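(* Let $\{X_n\}$ be the Bessel-like walk of the context and assume $\delta>-1$. For every $\theta>0$ there exists $\chi_0(\theta)>0$ such that for every $\chi\in(0,\chi_0)$ there exists $m_0(\theta,\chi)$ such that for all $m\ge m_0$ the following hold. (i) For all integers $1\le k<\sqrt{\chi m}$ with $m-k$ even, \[ (1-\theta)\frac{2^{2-\kappa}\kappa}{K_0\Gamma(\kappa)}m^{-(1+\kappa)}L(\sqrt m)M_k\le P_k(\tau_0=m)\le(1+\theta)\frac{2^{2-\kappa}\kappa}{K_0\Gamma(\kappa)}m^{-(1+\kappa)}L(\sqrt m)M_k . \] (ii) For all integers $k$ with $\sqrt{m\chi}\le k\le\sqrt{m/\chi}$ and $m-k$ even, \[ (1-\theta)\frac{2}{\Gamma(\kappa)m}\left(\frac{k^2}{2m}\right)^{\kappa}e^{-k^2/2m}\le P_k(\tau_0=m)\le(1+\theta)\frac{2}{\Gamma(\kappa)m}\left(\frac{k^2}{2m}\right)^{\kappa}e^{-k^2/2m}. \] (iii) For all integers $k>\sqrt{m/\chi}$ with $m-k$ even, \[ P_k(\tau_0=m)\le\frac1m e^{-k^2/8m}. \]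
   Context: Let $\{X_n\}_{n\ge0}$ be a Markov chain on $\mathbb{Z}_+=\{0,1,2,\dots\}$ with steps $\pm1$, reflecting at $0$ (i.e. $p(0,1)=1$), and for $x\ge1$ transition probabilities $p_x=p(x,x+1)$, $q_x=p(x,x-1)=1-p_x$. A drift parameter $\delta$ is fixed and $R_x$ is defined by $p_x=\frac12\left(1-\frac{\delta}{2x}+\frac{R_x}{2}\right)$, where it is assumed that $R_x=o(1/x)$ as $x\to\infty$. Uniform ellipticity is assumed: there is $\epsilon>0$ with $p_x,q_x\in[\epsilon,1-\epsilon]$ for all $x\ge1$. Set $\kappa=(1+\delta)/2$. Define $\lambda_0=1$, $\lambda_x=\prod_{k=1}^x q_k/p_k$ for $x\ge1$, $M_0=0$, $M_x=\sum_{k=0}^{x-1}\lambda_k$ for $x\ge1$, and $L(x)=\exp(R_1+\dots+R_x)$ for integers $x\ge1$, extended to $[1,\infty)$ by linear interpolation ($L$ is slowly varying). There is a constant $K_0>0$ such that $\lambda_x\sim K_0x^{2\kappa-1}L(x)^{-1}$ as $x\to\infty$; $K_0$ denotes this constant. $P_j$ denotes the law of the chain started at $j$, and $\tau_j=\min\{n\ge1:X_n=j\}$. *)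

theory Defs
  imports "HOL-Analysis.Analysis"
begin

text \<open>Bessel-like walk on the nonnegative integers. The parameter p gives p_x = p(x,x+1)
  for x \<ge> 1; q_x = 1 - p_x. At 0 the walk is reflecting: p(0,1) = 1 (the value p 0 is unused).\<close>

definition bw_step :: "(nat \<Rightarrow> real) \<Rightarrow> nat \<Rightarrow> nat \<Rightarrow> real" where
  "bw_step p x y =
     (if x = 0 then (if y = 1 then 1 else 0)
      else if y = Suc x then p x
      else if Suc y = x then 1 - p x
      else 0)"

text \<open>taboo0 p n y = P_y(X_n = 0 and X_j \<noteq> 0 for all 0 \<le> j < n).\<close>
fun taboo0 :: "(nat \<Rightarrow> real) \<Rightarrow> nat \<Rightarrow> nat \<Rightarrow> real" where
  "taboo0 p 0 y = (if y = 0 then 1 else 0)"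
| "taboo0 p (Suc n) y =
     (if y = 0 then 0 else p y * taboo0 p n (Suc y) + (1 - p y) * taboo0 p n (y - 1))"

text \<open>first_hit0 p k m = P_k(tau_0 = m), tau_0 = min{n \<ge> 1 : X_n = 0}.\<close>
definition first_hit0 :: "(nat \<Rightarrow> real) \<Rightarrow> nat \<Rightarrow> nat \<Rightarrow> real" where
  "first_hit0 p k m =
     (if m = 0 then 0 else (\<Sum>y\<le>Suc k. bw_step p k y * taboo0 p (m - 1) y))"

text \<open>R_x defined by p_x = (1 - delta/(2x) + R_x/2)/2.\<close>
definition Rterm :: "(nat \<Rightarrow> real) \<Rightarrow> real \<Rightarrow> nat \<Rightarrow> real" where
  "Rterm p \<delta> x = 4 * p x - 2 + \<delta> / real x"

definition lam :: "(nat \<Rightarrow> real) \<Rightarrow> nat \<Rightarrow> real" where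
  "lam p x = (\<Prod>k\<in>{1..x}. (1 - p k) / p k)"

definition Mfun :: "(nat \<Rightarrow> real) \<Rightarrow> nat \<Rightarrow> real" where
  "Mfun p x = (\<Sum>k<x. lam p k)"

definition Lnat :: "(nat \<Rightarrow> real) \<Rightarrow> real \<Rightarrow> nat \<Rightarrow> real" where
  "Lnat p \<delta> n = exp (\<Sum>j\<in>{1..n}. Rterm p \<delta> j)"

definition Lfun :: "(nat \<Rightarrow> real) \<Rightarrow> real \<Rightarrow> real \<Rightarrow> real" where
  "Lfun p \<delta> t = (let n = nat \<lfloor>t\<rfloor> in
      Lnat p \<delta> n + (t - real n) * (Lnat p \<delta> (Suc n) - Lnat p \<delta> n))"

definition kappa :: "real \<Rightarrow> real" where
  "kappa \<delta> = (1 + \<delta>) / 2"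

definition K0 :: "(nat \<Rightarrow> real) \<Rightarrow> real \<Rightarrow> real" where
  "K0 p \<delta> = lim (\<lambda>x. lam p x * Lnat p \<delta> x / real x powr (2 * kappa \<delta> - 1))"

end

theory Submission
  imports Defs "HOL-Real_Asymp.Real_Asymp"
begin

text \<open>
  The function \<open>M\<close> is harmonic for the walk killed at \<open>0\<close>. Hence \<open>P\<^sub>k(\<tau>\<^sub>0 = n + 1) = M k * v n k\<close>,
  where \<open>v n k\<close> is up to a constant the probability that the Doob transform of the walk by \<open>M\<close>,
  which never visits \<open>0\<close>, goes from \<open>k\<close> to \<open>1\<close> in \<open>n\<close> steps. The transformed chain is again
  Bessel-like, with drift \<open>(\<kappa> + 1/2) / x\<close>, and it is reversible with respect to a weight \<open>wt\<close>, so that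
  \<open>wt k * v n k\<close> is the law of its position at time \<open>n\<close> when it starts in \<open>1\<close>.

  Gaussian test functions show that \<open>X\<^sub>n\<^sup>2 / (2 (n + 1))\<close> converges in law to a Gamma distribution with
  parameter \<open>\<kappa> + 1\<close>. As \<open>1\<close> is the lowest state, stochastic monotonicity makes \<open>v n\<close> decreasing along
  a parity class, and this turns the convergence in law into a local limit theorem for \<open>k\<close> of order
  \<open>sqrt n\<close>; since \<open>wt\<close> is regularly varying, the slowly varying errors disappear in the
  normalisation. For small \<open>k\<close> the Chapman-Kolmogorov equation bounds \<open>v n k\<close> from above by its values
  at distance of order \<open>sqrt n\<close>, and for large \<open>k\<close> an exponential moment of
  \<open>X\<^sub>n\<^sup>2\<close> gives the tail estimate.
\<close>

subsection \<open>The Doob transform\<close>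

text \<open>The drift is known only up to \<open>o(1/x)\<close>, without a rate, so no quantitative
  expansion of the transition probabilities is available. Two things take its place. The transformed
  chain looks like a Bessel process of dimension \<open>2 * kap + 2 > 2\<close>; it escapes to
  infinity, hence the accumulated error in the drift is a Cesaro mean of a null sequence. And
  monotonicity of \<open>v n\<close> allows it to be compared with averages over thin shells, so
  that only interval probabilities are required.

  The constant in (i) is forced. With \<open>m = n + 1\<close> and \<open>y = k^2 / (2 * m)\<close>,
  the mass \<open>wt k * v n k\<close> must reproduce the density
  \<open>y powr kap * exp (- y) / Gamma (kap + 1)\<close> on a lattice of spacing 2, while
  \<open>wt k\<close> grows like a constant times \<open>k powr (2 * kap + 1) / L k\<close>.
  Dividing gives \<open>v n k\<close> close to \<open>cc m * exp (- y)\<close>. For \<open>k\<close>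
  of order \<open>sqrt m\<close>, multiplication by \<open>M k\<close> cancels \<open>K0\<close> and
  \<open>L\<close> and yields (ii); for \<open>k\<close> far below \<open>sqrt m\<close> the
  exponential is close to 1, which is (i). The range down to \<open>k = 1\<close> is the delicate
  one, since the limit law carries almost no mass there.\<close>

locale bessel_walk =
  fixes p :: "nat \<Rightarrow> real" and \<delta> \<epsilon> :: real
  assumes delta: "\<delta> > -1"
    and eps_pos: "\<epsilon> > 0"
    and ellip: "\<And>x. x \<ge> 1 \<Longrightarrow> \<epsilon> \<le> p x \<and> p x \<le> 1 - \<epsilon>"
    and R_small: "(\<lambda>x. real x * Rterm p \<delta> x) \<longlonglongrightarrow> 0"
begin

abbreviation kap :: real where "kap \<equiv> kappa \<delta>"
abbreviation lm :: "nat \<Rightarrow> real" where "lm \<equiv> lam p"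
abbreviation M :: "nat \<Rightarrow> real" where "M \<equiv> Mfun p"

text \<open>\<open>up\<close> and \<open>dn\<close> are the transition probabilities of the Doob transform by \<open>M\<close>, \<open>T\<close> is its
  transition operator, and \<open>E n\<close> is the expectation at time \<open>n\<close> for the start in \<open>1\<close>. At \<open>k = 0\<close>
  these are junk values (\<open>M 0 = 0\<close>) that never matter.\<close>

definition up :: "nat \<Rightarrow> real" where "up k = p k * M (Suc k) / M k"
definition dn :: "nat \<Rightarrow> real" where "dn k = (1 - p k) * M (k - 1) / M k"
definition T :: "(nat \<Rightarrow> real) \<Rightarrow> nat \<Rightarrow> real" where
  "T \<phi> k = up k * \<phi> (Suc k) + dn k * \<phi> (k - 1)"
text \<open>The reversible weight \<open>1 / (p k * lm k)\<close> of the original walk times the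
  square of the transforming function. The value \<open>wt 1 = 1 / (1 - p 1)\<close> cancels the
  last step from 1 to 0 that is contained in \<open>v\<close>, so that \<open>E n\<close> has total
  mass 1.\<close>

definition wt :: "nat \<Rightarrow> real" where "wt k = (M k)\<^sup>2 / (p k * lm k)"
definition v :: "nat \<Rightarrow> nat \<Rightarrow> real" where "v n k = taboo0 p (Suc n) k / M k"
definition E :: "nat \<Rightarrow> (nat \<Rightarrow> real) \<Rightarrow> real" where
  "E n \<phi> = (\<Sum>k\<in>{1..Suc n}. wt k * v n k * \<phi> k)"

lemma kap_pos: "kap > 0" using delta by (simp add: kappa_def)

lemma p_pos: "x \<ge> 1 \<Longrightarrow> 0 < p x" and q_pos: "x \<ge> 1 \<Longrightarrow> p x < 1"
  using ellip[of x] eps_pos by auto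

lemma lam_0 [simp]: "lm 0 = 1" by (simp add: lam_def)

lemma lam_Suc: "lm (Suc x) = lm x * ((1 - p (Suc x)) / p (Suc x))"
  by (simp add: lam_def)

lemma lam_pos: "lm x > 0"
  by (induction x) (auto simp: lam_Suc p_pos q_pos)

lemma lam_balance: "p (Suc x) * lm (Suc x) = (1 - p (Suc x)) * lm x"
  using p_pos[of "Suc x"] by (simp add: lam_Suc)

lemma M_0 [simp]: "M 0 = 0" by (simp add: Mfun_def)
lemma M_Suc: "M (Suc x) = M x + lm x" by (simp add: Mfun_def)
lemma M_1: "M (Suc 0) = 1" by (simp add: M_Suc)

lemma M_mono: "x \<le> y \<Longrightarrow> M x \<le> M y"
  by (rule lift_Suc_mono_le[of M]) (auto simp: M_Suc less_imp_le lam_pos)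

lemma M_ge1: "x \<ge> 1 \<Longrightarrow> M x \<ge> 1"
  using M_mono[of "Suc 0" x] by (simp add: M_1)

lemma M_pos: "x \<ge> 1 \<Longrightarrow> M x > 0"
  using M_ge1[of x] by linarith

lemma M_nonneg: "M x \<ge> 0"
  using M_mono[of 0 x] by simp

lemma M_harmonic: "p (Suc x) * M (Suc (Suc x)) + (1 - p (Suc x)) * M x = M (Suc x)"
  using lam_balance[of x] by (simp add: M_Suc algebra_simps)

lemma up_dn: "k \<ge> 1 \<Longrightarrow> up k + dn k = 1"
proof -
  assume "k \<ge> 1" then obtain x where x: "k = Suc x" by (cases k) auto
  show ?thesis using M_harmonic[of x] M_pos[of k] x
    by (simp add: up_def dn_def add_divide_distrib[symmetric])
qed

lemma up_nonneg: "k \<ge> 1 \<Longrightarrow> up k \<ge> 0"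
  using p_pos[of k] M_nonneg by (auto simp: up_def intro!: divide_nonneg_nonneg mult_nonneg_nonneg)
lemma dn_nonneg: "k \<ge> 1 \<Longrightarrow> dn k \<ge> 0"
  using q_pos[of k] M_nonneg by (auto simp: dn_def intro!: divide_nonneg_nonneg mult_nonneg_nonneg)
lemma dn_1 [simp]: "dn (Suc 0) = 0" by (simp add: dn_def)
lemma up_1 [simp]: "up (Suc 0) = 1" using up_dn[of 1] by simp

lemma wt_pos: "k \<ge> 1 \<Longrightarrow> wt k > 0"
  using M_pos[of k] p_pos[of k] lam_pos[of k] by (simp add: wt_def)

lemma wt_balance: "k \<ge> 1 \<Longrightarrow> wt k * up k = wt (Suc k) * dn (Suc k)"
proof -
  assume k: "k \<ge> 1"
  have pk: "p k \<noteq> 0" "p (Suc k) \<noteq> 0" "1 - p (Suc k) \<noteq> 0" using p_pos[of k] p_pos[of "Suc k"] q_pos[of "Suc k"] k by auto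
  have a: "wt k * up k = M k * M (Suc k) / lm k"
    using M_pos[of k] k pk by (simp add: wt_def up_def power2_eq_square)
  have b: "wt (Suc k) * dn (Suc k) = M k * M (Suc k) * ((1 - p (Suc k)) / (p (Suc k) * lm (Suc k)))"
    using M_pos[of "Suc k"] by (simp add: wt_def dn_def power2_eq_square)
  have c: "(1 - p (Suc k)) / (p (Suc k) * lm (Suc k)) = 1 / lm k"
    unfolding lam_balance using pk by simp
  show "wt k * up k = wt (Suc k) * dn (Suc k)" unfolding a b c by simp
qed

lemma first_hit0_eq:
  assumes "k \<ge> 1"
  shows "first_hit0 p k (Suc n) = v n k * M k"
proof -
  obtain x where x: "k = Suc x" using assms by (cases k) auto
  have "(\<Sum>y\<le>Suc k. bw_step p k y * taboo0 p n y)
      = (\<Sum>y\<in>{x, Suc k}. bw_step p k y * taboo0 p n y)"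
    using x by (intro sum.mono_neutral_right) (auto simp: bw_step_def)
  also have "\<dots> = taboo0 p (Suc n) k"
    using x by (simp add: bw_step_def)
  finally show ?thesis using M_pos[OF assms] by (simp add: first_hit0_def v_def)
qed

lemma v_0: "k \<ge> 1 \<Longrightarrow> v 0 k = (if k = 1 then 1 - p 1 else 0)"
  by (auto simp: v_def M_1)

lemma v_nonneg: "v n k \<ge> 0"
proof -
  have "taboo0 p n k \<ge> 0" for n k
    by (induction n arbitrary: k)
       (auto intro!: add_nonneg_nonneg mult_nonneg_nonneg simp: less_imp_le p_pos q_pos)
  then show ?thesis unfolding v_def by (intro divide_nonneg_nonneg M_nonneg)
qed

lemma v_Suc: "k \<ge> 1 \<Longrightarrow> v (Suc n) k = T (v n) k"
proof -
  assume "k \<ge> 1" then obtain x where x: "k = Suc x" by (cases k) auto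
  show ?thesis
  proof (cases x)
    \<comment> \<open>The left neighbour is the junk point 0: the taboo probability there at a
      positive time and \<open>dn 1\<close> both vanish.\<close>
    case 0 then show ?thesis using M_pos[of 2]
      by (simp add: v_def T_def x M_1 up_def numeral_2_eq_2)
  next
    case (Suc y)
    have "taboo0 p (Suc (Suc n)) k = p k * taboo0 p (Suc n) (Suc k) + (1 - p k) * taboo0 p (Suc n) (k - 1)"
      using x by simp
    then show ?thesis using M_pos[of x] M_pos[of "Suc k"] x Suc
      by (simp add: v_def T_def up_def dn_def add_divide_distrib del: taboo0.simps)
  qed
qed

lemma v_support: "k > Suc n \<Longrightarrow> v n k = 0"
proof -
  have "k > n \<Longrightarrow> taboo0 p n k = 0" for n k
    by (induction n arbitrary: k) auto
  then show "k > Suc n \<Longrightarrow> v n k = 0" by (simp add: v_def)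
qed

lemma v_parity: "odd (Suc n + k) \<Longrightarrow> v n k = 0"
proof -
  have "odd (n + k) \<Longrightarrow> taboo0 p n k = 0" for n k
  proof (induction n arbitrary: k)
    case 0 then show ?case by (cases k) auto
  next
    case (Suc n) then show ?case by (cases k) auto
  qed
  then show "odd (Suc n + k) \<Longrightarrow> v n k = 0" unfolding v_def by simp
qed

text \<open>Nearest-neighbour paths of equal parity cannot cross without meeting.\<close>
lemma v_add_2_le: "k \<ge> 1 \<Longrightarrow> v n (k + 2) \<le> v n k"
  and v_ge_step: "k \<ge> 1 \<Longrightarrow> v n (Suc k) \<le> v (Suc n) k"
  and v_le_step: "k \<ge> 1 \<Longrightarrow> v (Suc n) (Suc k) \<le> v n k"
proof -
  \<comment> \<open>Both step inequalities are conditional on monotonicity at time \<open>n\<close>: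
    a value at time \<open>n + 1\<close> is an average of two neighbouring values at time
    \<open>n\<close>, and monotonicity says which of the two is larger. Chaining them then gives
    monotonicity at time \<open>n + 1\<close>.\<close>
  have step: "v n (Suc k) \<le> v (Suc n) k"
    if *: "\<And>k. k \<ge> 1 \<Longrightarrow> v n (k + 2) \<le> v n k" and k: "k \<ge> 1" for n k
  proof (cases "k = 1")
    case True then show ?thesis by (simp add: v_Suc T_def)
  next
    case False
    then have "v n (Suc k) \<le> v n (k - 1)" using *[of "k - 1"] k by (simp add: numeral_2_eq_2)
    have "v n (Suc k) = up k * v n (Suc k) + dn k * v n (Suc k)"
      using up_dn[OF k] by (metis distrib_right mult_1)
    also have "\<dots> \<le> v (Suc n) k"
      using \<open>v n (Suc k) \<le> v n (k - 1)\<close> dn_nonneg[OF k] k by (simp add: v_Suc T_def mult_left_mono)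
    finally show ?thesis .
  qed
  have step2: "v (Suc n) (Suc k) \<le> v n k"
    if *: "\<And>k. k \<ge> 1 \<Longrightarrow> v n (k + 2) \<le> v n k" and k: "k \<ge> 1" for n k
  proof -
    have "v (Suc n) (Suc k) \<le> up (Suc k) * v n k + dn (Suc k) * v n k"
      using *[OF k] up_nonneg[of "Suc k"] by (simp add: v_Suc T_def mult_left_mono)
    also have "\<dots> = v n k" using up_dn[of "Suc k"] by (metis distrib_right mult_1 le_add1 plus_1_eq_Suc)
    finally show ?thesis .
  qed
  show 1: "k \<ge> 1 \<Longrightarrow> v n (k + 2) \<le> v n k" for n k
  proof (induction n arbitrary: k)
    case 0 then show ?case by (auto simp: v_0 q_pos less_imp_le)
  next
    case (Suc n)
    have "v (Suc n) (Suc (Suc k)) \<le> v n (Suc k)" using Suc by (intro step2) auto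
    also have "\<dots> \<le> v (Suc n) k" using Suc by (intro step) auto
    finally show ?case by simp
  qed
  show "k \<ge> 1 \<Longrightarrow> v n (Suc k) \<le> v (Suc n) k" using step[OF 1] by blast
  show "k \<ge> 1 \<Longrightarrow> v (Suc n) (Suc k) \<le> v n k" using step2[OF 1] by blast
qed

lemma v_antimono:
  assumes "1 \<le> k" "k \<le> l" "even (k + l)"
  shows "v n l \<le> v n k"
proof -
  obtain i where i: "l = k + 2 * i" 
    using assms(2,3) by (metis evenE le_add_diff_inverse even_diff_nat even_add le_iff_add)
  have "v n (k + 2 * i) \<le> v n k"
  proof (induction i)
    case (Suc i)
    then show ?case using v_add_2_le[of "k + 2 * i" n] assms(1) by (simp add: numeral_2_eq_2)
  qed simp
  then show ?thesis using i by simp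
qed

lemma E_cong: "(\<And>k. k \<ge> 1 \<Longrightarrow> \<phi> k = \<psi> k) \<Longrightarrow> E n \<phi> = E n \<psi>"
  by (auto simp: E_def intro!: sum.cong)

lemma E_mono: "(\<And>k. k \<ge> 1 \<Longrightarrow> \<phi> k \<le> \<psi> k) \<Longrightarrow> E n \<phi> \<le> E n \<psi>"
  unfolding E_def by (intro sum_mono mult_left_mono) (auto simp: v_nonneg wt_pos less_imp_le)

lemma E_nonneg: "(\<And>k. k \<ge> 1 \<Longrightarrow> 0 \<le> \<phi> k) \<Longrightarrow> 0 \<le> E n \<phi>"
  unfolding E_def by (intro sum_nonneg mult_nonneg_nonneg) (auto simp: v_nonneg wt_pos less_imp_le)

lemma E_add: "E n (\<lambda>k. \<phi> k + \<psi> k) = E n \<phi> + E n \<psi>"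
  by (simp add: E_def distrib_left sum.distrib)

lemma E_diff: "E n (\<lambda>k. \<phi> k - \<psi> k) = E n \<phi> - E n \<psi>"
  by (simp add: E_def right_diff_distrib sum_subtractf)

lemma E_cmult: "E n (\<lambda>k. c * \<phi> k) = c * E n \<phi>"
  unfolding E_def sum_distrib_left by (simp add: mult.left_commute)

lemma E_sum: "E n (\<lambda>k. \<Sum>i\<in>I. \<phi> i k) = (\<Sum>i\<in>I. E n (\<phi> i))"
  unfolding E_def sum_distrib_left by (rule sum.swap)

lemma E_abs: "\<bar>E n \<phi>\<bar> \<le> E n (\<lambda>k. \<bar>\<phi> k\<bar>)"
proof -
  have "E n (\<lambda>k. - 1 * \<bar>\<phi> k\<bar>) \<le> E n \<phi>" "E n \<phi> \<le> E n (\<lambda>k. \<bar>\<phi> k\<bar>)"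
    by (rule E_mono; simp)+
  then show ?thesis unfolding E_cmult by simp
qed

lemma E_0: "E 0 \<phi> = \<phi> 1"
  using p_pos[of 1] q_pos[of 1] by (simp add: E_def v_0 wt_def M_1 lam_Suc)

text \<open>Detailed balance makes \<open>T\<close> self-adjoint for \<open>wt\<close>, so the
  operator that advances \<open>v n\<close> can be moved to the test function. The boundary terms of
  the index shifts vanish by \<open>dn 1 = 0\<close> and by the support of
  \<open>v n\<close>.\<close>

lemma E_Suc: "E (Suc n) \<phi> = E n (T \<phi>)"
proof -
  let ?c = "\<lambda>k. wt k * up k"
  have A: "(\<Sum>k\<in>{1..Suc n}. ?c k * v n k * \<phi> (Suc k))
      = (\<Sum>j\<in>{1..Suc (Suc n)}. wt j * dn j * v n (j - 1) * \<phi> j)"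
  proof -
    have "(\<Sum>j\<in>{1..Suc (Suc n)}. wt j * dn j * v n (j - 1) * \<phi> j)
        = (\<Sum>j\<in>{Suc 1..Suc (Suc n)}. wt j * dn j * v n (j - 1) * \<phi> j)"
      by (intro sum.mono_neutral_right) (auto simp: not_less_eq_eq le_Suc_eq)
    also have "\<dots> = (\<Sum>k\<in>{1..Suc n}. ?c k * v n k * \<phi> (Suc k))"
      unfolding sum.shift_bounds_cl_Suc_ivl
      by (intro sum.cong) (auto simp: wt_balance)
    finally show ?thesis by simp
  qed
  have B: "(\<Sum>k\<in>{1..Suc n}. wt k * dn k * v n k * \<phi> (k - 1))
      = (\<Sum>j\<in>{1..Suc (Suc n)}. ?c j * v n (Suc j) * \<phi> j)"
  proof -
    have "(\<Sum>j\<in>{1..Suc (Suc n)}. ?c j * v n (Suc j) * \<phi> j)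
        = (\<Sum>j\<in>{1..n}. ?c j * v n (Suc j) * \<phi> j)"
      by (intro sum.mono_neutral_right) (auto simp: v_support)
    also have "\<dots> = (\<Sum>k\<in>{Suc 1..Suc n}. wt k * dn k * v n k * \<phi> (k - 1))"
      unfolding sum.shift_bounds_cl_Suc_ivl
      by (intro sum.cong) (auto simp: wt_balance)
    also have "\<dots> = (\<Sum>k\<in>{1..Suc n}. wt k * dn k * v n k * \<phi> (k - 1))"
      by (intro sum.mono_neutral_left) (auto simp: not_less_eq_eq le_Suc_eq)
    finally show ?thesis by simp
  qed
  have "E n (T \<phi>) = (\<Sum>k\<in>{1..Suc n}. ?c k * v n k * \<phi> (Suc k))
      + (\<Sum>k\<in>{1..Suc n}. wt k * dn k * v n k * \<phi> (k - 1))"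
    unfolding E_def sum.distrib[symmetric] T_def by (intro sum.cong) (auto simp: algebra_simps)
  also have "\<dots> = E (Suc n) \<phi>"
    unfolding A B E_def sum.distrib[symmetric]
    by (intro sum.cong) (auto simp: v_Suc T_def algebra_simps)
  finally show ?thesis by simp
qed

lemma E_const: "E n (\<lambda>_. c) = c"
proof (induction n)
  case (Suc n)
  have "E (Suc n) (\<lambda>_. c) = E n (\<lambda>_. c)"
    unfolding E_Suc by (intro E_cong) (simp add: T_def distrib_right[symmetric] up_dn)
  then show ?case using Suc by simp
qed (simp add: E_0)

text \<open>Here \<open>v n\<close> itself serves as test function. This is the link from values of
  \<open>v\<close> at distance of order \<open>sqrt n\<close>, where the limit law is informative,
  to its value at 1.\<close>

lemma chapman_kolmogorov: "E s (v n) = v (n + s) 1"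
proof (induction s arbitrary: n)
  case (Suc s)
  have "E (Suc s) (v n) = E s (v (Suc n))"
    unfolding E_Suc by (intro E_cong) (simp add: v_Suc)
  then show ?case using Suc by simp
qed (simp add: E_0)

end

subsection \<open>Regular variation\<close>

text \<open>The ratio of increments is a separate sequence \<open>r\<close>, which avoids dividing
  by increments of \<open>b\<close>. It serves both for regular variation of \<open>M\<close> and
  for Cesaro means.\<close>

lemma stolz_cesaro:
  fixes a b :: "nat \<Rightarrow> real"
  assumes b: "filterlim b at_top sequentially" and inc: "\<And>n. b n \<le> b (Suc n)"
    and r: "\<And>n. a (Suc n) - a n = r n * (b (Suc n) - b n)" and l: "r \<longlonglongrightarrow> l"
  shows "(\<lambda>n. a n / b n) \<longlonglongrightarrow> l"
proof (rule LIMSEQ_I)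
  fix e :: real assume e: "e > 0"
  obtain N where N: "\<And>n. n \<ge> N \<Longrightarrow> \<bar>r n - l\<bar> \<le> e / 2"
    using LIMSEQ_D[OF l, of "e/2"] e by (force intro: less_imp_le)
  have key: "\<bar>(a n - l * b n) - (a N - l * b N)\<bar> \<le> e / 2 * (b n - b N)" if "n \<ge> N" for n
    using that
  proof (induction n rule: dec_induct)
    case (step n)
    have "(a (Suc n) - l * b (Suc n)) - (a n - l * b n) = (r n - l) * (b (Suc n) - b n)"
      using r[of n] by (simp add: algebra_simps)
    also have "\<bar>\<dots>\<bar> \<le> e / 2 * (b (Suc n) - b n)"
      using mult_right_mono[OF N[of n], of "b (Suc n) - b n"] inc[of n] step by (simp add: abs_mult)
    finally have "\<bar>(a (Suc n) - l * b (Suc n)) - (a n - l * b n)\<bar> + \<bar>(a n - l * b n) - (a N - l * b N)\<bar>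
      \<le> e / 2 * (b (Suc n) - b n) + e / 2 * (b n - b N)"
      using step.IH by (intro add_mono)
    also have "\<dots> = e / 2 * (b (Suc n) - b N)" by (simp add: field_simps)
    finally show ?case by linarith
  qed simp
  define C where "C = \<bar>a N - l * b N\<bar> + e / 2 * \<bar>b N\<bar> + 1"
  have "eventually (\<lambda>n. b n > 2 * C / e) sequentially"
    using b by (simp add: filterlim_at_top_dense)
  then have "eventually (\<lambda>n. norm (a n / b n - l) < e) sequentially"
    using eventually_ge_at_top[of N]
  proof eventually_elim
    case (elim n)
    have C: "C > 0" using e by (simp add: C_def add_nonneg_pos)
    then have bn: "b n > 0" using elim(1) e by (meson divide_pos_pos less_trans mult_pos_pos zero_less_numeral)
    have "\<bar>a n - l * b n\<bar> \<le> e / 2 * b n + C - 1"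
    proof -
      have "e / 2 * (b n - b N) \<le> e / 2 * b n + e / 2 * \<bar>b N\<bar>"
        unfolding distrib_left[symmetric] using e by (intro mult_left_mono) auto
      then show ?thesis using key[OF elim(2)] unfolding C_def by linarith
    qed
    also have "\<dots> < e / 2 * b n + C" by simp
    also have "\<dots> < e * b n" using elim(1) e by (simp add: field_simps)
    finally have "\<bar>a n - l * b n\<bar> / b n < e" using bn by (simp add: field_simps)
    moreover have "a n / b n - l = (a n - l * b n) / b n" using bn by (simp add: field_simps)
    ultimately show ?case using bn by (simp add: abs_divide)
  qed
  then show "\<exists>no. \<forall>n\<ge>no. norm (a n / b n - l) < e"
    by (simp add: eventually_at_top_linorder)
qed

context bessel_walk
begin

abbreviation L :: "nat \<Rightarrow> real" where "L \<equiv> Lnat p \<delta>"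
abbreviation R :: "nat \<Rightarrow> real" where "R \<equiv> Rterm p \<delta>"

lemma p_minus_q_lim: "(\<lambda>x. real x * (2 * p x - 1)) \<longlonglongrightarrow> - \<delta> / 2"
proof -
  have "(\<lambda>x. (real x * R x - \<delta>) / 2) \<longlonglongrightarrow> (0 - \<delta>) / 2"
    by (intro tendsto_intros R_small) auto
  moreover have "eventually (\<lambda>x. (real x * R x - \<delta>) / 2 = real x * (2 * p x - 1)) sequentially"
    using eventually_gt_at_top[of 0] by eventually_elim (simp add: Rterm_def field_simps)
  ultimately show ?thesis by (simp add: tendsto_cong)
qed

lemma p_lim: "p \<longlonglongrightarrow> 1/2"
proof -
  have "(\<lambda>x. (real x * (2 * p x - 1) * (1 / real x) + 1) / 2) \<longlonglongrightarrow> (- \<delta> / 2 * 0 + 1) / 2"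
    by (intro tendsto_intros p_minus_q_lim lim_1_over_n) auto
  moreover have "eventually (\<lambda>x. (real x * (2 * p x - 1) * (1 / real x) + 1) / 2 = p x) sequentially"
    using eventually_gt_at_top[of 0] by eventually_elim (simp add: field_simps)
  ultimately show ?thesis by (simp add: tendsto_cong)
qed

lemma lam_ratio_lim: "(\<lambda>x. real (Suc x) * ((1 - p (Suc x)) / p (Suc x) - 1)) \<longlonglongrightarrow> \<delta>"
proof -
  have "(\<lambda>x. - (real x * (2 * p x - 1)) / p x) \<longlonglongrightarrow> - (- \<delta> / 2) / (1/2)"
    by (intro tendsto_intros p_minus_q_lim p_lim) auto
  then have "(\<lambda>x. - (real (Suc x) * (2 * p (Suc x) - 1)) / p (Suc x)) \<longlonglongrightarrow> \<delta>"
    by (intro LIMSEQ_Suc) simp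
  moreover have "- (real (Suc x) * (2 * p (Suc x) - 1)) / p (Suc x)
     = real (Suc x) * ((1 - p (Suc x)) / p (Suc x) - 1)" for x
    using p_pos[of "Suc x"] by (simp add: field_simps)
  ultimately show ?thesis by simp
qed

text \<open>With \<open>u = 2 * p x - 1\<close> the logarithm is \<open>- 2 * u + O(u^2)\<close>,
  and \<open>R x - \<delta> / x\<close> is exactly \<open>2 * u\<close>. Since
  \<open>u = O(1/x)\<close>, the sum is dominated by that of \<open>1/x^2\<close>. Thus
  \<open>L\<close> collects precisely the part of \<open>lm\<close> that need not converge.\<close>

lemma ln_ratio_summable: "summable (\<lambda>x. ln ((1 - p x) / p x) + R x - \<delta> / real x)"
proof -
  obtain C where C: "\<And>x. \<bar>real x * (2 * p x - 1)\<bar> \<le> C"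
    using convergent_imp_Bseq[OF convergentI[OF p_minus_q_lim]] by (auto simp: Bseq_def)
  have "eventually (\<lambda>x. \<bar>p x - 1/2\<bar> < 1/4) sequentially"
    using tendstoD[OF p_lim, of "1/4"] by (simp add: dist_real_def)
  then have "eventually (\<lambda>x. norm (ln ((1 - p x) / p x) + R x - \<delta> / real x) \<le> 4 * C\<^sup>2 * (1 / (real x)\<^sup>2)) sequentially"
    using eventually_gt_at_top[of 0]
  proof eventually_elim
    case (elim x)
    define u where "u = 2 * p x - 1"
    have u: "\<bar>u\<bar> \<le> 1/2" "p x = (1 + u) / 2" "1 - p x = (1 - u) / 2"
      using elim by (auto simp: u_def field_simps abs_if split: if_splits)
    have "ln ((1 - p x) / p x) = ln (1 + - u) - ln (1 + u)"
    proof -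
      have "(1 - p x) / p x = (1 + - u) / (1 + u)" 
      proof -
        have "(A / 2) / (B / 2) = A / B" for A B :: real by simp
        then show ?thesis by (subst u(3), subst u(2)) (simp only: diff_conv_add_uminus)
      qed
      moreover have "1 + - u > 0" "1 + u > 0" using u(1) by linarith+
      ultimately show ?thesis by (simp add: ln_div del: add_uminus_conv_diff)
    qed
    moreover have "R x - \<delta> / real x = 2 * u" by (simp add: Rterm_def u_def)
    ultimately have "ln ((1 - p x) / p x) + R x - \<delta> / real x = (ln (1 + - u) - (- u)) - (ln (1 + u) - u)"
      by simp
    also have "\<bar>\<dots>\<bar> \<le> 2 * (- u)\<^sup>2 + 2 * u\<^sup>2"
      using abs_ln_one_plus_x_minus_x_bound[of u] abs_ln_one_plus_x_minus_x_bound[of "-u"] u(1) by linarith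
    also have "\<dots> = 4 * (real x * u)\<^sup>2 * (1 / (real x)\<^sup>2)"
      using elim by (simp add: power_mult_distrib)
    also have "\<dots> \<le> 4 * C\<^sup>2 * (1 / (real x)\<^sup>2)"
      using power_mono[OF C[of x], of 2] by (intro mult_right_mono) (auto simp: u_def)
    finally show ?case by simp
  qed
  moreover have "summable (\<lambda>x. 4 * C\<^sup>2 * (1 / (real x)\<^sup>2))"
    using inverse_power_summable[of 2] by (intro summable_mult) (simp add: inverse_eq_divide)
  ultimately show ?thesis by (rule summable_comparison_test_ev)
qed

lemma K0_pos: "K0 p \<delta> > 0" and lam_asymp: "(\<lambda>x. lm x * L x / real x powr (2 * kap - 1)) \<longlonglongrightarrow> K0 p \<delta>"
proof -
  let ?t = "\<lambda>x. ln ((1 - p x) / p x) + R x - \<delta> / real x"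
  let ?f = "\<lambda>x. lm x * L x / real x powr (2 * kap - 1)"
  obtain s where s: "(\<lambda>n. \<Sum>x<n. ?t x) \<longlonglongrightarrow> s"
    using ln_ratio_summable by (auto simp: summable_def sums_def)
  \<comment> \<open>The product \<open>lm\<close> starts at index 1, hence the junk summand
    \<open>?t 0\<close> is removed; the harmonic sum contributes the power of \<open>x\<close> and
    Euler's constant.\<close>
  have L1: "(\<lambda>x. exp ((\<Sum>k<Suc x. ?t k) - ?t 0 + \<delta> * (harm x - ln (real x))))
     \<longlonglongrightarrow> exp (s - ?t 0 + \<delta> * euler_mascheroni)"
    by (intro tendsto_intros LIMSEQ_Suc[OF s] euler_mascheroni_LIMSEQ)
  have "eventually (\<lambda>x. exp ((\<Sum>k<Suc x. ?t k) - ?t 0 + \<delta> * (harm x - ln (real x))) = ?f x) sequentially"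
    using eventually_gt_at_top[of 0]
  proof eventually_elim
    case (elim x)
    have "(\<Sum>k<Suc x. ?t k) - ?t 0 = (\<Sum>k\<in>{1..x}. ?t k)"
      unfolding lessThan_Suc_atMost atMost_atLeast0 by (subst sum.atLeast_Suc_atMost) simp_all
    also have "\<dots> = (\<Sum>k\<in>{1..x}. ln ((1 - p k) / p k)) + (\<Sum>k\<in>{1..x}. R k) - \<delta> * harm x"
      by (simp add: sum.distrib sum_subtractf sum_distrib_left harm_def inverse_eq_divide)
    also have "(\<Sum>k\<in>{1..x}. ln ((1 - p k) / p k)) = ln (lm x)"
      unfolding lam_def by (subst ln_prod) (use p_pos q_pos in \<open>force+\<close>)
    finally have "(\<Sum>k<Suc x. ?t k) - ?t 0 + \<delta> * (harm x - ln (real x))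
       = ln (lm x) + (\<Sum>k\<in>{1..x}. R k) - \<delta> * ln (real x)"
      by (simp add: algebra_simps)
    moreover have "2 * kap - 1 = \<delta>" by (simp add: kappa_def field_simps)
    ultimately show ?case
      using elim lam_pos[of x] by (simp add: exp_diff exp_add Lnat_def powr_def)
  qed
  with L1 have L2: "?f \<longlonglongrightarrow> exp (s - ?t 0 + \<delta> * euler_mascheroni)" by (simp add: tendsto_cong)
  then have "K0 p \<delta> = exp (s - ?t 0 + \<delta> * euler_mascheroni)"
    unfolding K0_def by (rule limI)
  with L2 show "K0 p \<delta> > 0" "?f \<longlonglongrightarrow> K0 p \<delta>" by simp_all
qed

text \<open>Here \<open>\<delta> > -1\<close> enters: it makes \<open>x * lm x\<close> eventually
  nondecreasing, so \<open>lm\<close> dominates a multiple of the harmonic series. Divergence of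
  \<open>M\<close> expresses that the original walk is recurrent.\<close>

lemma M_at_top: "filterlim M at_top sequentially"
proof -
  let ?e = "\<lambda>x. real (Suc x) * ((1 - p (Suc x)) / p (Suc x) - 1)"
  have "eventually (\<lambda>x. ?e x > -1) sequentially"
    using order_tendstoD(1)[OF lam_ratio_lim delta] .
  then obtain N where N: "\<And>x. x \<ge> N \<Longrightarrow> ?e x > -1" by (auto simp: eventually_at_top_linorder)
  define N' where "N' = Suc N"
  define c where "c = real N' * lm N'"
  have c: "c > 0" by (simp add: c_def N'_def lam_pos)
  have ge: "real x * lm x \<ge> c" if "x \<ge> N'" for x using that
  proof (induction x rule: dec_induct)
    case (step x)
    have "real (Suc x) * lm (Suc x) - real x * lm x = lm x * (1 + ?e x)"
      by (simp add: lam_Suc algebra_simps)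
    moreover have "lm x * (1 + ?e x) \<ge> 0"
      using N[of x] step by (intro mult_nonneg_nonneg less_imp_le[OF lam_pos]) (auto simp: N'_def)
    ultimately show ?case using step.IH by linarith
  qed (simp add: c_def)
  have "\<not> summable lm"
  proof
    assume "summable lm"
    then have "summable (\<lambda>x. lm x / c)" by (rule summable_divide)
    moreover have "eventually (\<lambda>x. norm (inverse (real x)) \<le> lm x / c) sequentially"
      using eventually_ge_at_top[of N']
    proof eventually_elim
      case (elim x)
      then have "x > 0" by (simp add: N'_def)
      then show ?case using ge[OF elim] c by (simp add: field_simps)
    qed
    ultimately have "summable (\<lambda>x. inverse (real x))" by (rule summable_comparison_test_ev[rotated])
    then show False using not_summable_harmonic[where 'a = real] by simp
  qed
  have "\<exists>x. M x > B" for B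
  proof (rule ccontr)
    assume "\<nexists>x. M x > B"
    then have "summable lm" 
      by (intro summableI_nonneg_bounded[of lm B]) (auto simp: Mfun_def not_less less_imp_le lam_pos)
    with \<open>\<not> summable lm\<close> show False by simp
  qed
  then show ?thesis
    unfolding filterlim_at_top eventually_at_top_linorder
    by (meson M_mono less_imp_le order_trans)
qed

text \<open>Karamata's theorem for \<open>M\<close>: relative to \<open>lm\<close>, the increments
  of \<open>x * lm x\<close> tend to \<open>1 + \<delta> = 2 * kap\<close>.\<close>

lemma lam_over_M_lim: "(\<lambda>x. real x * lm x / M x) \<longlonglongrightarrow> 2 * kap"
proof (rule stolz_cesaro[OF M_at_top])
  show "M n \<le> M (Suc n)" for n by (simp add: M_mono)
  show "real (Suc n) * lm (Suc n) - real n * lm n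
     = (real (Suc n) * ((1 - p (Suc n)) / p (Suc n) - 1) + 1) * (M (Suc n) - M n)" for n
    by (simp add: lam_Suc M_Suc algebra_simps)
  have "(\<lambda>n. real (Suc n) * ((1 - p (Suc n)) / p (Suc n) - 1) + 1) \<longlonglongrightarrow> \<delta> + 1"
    by (intro tendsto_intros lam_ratio_lim)
  then show "(\<lambda>n. real (Suc n) * ((1 - p (Suc n)) / p (Suc n) - 1) + 1) \<longlonglongrightarrow> 2 * kap"
    by (simp add: kappa_def add.commute add_divide_distrib)
qed

lemma M_asymp: "(\<lambda>x. M x * L x / real x powr (2 * kap)) \<longlonglongrightarrow> K0 p \<delta> / (2 * kap)"
proof -
  have "(\<lambda>x. lm x * L x / real x powr (2 * kap - 1) / (real x * lm x / M x)) \<longlonglongrightarrow> K0 p \<delta> / (2 * kap)"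
    using kap_pos by (intro tendsto_intros lam_asymp lam_over_M_lim) auto
  moreover have "eventually (\<lambda>x. lm x * L x / real x powr (2 * kap - 1) / (real x * lm x / M x)
      = M x * L x / real x powr (2 * kap)) sequentially"
    using eventually_gt_at_top[of 0]
  proof eventually_elim
    case (elim x)
    have "real x powr (2 * kap) = real x powr (2 * kap - 1) * real x"
      using elim by (simp add: powr_diff)
    then show ?case using elim lam_pos[of x] by (simp add: field_simps)
  qed
  ultimately show ?thesis by (simp add: tendsto_cong)
qed

lemma wt_asymp: "(\<lambda>x. wt x * L x / real x powr (2 * kap + 1)) \<longlonglongrightarrow> K0 p \<delta> / (2 * kap\<^sup>2)"
proof -
  have "(\<lambda>x. M x * L x / real x powr (2 * kap) / (real x * lm x / M x) / p x)
      \<longlonglongrightarrow> K0 p \<delta> / (2 * kap) / (2 * kap) / (1/2)"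
    using kap_pos by (intro tendsto_intros M_asymp lam_over_M_lim p_lim) auto
  moreover have "eventually (\<lambda>x. M x * L x / real x powr (2 * kap) / (real x * lm x / M x) / p x
      = wt x * L x / real x powr (2 * kap + 1)) sequentially"
    using eventually_gt_at_top[of 0]
    by eventually_elim (simp add: powr_add wt_def power2_eq_square field_simps)
  ultimately show ?thesis by (simp add: tendsto_cong power2_eq_square)
qed

text \<open>The original drift coefficient is \<open>- \<delta> / 2 = 1/2 - kap\<close>; the
  transform adds \<open>x * lm x / M x\<close>, whose limit is \<open>2 * kap\<close>. In terms of
  Bessel processes the dimension changes from \<open>2 - 2 * kap\<close> to
  \<open>2 + 2 * kap\<close>.\<close>

lemma drift_lim: "(\<lambda>x. real x * (up x - dn x)) \<longlonglongrightarrow> kap + 1/2"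
proof -
  have "(\<lambda>x. real x * (2 * p x - 1) + 2 * p x * (real x * lm x / M x)) \<longlonglongrightarrow> - \<delta> / 2 + 2 * (1/2) * (2 * kap)"
    by (intro tendsto_intros p_minus_q_lim p_lim lam_over_M_lim)
  then have "(\<lambda>x. real x * (2 * p x - 1) + 2 * p x * (real x * lm x / M x)) \<longlonglongrightarrow> kap + 1/2"
    by (rule back_subst[where P = "\<lambda>l. _ \<longlonglongrightarrow> l"]) (simp add: kappa_def field_simps)
  moreover have "eventually (\<lambda>x. real x * (2 * p x - 1) + 2 * p x * (real x * lm x / M x)
     = real x * (up x - dn x)) sequentially"
    using eventually_ge_at_top[of 1]
  proof eventually_elim
    case (elim x)
    have "up x - dn x = 2 * up x - 1" using up_dn[OF elim] by simp
    also have "\<dots> = 2 * p x - 1 + 2 * p x * (lm x / M x)"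
      using M_pos[OF elim] by (simp add: up_def M_Suc field_simps)
    finally have "up x - dn x = 2 * p x - 1 + 2 * p x * (lm x / M x)" .
    then show ?case by (simp only: distrib_left mult.assoc mult.left_commute times_divide_eq_right)
  qed
  ultimately show ?thesis by (simp add: tendsto_cong)
qed

lemma L_pos: "L x > 0" by (simp add: Lnat_def)

text \<open>Between comparable arguments \<open>x <= y <= A * x\<close> the exponent of
  \<open>L\<close> changes by at most \<open>(y - x) / x\<close> times the supremum of
  \<open>j * |R j|\<close>, which is small. The uniformity over both arguments is what the diffusive
  windows below require.\<close>

lemma L_slow:
  assumes A: "A \<ge> 1" and xi: "\<xi> > 0"
  shows "\<exists>N. \<forall>x\<ge>N. \<forall>y\<ge>N. real x \<le> A * real y \<and> real y \<le> A * real x \<longrightarrow> L x \<le> exp \<xi> * L y"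
proof -
  obtain N where N: "\<And>x. x \<ge> N \<Longrightarrow> \<bar>real x * R x\<bar> < \<xi> / A"
    using LIMSEQ_D[OF R_small, of "\<xi> / A"] A xi by auto
  have key: "\<bar>(\<Sum>j\<in>{1..y}. R j) - (\<Sum>j\<in>{1..x}. R j)\<bar> \<le> \<xi>"
    if x: "x \<ge> Suc N" and xy: "x \<le> y" and yA: "real y \<le> A * real x" for x y
  proof -
    have "{1..y} = {1..x} \<union> {Suc x..y}" using xy by auto
    then have "(\<Sum>j\<in>{1..y}. R j) - (\<Sum>j\<in>{1..x}. R j) = (\<Sum>j\<in>{Suc x..y}. R j)"
      by (simp add: sum.union_disjoint)
    also have "\<bar>\<dots>\<bar> \<le> (\<Sum>j\<in>{Suc x..y}. \<xi> / A / real x)"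
    proof (rule order_trans[OF sum_abs], rule sum_mono)
      fix j assume j: "j \<in> {Suc x..y}"
      have "real j * \<bar>R j\<bar> \<le> \<xi> / A" using N[of j] j x by (simp add: abs_mult less_imp_le)
      moreover have "real x * \<bar>R j\<bar> \<le> real j * \<bar>R j\<bar>" using j by (intro mult_right_mono) auto
      ultimately have "real x * \<bar>R j\<bar> \<le> \<xi> / A" by linarith
      then show "\<bar>R j\<bar> \<le> \<xi> / A / real x"
        using x by (subst pos_le_divide_eq) (simp_all add: mult.commute)
    qed
    also have "\<dots> = \<xi> * ((real y - real x) / (A * real x))"
      using xy by (simp add: of_nat_diff)
    also have "\<dots> \<le> \<xi> * 1"
      using xi yA x A by (intro mult_left_mono) (auto simp: divide_le_eq_1 intro: order_trans)
    finally show ?thesis by simp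
  qed
  show ?thesis
  proof (intro exI[of _ "Suc N"] allI impI)
    fix x y assume h: "x \<ge> Suc N" "y \<ge> Suc N" "real x \<le> A * real y \<and> real y \<le> A * real x"
    have "(\<Sum>j\<in>{1..x}. R j) \<le> \<xi> + (\<Sum>j\<in>{1..y}. R j)"
      using key[of x y] key[of y x] h by (cases "x \<le> y") auto
    then show "L x \<le> exp \<xi> * L y" by (simp add: Lnat_def exp_add[symmetric])
  qed
qed

definition Lf :: "nat \<Rightarrow> real" where "Lf m = Lfun p \<delta> (sqrt (real m))"

lemma Lfun_convex:
  assumes "t \<ge> 0" "n = nat \<lfloor>t\<rfloor>" "c \<le> L n" "c \<le> L (Suc n)" "L n \<le> d" "L (Suc n) \<le> d"
  shows "c \<le> Lfun p \<delta> t" "Lfun p \<delta> t \<le> d"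
proof -
  have e: "Lfun p \<delta> t = (1 - (t - real n)) * L n + (t - real n) * L (Suc n)"
    using assms(2) by (simp add: Lfun_def Let_def algebra_simps)
  have u: "0 \<le> t - real n" "t - real n \<le> 1" using assms(1,2) by linarith+
  show "c \<le> Lfun p \<delta> t" "Lfun p \<delta> t \<le> d" unfolding e
    using convex_bound_le[of "L n" d "L (Suc n)" "1 - (t - real n)" "t - real n"]
      convex_bound_le[of "- L n" "-c" "- L (Suc n)" "1 - (t - real n)" "t - real n"] assms u by auto
qed

lemma Lf_pos: "Lf m > 0"
proof -
  have "0 < min (L (nat \<lfloor>sqrt (real m)\<rfloor>)) (L (Suc (nat \<lfloor>sqrt (real m)\<rfloor>)))" by (simp add: L_pos)
  also have "\<dots> \<le> Lf m" unfolding Lf_def by (rule Lfun_convex(1)[OF _ refl _ _ max.cobounded1 max.cobounded2]) auto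
  finally show ?thesis .
qed

lemma Lf_asymp:
  assumes ab: "0 < a" and xi: "\<xi> > 0"
  shows "eventually (\<lambda>m. \<forall>k. a * real m \<le> (real k)\<^sup>2 \<and> (real k)\<^sup>2 \<le> b * real m \<longrightarrow>
      L k \<le> exp \<xi> * Lf m \<and> Lf m \<le> exp \<xi> * L k) sequentially"
proof -
  \<comment> \<open>\<open>A\<close> makes \<open>k\<close> comparable with both interpolation nodes
    around \<open>t = sqrt m\<close>: these lie in \<open>[t / 2, 2 * t]\<close>, and
    \<open>k\<close> lies between \<open>sqrt a * t\<close> and \<open>sqrt b * t\<close>.\<close>
  define A where "A = max 1 (max (2 * sqrt b) (2 / sqrt a))"
  have A: "A \<ge> 1" "A \<ge> 2 * sqrt b" "A \<ge> 2 / sqrt a" by (auto simp: A_def)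
  obtain N where N: "\<And>x y. x \<ge> N \<Longrightarrow> y \<ge> N \<Longrightarrow> real x \<le> A * real y \<Longrightarrow> real y \<le> A * real x \<Longrightarrow> L x \<le> exp \<xi> * L y"
    using L_slow[OF A(1) xi] by blast
  have "filterlim (\<lambda>m. sqrt (real m)) at_top sequentially" by real_asymp
  then have "eventually (\<lambda>m. sqrt (real m) > max (real N / sqrt a) (real N + 2)) sequentially"
    unfolding filterlim_at_top_dense by blast
  then show ?thesis
  proof eventually_elim
    case (elim m)
    define t where "t = sqrt (real m)"
    define n where "n = nat \<lfloor>t\<rfloor>"
    have t: "t > real N / sqrt a" "t > real N + 2" using elim by (auto simp: t_def)
    have n: "real n \<le> t" "t \<le> real n + 1" using t unfolding n_def by linarith+
    show ?case
    proof (intro allI impI)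
      fix k assume "a * real m \<le> (real k)\<^sup>2 \<and> (real k)\<^sup>2 \<le> b * real m"
      then have "sqrt (a * real m) \<le> real k" "real k \<le> sqrt (b * real m)"
        by (auto intro: real_le_lsqrt real_le_rsqrt)
      then have k: "sqrt a * t \<le> real k" "real k \<le> sqrt b * t" by (simp_all add: t_def real_sqrt_mult)
      have kN: "real k \<ge> real N" using t(1) k(1) ab by (simp add: field_simps)
      have t0: "t > 0" using t by linarith
      have up: "real y \<le> A * real k" if "real y \<le> 2 * t" for y
      proof -
        have "2 * t \<le> 2 / sqrt a * real k" using k(1) ab by (simp add: field_simps)
        also have "\<dots> \<le> A * real k" using A by (intro mult_right_mono) auto
        finally show ?thesis using that by linarith
      qed
      have dn: "real k \<le> A * real y" if "real y \<ge> t / 2" for y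
      proof -
        have "real k \<le> 2 * sqrt b * (t / 2)" using k by simp
        also have "\<dots> \<le> A * (t / 2)" using A t0 by (intro mult_right_mono) auto
        also have "\<dots> \<le> A * real y" using A(1) that by (intro mult_left_mono) auto
        finally show ?thesis .
      qed
      have y: "L k \<le> exp \<xi> * L y \<and> L y \<le> exp \<xi> * L k" if "y = n \<or> y = Suc n" for y
        using that n t kN by (intro conjI N up dn) auto
      have a: "exp (-\<xi>) * L k \<le> L y" if "y = n \<or> y = Suc n" for y
        using y[OF that] by (simp add: exp_minus field_simps)
      have "exp (-\<xi>) * L k \<le> Lfun p \<delta> t"
        by (rule Lfun_convex(1)[OF _ n_def a a max.cobounded1 max.cobounded2]) (use t0 in auto)
      moreover have "Lfun p \<delta> t \<le> exp \<xi> * L k"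
        by (rule Lfun_convex(2)[OF _ n_def a a]) (use t0 y in auto)
      ultimately show "L k \<le> exp \<xi> * Lf m \<and> Lf m \<le> exp \<xi> * L k"
        by (simp add: Lf_def t_def exp_minus field_simps)
    qed
  qed
qed

end

subsection \<open>Convergence in law\<close>

lemma sinh_real_bounds:
  fixes y :: real
  assumes "y \<ge> 0"
  shows "y \<le> sinh y" "sinh y \<le> y * cosh y"
proof -
  have "(\<lambda>y::real. sinh y - y) 0 \<le> (\<lambda>y. sinh y - y) y"
  proof (rule DERIV_nonneg_imp_nondecreasing[OF assms])
    show "\<exists>d. ((\<lambda>y. sinh y - y) has_real_derivative d) (at x) \<and> 0 \<le> d" for x :: real
      by (rule exI[of _ "cosh x - 1"]) (auto intro!: derivative_eq_intros simp: cosh_real_ge_1)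
  qed
  then show "y \<le> sinh y" by simp
  have "(\<lambda>y::real. y * cosh y - sinh y) 0 \<le> (\<lambda>y. y * cosh y - sinh y) y"
  proof (rule DERIV_nonneg_imp_nondecreasing[OF assms])
    show "\<exists>d. ((\<lambda>y. y * cosh y - sinh y) has_real_derivative d) (at x) \<and> 0 \<le> d" if "0 \<le> x" for x :: real
      using that by (intro exI[of _ "x * sinh x"]) (auto intro!: derivative_eq_intros)
  qed
  then show "sinh y \<le> y * cosh y" by simp
qed

lemma cosh_real_bounds:
  fixes y :: real
  assumes "y \<ge> 0"
  shows "1 + y\<^sup>2 / 2 \<le> cosh y" "cosh y \<le> exp (y\<^sup>2 / 2)"
proof -
  have "(\<lambda>y::real. cosh y - y\<^sup>2 / 2) 0 \<le> (\<lambda>y. cosh y - y\<^sup>2 / 2) y"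
  proof (rule DERIV_nonneg_imp_nondecreasing[OF assms])
    show "\<exists>d. ((\<lambda>y. cosh y - y\<^sup>2 / 2) has_real_derivative d) (at x) \<and> 0 \<le> d" if "0 \<le> x" for x :: real
      using that sinh_real_bounds(1)[of x] 
      by (intro exI[of _ "sinh x - x"]) (auto intro!: derivative_eq_intros)
  qed
  then show "1 + y\<^sup>2 / 2 \<le> cosh y" by simp
  have "(\<lambda>y::real. y\<^sup>2 / 2 - ln (cosh y)) 0 \<le> (\<lambda>y. y\<^sup>2 / 2 - ln (cosh y)) y"
  proof (rule DERIV_nonneg_imp_nondecreasing[OF assms])
    show "\<exists>d. ((\<lambda>y. y\<^sup>2 / 2 - ln (cosh y)) has_real_derivative d) (at x) \<and> 0 \<le> d" if "0 \<le> x" for x :: real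
      using that sinh_real_bounds(2)[of x] cosh_real_pos[of x]
      by (intro exI[of _ "x - sinh x / cosh x"]) (auto intro!: derivative_eq_intros simp: field_simps)
  qed
  then have "ln (cosh y) \<le> y\<^sup>2 / 2" by simp
  then have "exp (ln (cosh y)) \<le> exp (y\<^sup>2 / 2)" by (simp only: exp_le_cancel_iff)
  then show "cosh y \<le> exp (y\<^sup>2 / 2)" using cosh_real_pos[of y] by simp
qed

lemma exp_taylor2_le:
  fixes z :: real
  assumes "z \<ge> 0"
  shows "exp z \<le> 1 + z + z\<^sup>2 / 2 * exp z"
proof -
  have "(\<lambda>z::real. 1 + z + z\<^sup>2 / 2 * exp z - exp z) 0 \<le> (\<lambda>z. 1 + z + z\<^sup>2 / 2 * exp z - exp z) z"
  proof (rule DERIV_nonneg_imp_nondecreasing[OF assms])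
    fix x :: real assume "0 \<le> x"
    have "1 - exp x + x * exp x + x\<^sup>2 / 2 * exp x \<ge> 0"
    proof -
      have "exp (- x) \<ge> 1 - x" using exp_ge_add_one_self[of "-x"] by simp
      then have "exp x * exp (- x) \<ge> exp x * (1 - x)" by (intro mult_left_mono) auto
      then have "exp x \<le> 1 + x * exp x" by (simp add: exp_minus algebra_simps)
      moreover have "x\<^sup>2 / 2 * exp x \<ge> 0" by simp
      ultimately show ?thesis by linarith
    qed
    then show "\<exists>d. ((\<lambda>z. 1 + z + z\<^sup>2 / 2 * exp z - exp z) has_real_derivative d) (at x) \<and> 0 \<le> d"
      by (intro exI[of _ "1 - exp x + x * exp x + x\<^sup>2 / 2 * exp x"])
         (auto intro!: derivative_eq_intros simp: algebra_simps)
  qed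
  then show ?thesis by simp
qed

lemma exp_neg_taylor2:
  fixes t :: real
  assumes "t \<ge> 0"
  shows "\<bar>exp (-t) - 1 + t\<bar> \<le> t\<^sup>2"
proof -
  have 1: "exp (-t) \<ge> 1 - t" using exp_ge_add_one_self[of "-t"] by simp
  have "exp t \<ge> 1 + t" by (rule exp_ge_add_one_self)
  then have "exp (-t) \<le> 1 / (1 + t)" using assms by (simp add: exp_minus field_simps)
  also have "\<dots> \<le> 1 - t + t\<^sup>2"
    using assms by (subst pos_divide_le_eq) (simp_all add: power2_eq_square algebra_simps)
  finally show ?thesis using 1 by simp
qed

text \<open>Half of a Gaussian exponent suffices to absorb powers of \<open>w = a * x^2\<close>.
  This makes the error terms of the Gaussian step uniform in the position \<open>x\<close>.\<close>

lemma mult_exp_neg_half_le: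
  fixes w :: real
  assumes "w \<ge> 0"
  shows "w * exp (- w / 2) \<le> 2" "w\<^sup>2 * exp (- w / 2) \<le> 8"
proof -
  have "w / 2 \<le> exp (w / 2)" using exp_ge_add_one_self[of "w/2"] by linarith
  then show "w * exp (- w / 2) \<le> 2" by (simp add: exp_minus field_simps)
  have "(w/2)\<^sup>2 / 2 \<le> exp (w / 2)" using exp_lower_Taylor_quadratic[of "w/2"] assms by linarith
  then show "w\<^sup>2 * exp (- w / 2) \<le> 8" by (simp add: exp_minus field_simps)
qed

lemma powr_taylor2:
  fixes a K :: real
  assumes a: "0 < a" "a \<le> 1/4" and K: "K \<ge> 0"
  shows "\<bar>(1 + 2 * a) powr (- K) - 1 + 2 * a * K\<bar> \<le> (4 * K\<^sup>2 + 8 * K) * a\<^sup>2"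
proof -
  define t where "t = K * ln (1 + 2 * a)"
  have l: "\<bar>ln (1 + 2 * a) - 2 * a\<bar> \<le> 8 * a\<^sup>2"
    using abs_ln_one_plus_x_minus_x_bound[of "2 * a"] a by (simp add: power_mult_distrib)
  have l2: "ln (1 + 2 * a) \<le> 2 * a" using a by (intro ln_add_one_self_le_self) auto
  have t: "0 \<le> t" "t \<le> K * (2 * a)" using a K l2 by (auto simp: t_def intro!: mult_left_mono)
  have "\<bar>exp (-t) - 1 + t\<bar> \<le> t\<^sup>2" by (rule exp_neg_taylor2[OF t(1)])
  also have "\<dots> \<le> (K * (2 * a))\<^sup>2" using t by (intro power_mono) auto
  finally have 1: "\<bar>exp (-t) - 1 + t\<bar> \<le> 4 * K\<^sup>2 * a\<^sup>2" by (simp add: power_mult_distrib)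
  have "2 * a * K - t = K * (2 * a - ln (1 + 2 * a))" by (simp add: t_def algebra_simps)
  then have "\<bar>2 * a * K - t\<bar> = K * \<bar>ln (1 + 2 * a) - 2 * a\<bar>" using K by (simp add: abs_mult abs_minus_commute)
  also have "\<dots> \<le> K * (8 * a\<^sup>2)" using l K by (rule mult_left_mono)
  finally have 2: "\<bar>2 * a * K - t\<bar> \<le> 8 * K * a\<^sup>2" by simp
  have "(1 + 2 * a) powr (- K) = exp (-t)" using a by (simp add: powr_def t_def)
  then show ?thesis using 1 2 by (simp add: algebra_simps)
qed

text \<open>The Gaussians form the family that the Bessel semigroup of drift \<open>(K - 1/2) / x\<close>
  maps to itself; one step of a walk with drift \<open>\<beta> / x\<close> follows it up to the stated error.\<close>
lemma gaussian_one_step: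
  fixes a x \<beta> K P Q :: real
  assumes a: "0 < a" "a \<le> 1/4" and x: "x \<ge> 1" and K: "K \<ge> 0"
    and PQ: "P + Q = 1" "P - Q = \<beta> / x" and B: "\<bar>\<beta>\<bar> \<le> B"
  shows "\<bar>P * exp (- a * (x + 1)\<^sup>2) + Q * exp (- a * (x - 1)\<^sup>2)
      - (1 + 2 * a) powr (- K) * exp (- (a / (1 + 2 * a)) * x\<^sup>2)\<bar>
    \<le> (46 + 11 * B + 4 * K\<^sup>2 + 28 * K) * a\<^sup>2 + 2 * a * \<bar>\<beta> - (K - 1/2)\<bar>"
proof -
  \<comment> \<open>The two-point average equals \<open>exp (- a) * e * (c - \<beta> * S)\<close>.
    To first order in \<open>a\<close>, \<open>c\<close> is \<open>1 + z\<close>, \<open>S\<close>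
    is \<open>2 * a\<close>, \<open>G\<close> is \<open>e * (1 + z)\<close> and \<open>Pw\<close> is
    \<open>1 - 2 * a * K\<close>. The condition \<open>a <= 1/4\<close> gives
    \<open>z <= w / 2\<close>, so \<open>e * exp z\<close> still decays like
    \<open>exp (- w / 2)\<close>.\<close>
  define w where "w = a * x\<^sup>2"
  define e where "e = exp (- w)"
  define z where "z = 2 * a * w"
  define c where "c = cosh (2 * a * x)"
  define S where "S = sinh (2 * a * x) / x"
  define G where "G = exp (- (a / (1 + 2 * a)) * x\<^sup>2)"
  define Pw where "Pw = (1 + 2 * a) powr (- K)"
  have w: "w \<ge> 0" using a by (simp add: w_def)
  have z: "z \<ge> 0" "z \<le> w / 2" using a w mult_right_mono[of "4 * a" 1 w] by (auto simp: z_def)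
  have e: "0 < e" "e \<le> 1" using w by (auto simp: e_def)
  have eh: "e = exp (- w / 2) * exp (- w / 2)" by (simp add: e_def exp_add[symmetric])
  have ez: "e * exp z \<le> exp (- w / 2)" using z by (simp add: e_def exp_add[symmetric])
  have e1: "e \<le> exp (- w / 2)" using w by (simp add: e_def)
  have we: "w * e \<le> 2" using mult_left_mono[OF e1 w] mult_exp_neg_half_le(1)[OF w] by linarith
  have wez: "w * (e * exp z) \<le> 2" using mult_left_mono[OF ez w] mult_exp_neg_half_le(1)[OF w] by linarith
  have wwez: "w\<^sup>2 * (e * exp z) \<le> 8"
    using mult_left_mono[OF ez, of "w\<^sup>2"] mult_exp_neg_half_le(2)[OF w] by simp
  have zz: "e * (z\<^sup>2 / 2 * exp z) \<le> 16 * a\<^sup>2"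
  proof -
    have "e * (z\<^sup>2 / 2 * exp z) = 2 * a\<^sup>2 * (w\<^sup>2 * (e * exp z))"
      by (simp add: z_def power_mult_distrib)
    also have "\<dots> \<le> 2 * a\<^sup>2 * 8" using wwez by (intro mult_left_mono) auto
    finally show ?thesis by simp
  qed
  have yz: "(2 * a * x)\<^sup>2 / 2 = z" by (simp add: z_def w_def power2_eq_square)
  have c: "1 + z \<le> c" "c \<le> exp z"
    using cosh_real_bounds[of "2 * a * x"] a x yz by (auto simp: c_def)
  have cc: "0 \<le> e * (c - (1 + z))" "e * (c - (1 + z)) \<le> 16 * a\<^sup>2"
  proof -
    have "e * (c - (1 + z)) \<le> e * (z\<^sup>2 / 2 * exp z)"
      using c exp_taylor2_le[OF z(1)] e by (intro mult_left_mono) auto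
    with zz show "e * (c - (1 + z)) \<le> 16 * a\<^sup>2" by linarith
  qed (use c e in auto)
  have S: "2 * a \<le> S" "S \<le> 2 * a * exp z"
  proof -
    show "2 * a \<le> S" using sinh_real_bounds(1)[of "2 * a * x"] a x by (simp add: S_def field_simps)
    have "S \<le> 2 * a * c" using sinh_real_bounds(2)[of "2 * a * x"] a x by (simp add: S_def c_def field_simps)
    also have "\<dots> \<le> 2 * a * exp z" using c a by simp
    finally show "S \<le> 2 * a * exp z" .
  qed
  have SS: "0 \<le> e * (S - 2 * a)" "e * (S - 2 * a) \<le> 8 * a\<^sup>2"
  proof -
    have "exp z - 1 \<le> z * exp z" using exp_ge_add_one_self[of "-z"] mult_right_mono[of "1 - z" "exp (-z)" "exp z"]
      by (simp add: exp_minus algebra_simps)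
    then have "2 * a * (exp z - 1) \<le> 2 * a * (z * exp z)" using a by (intro mult_left_mono) auto
    then have "S - 2 * a \<le> 2 * a * (z * exp z)" using S by (simp add: right_diff_distrib)
    then have "e * (S - 2 * a) \<le> e * (2 * a * (z * exp z))" using e by (intro mult_left_mono) auto
    also have "\<dots> = 4 * a\<^sup>2 * (w * (e * exp z))" by (simp add: z_def power2_eq_square)
    also have "\<dots> \<le> 4 * a\<^sup>2 * 2" using wez by (intro mult_left_mono) auto
    finally show "e * (S - 2 * a) \<le> 8 * a\<^sup>2" by simp
  qed (use S e in auto)
  have GG: "\<bar>G - e * (1 + z)\<bar> \<le> 24 * a\<^sup>2"
  proof -
    define z' where "z' = z / (1 + 2 * a)"
    have "G = e * exp z'"
      using a by (simp add: G_def e_def z'_def z_def w_def exp_add[symmetric] field_simps power2_eq_square)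
    have z': "0 \<le> z'" "z' \<le> z" using a z by (auto simp: z'_def divide_le_eq mult_le_cancel_left1)
    have "z - z' = 2 * a * z'" using a by (simp add: z'_def field_simps)
    also have "\<dots> \<le> 2 * a * z" using z' a by simp
    finally have d: "z - z' \<le> 4 * a\<^sup>2 * w" by (simp add: z_def power2_eq_square)
    have "exp z' \<le> 1 + z' + z'\<^sup>2 / 2 * exp z'" by (rule exp_taylor2_le[OF z'(1)])
    also have "z'\<^sup>2 / 2 * exp z' \<le> z\<^sup>2 / 2 * exp z" using z' by (intro mult_mono divide_right_mono power_mono) auto
    finally have "exp z' - (1 + z) \<le> z\<^sup>2 / 2 * exp z" using z' by linarith
    then have "e * (exp z' - (1 + z)) \<le> e * (z\<^sup>2 / 2 * exp z)" using e by (intro mult_left_mono) auto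
    with zz have u: "e * (exp z' - (1 + z)) \<le> 16 * a\<^sup>2" by linarith
    have "exp z' - (1 + z) \<ge> - (4 * a\<^sup>2 * w)" using exp_ge_add_one_self[of z'] d by linarith
    then have "e * (exp z' - (1 + z)) \<ge> e * (- (4 * a\<^sup>2 * w))" using e by (intro mult_left_mono) auto
    moreover have "4 * a\<^sup>2 * (w * e) \<le> 4 * a\<^sup>2 * 2" using we by (intro mult_left_mono) auto
    ultimately have "e * (exp z' - (1 + z)) \<ge> - (8 * a\<^sup>2)" by (simp add: mult_ac)
    with u show ?thesis unfolding \<open>G = e * exp z'\<close> by (simp add: right_diff_distrib abs_le_iff)
  qed
  have G1: "0 \<le> G" "G \<le> 1" using a by (auto simp: G_def)
  have aa: "a\<^sup>2 \<le> a / 4" using mult_left_mono[OF a(2), of a] a by (simp add: power2_eq_square)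
  have ez1: "e * z \<le> 4 * a" using mult_left_mono[OF we, of "2 * a"] a by (simp add: z_def mult_ac)
  have ez0: "0 \<le> e * z" using e z by simp
  define X where "X = e * (c - \<beta> * S)"
  define X0 where "X0 = e * (1 + z - 2 * a * \<beta>)"
  have B0: "B \<ge> 0" using B by linarith
  have XX: "\<bar>X - X0\<bar> \<le> (16 + 8 * B) * a\<^sup>2"
  proof -
    have "X - X0 = e * (c - (1 + z)) - \<beta> * (e * (S - 2 * a))" by (simp add: X_def X0_def algebra_simps)
    moreover have "\<bar>\<beta> * (e * (S - 2 * a))\<bar> \<le> B * (8 * a\<^sup>2)"
      unfolding abs_mult[of \<beta>] using SS B by (intro mult_mono) auto
    ultimately show ?thesis using cc by (simp add: algebra_simps)
  qed
  have be: "\<bar>e * (2 * a * \<beta>)\<bar> \<le> 2 * a * B"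
  proof -
    have "\<bar>e * (2 * a * \<beta>)\<bar> = e * (2 * a * \<bar>\<beta>\<bar>)" using e a by (simp add: abs_mult)
    also have "\<dots> \<le> 1 * (2 * a * B)" using e a B by (intro mult_mono) auto
    finally show ?thesis by simp
  qed
  have X0e: "\<bar>X0 - e\<bar> \<le> (4 + 2 * B) * a" 
  proof -
    have "X0 - e = e * z - e * (2 * a * \<beta>)" by (simp add: X0_def algebra_simps)
    then show ?thesis using be ez1 ez0 by (simp add: algebra_simps)
  qed
  have X0b: "\<bar>X0\<bar> \<le> 2 + B"
  proof -
    have "(4 + 2 * B) * a \<le> (4 + 2 * B) * (1/4)" using a B0 by (intro mult_left_mono) auto
    then have "(4 + 2 * B) * a \<le> 1 + B / 2" by simp
    then show ?thesis using X0e e B0 by linarith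
  qed
  have A: "\<bar>exp (-a) * X - (X0 - a * e)\<bar> \<le> (16 + 8 * B) * a\<^sup>2 + a\<^sup>2 * (2 + B) + a * ((4 + 2 * B) * a)"
  proof -
    have "exp (-a) * X - (X0 - a * e) = exp (-a) * (X - X0) + (exp (-a) - 1 + a) * X0 - a * (X0 - e)"
      by (simp add: algebra_simps)
    moreover have "\<bar>exp (-a) * (X - X0)\<bar> \<le> 1 * ((16 + 8 * B) * a\<^sup>2)"
      unfolding abs_mult using XX a by (intro mult_mono) auto
    moreover have "\<bar>(exp (-a) - 1 + a) * X0\<bar> \<le> a\<^sup>2 * (2 + B)"
      unfolding abs_mult using exp_neg_taylor2[of a] a X0b by (intro mult_mono) auto
    moreover have "\<bar>a * (X0 - e)\<bar> \<le> a * ((4 + 2 * B) * a)"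
      unfolding abs_mult using X0e a by (intro mult_mono) auto
    ultimately show ?thesis by linarith
  qed
  have Ge: "\<bar>G - e\<bar> \<le> 10 * a"
  proof -
    have "\<bar>G - e\<bar> \<le> \<bar>G - e * (1 + z)\<bar> + e * z" using ez0 by (simp add: algebra_simps abs_if)
    also have "\<dots> \<le> 24 * a\<^sup>2 + 4 * a" using GG ez1 by linarith
    finally show ?thesis using aa by linarith
  qed
  have Bb: "\<bar>Pw * G - (e * (1 + z) - 2 * a * K * e)\<bar> \<le> (4 * K\<^sup>2 + 8 * K) * a\<^sup>2 + 24 * a\<^sup>2 + 2 * a * K * (10 * a)"
  proof -
    have "Pw * G - (e * (1 + z) - 2 * a * K * e)
       = (Pw - 1 + 2 * a * K) * G + (G - e * (1 + z)) - 2 * a * K * (G - e)"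
      by (simp add: algebra_simps)
    moreover have "\<bar>(Pw - 1 + 2 * a * K) * G\<bar> \<le> (4 * K\<^sup>2 + 8 * K) * a\<^sup>2 * 1"
      unfolding abs_mult Pw_def using powr_taylor2[OF a K] G1 K by (intro mult_mono) auto
    moreover have "\<bar>2 * a * K * (G - e)\<bar> \<le> 2 * a * K * (10 * a)"
    proof -
      have "\<bar>2 * a * K * (G - e)\<bar> = 2 * a * K * \<bar>G - e\<bar>" using a K by (simp add: abs_mult)
      also have "\<dots> \<le> 2 * a * K * (10 * a)" using Ge a K by (intro mult_left_mono) auto
      finally show ?thesis .
    qed
    ultimately show ?thesis using GG by linarith
  qed
  \<comment> \<open>The only first-order discrepancy. The factor \<open>exp (- a)\<close>
    contributes \<open>- a * e\<close>, which is why \<open>\<beta>\<close> is compared with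
    \<open>K - 1/2\<close> and not with \<open>K\<close>.\<close>
  have C: "\<bar>(X0 - a * e) - (e * (1 + z) - 2 * a * K * e)\<bar> \<le> 2 * a * \<bar>\<beta> - (K - 1/2)\<bar>"
  proof -
    have "(X0 - a * e) - (e * (1 + z) - 2 * a * K * e) = - (2 * a * (\<beta> - (K - 1/2))) * e"
      by (simp add: X0_def algebra_simps)
    also have "\<bar>\<dots>\<bar> \<le> 2 * a * \<bar>\<beta> - (K - 1/2)\<bar> * 1"
      using e a by (simp add: abs_mult mult_left_le)
    finally show ?thesis by simp
  qed
  have main: "P * exp (- a * (x + 1)\<^sup>2) + Q * exp (- a * (x - 1)\<^sup>2) = exp (-a) * X"
  proof -
    have P: "P = (1 + \<beta> / x) / 2" and Q: "Q = (1 - \<beta> / x) / 2" using PQ by (auto simp: field_simps)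
    have "exp (- a * (x + 1)\<^sup>2) = exp (-a) * e * exp (- (2 * a * x))"
      "exp (- a * (x - 1)\<^sup>2) = exp (-a) * e * exp (2 * a * x)"
      by (simp_all add: e_def w_def exp_add[symmetric] power2_eq_square algebra_simps)
    then have "P * exp (- a * (x + 1)\<^sup>2) + Q * exp (- a * (x - 1)\<^sup>2)
       = exp (-a) * e * (P * exp (- (2 * a * x)) + Q * exp (2 * a * x))"
      by (simp add: algebra_simps)
    also have "P * exp (- (2 * a * x)) + Q * exp (2 * a * x) = c - \<beta> * S"
    proof -
      have "\<beta> * S = \<beta> / x * ((exp (2 * a * x) - exp (- (2 * a * x))) / 2)" by (simp add: S_def sinh_def)
      moreover have "c = (exp (2 * a * x) + exp (- (2 * a * x))) / 2" by (simp add: c_def cosh_def)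
      ultimately show ?thesis unfolding P Q by (simp only:) argo
    qed
    finally show ?thesis by (simp add: X_def)
  qed
  \<comment> \<open>The final constants collect \<open>46 = 16 + 2 + 4 + 24\<close>,
    \<open>11 = 8 + 1 + 2\<close> and \<open>28 = 8 + 20\<close>.\<close>
  have "\<bar>exp (-a) * X - Pw * G\<bar> \<le> (16 + 8 * B) * a\<^sup>2 + a\<^sup>2 * (2 + B) + a * ((4 + 2 * B) * a)
    + 2 * a * \<bar>\<beta> - (K - 1/2)\<bar> + ((4 * K\<^sup>2 + 8 * K) * a\<^sup>2 + 24 * a\<^sup>2 + 2 * a * K * (10 * a))"
    using A Bb C by linarith
  also have "\<dots> \<le> (46 + 11 * B + 4 * K\<^sup>2 + 28 * K) * a\<^sup>2 + 2 * a * \<bar>\<beta> - (K - 1/2)\<bar>"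
    by (simp add: algebra_simps power2_eq_square)
  finally show ?thesis unfolding main G_def[symmetric] Pw_def[symmetric] .
qed

context bessel_walk
begin

section \<open>Escape to infinity and comparison with the Bessel semigroup\<close>

lemma E_point: "j \<ge> 1 \<Longrightarrow> E n (\<lambda>k. if k = j then 1 else 0) = wt j * v n j"
proof -
  assume "j \<ge> 1"
  have "E n (\<lambda>k. if k = j then 1 else 0) = (\<Sum>k\<in>{1..Suc n}. if k = j then wt j * v n j else 0)"
    unfolding E_def by (intro sum.cong) auto
  also have "\<dots> = wt j * v n j" using \<open>j \<ge> 1\<close> v_support[of n j] by (subst sum.delta) auto
  finally show ?thesis .
qed

text \<open>The transform \<open>1 / M\<close> of the constant 1 is harmonic except at 1, where the
  original walk can be killed. Its expectation therefore drops in each step by exactly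
  \<open>v n 1\<close>, the probability of hitting 0 at time \<open>n + 1\<close> from 1, and these
  drops are summable.\<close>

lemma v_one_lim: "(\<lambda>n. v n 1) \<longlonglongrightarrow> 0"
proof -
  define h where "h = (\<lambda>k. 1 / M k)"
  have step: "E (Suc n) h = E n h - v n 1" for n
  proof -
    have "E (Suc n) h = E n (\<lambda>k. h k - (1 - p 1) * (if k = 1 then 1 else 0))"
      unfolding E_Suc
    proof (rule E_cong)
      fix k :: nat assume k: "k \<ge> 1"
      show "T h k = h k - (1 - p 1) * (if k = 1 then 1 else 0)"
      proof (cases "k = 1")
        case True
        then show ?thesis using M_pos[of "Suc (Suc 0)"] by (simp add: T_def h_def M_1 up_def)
      next
        case False
        then have "M (k - 1) > 0" "M (Suc k) > 0" "M k > 0" using k by (auto intro: M_pos)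
        then show ?thesis using False by (simp add: T_def h_def up_def dn_def field_simps)
      qed
    qed
    also have "\<dots> = E n h - (1 - p 1) * (wt 1 * v n 1)"
      unfolding E_diff E_cmult by (simp add: E_point)
    also have "(1 - p 1) * (wt 1 * v n 1) = v n 1"
      using p_pos[of 1] q_pos[of 1] by (simp add: wt_def M_1 lam_Suc)
    finally show ?thesis .
  qed
  have "(\<Sum>i<n. v i 1) = E 0 h - E n h" for n
    by (induction n) (simp_all add: step)
  moreover have "E n h \<ge> 0" for n by (intro E_nonneg) (simp add: h_def M_nonneg)
  ultimately have "summable (\<lambda>n. v n 1)"
    by (intro summableI_nonneg_bounded[of _ "E 0 h"]) (auto simp: v_nonneg)
  then show ?thesis by (rule summable_LIMSEQ_zero)
qed

lemma v_lim: "k \<ge> 1 \<Longrightarrow> (\<lambda>n. v n k) \<longlonglongrightarrow> 0"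
proof -
  assume k: "k \<ge> 1"
  have le: "v n k \<le> v n 1 + v (Suc n) 1" for n
  proof (cases "odd k")
    case True
    then show ?thesis using v_antimono[of 1 k n] k v_nonneg[of "Suc n" 1] by simp
  next
    case False
    then have "k \<ge> 2" using k by (cases "k = 1") auto
    then have "v n k \<le> v n 2" using False by (intro v_antimono) auto
    also have "\<dots> \<le> v (Suc n) 1" using v_ge_step[of 1 n] by (simp add: numeral_2_eq_2)
    finally show ?thesis using v_nonneg[of n 1] by linarith
  qed
  have "(\<lambda>n. v n 1 + v (Suc n) 1) \<longlonglongrightarrow> 0 + 0"
    by (intro tendsto_add LIMSEQ_Suc v_one_lim)
  moreover have "eventually (\<lambda>n. norm (v n k) \<le> v n 1 + v (Suc n) 1) sequentially"
    using le by (simp add: v_nonneg)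
  ultimately show ?thesis by (simp add: Lim_null_comparison)
qed

text \<open>Since \<open>v n k\<close> tends to 0 for fixed \<open>k\<close>, each finite set of
  states loses its mass, and outside it \<open>e\<close> is small. This turns convergence of the
  drift at infinity into smallness along the path.\<close>

lemma E_vanishing:
  fixes e :: "nat \<Rightarrow> real"
  assumes "e \<longlonglongrightarrow> 0"
  shows "(\<lambda>n. E n (\<lambda>k. \<bar>e k\<bar>)) \<longlonglongrightarrow> 0"
proof (rule LIMSEQ_I)
  fix r :: real assume r: "r > 0"
  obtain N where N: "\<And>k. k \<ge> N \<Longrightarrow> \<bar>e k\<bar> < r / 2" using LIMSEQ_D[OF assms, of "r/2"] r by auto
  define J where "J = {1..<N}"
  have b: "E n (\<lambda>k. \<bar>e k\<bar>) \<le> r / 2 + (\<Sum>j\<in>J. \<bar>e j\<bar> * (wt j * v n j))" for n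
  proof -
    have "E n (\<lambda>k. \<bar>e k\<bar>) \<le> E n (\<lambda>k. r / 2 + (\<Sum>j\<in>J. \<bar>e j\<bar> * (if k = j then 1 else 0)))"
    proof (rule E_mono)
      fix k :: nat assume k: "k \<ge> 1"
      have s: "(\<Sum>j\<in>J. \<bar>e j\<bar> * (if k = j then 1 else 0)) = (if k \<in> J then \<bar>e k\<bar> else 0)"
        by (simp add: J_def if_distrib sum.delta cong: if_cong)
      show "\<bar>e k\<bar> \<le> r / 2 + (\<Sum>j\<in>J. \<bar>e j\<bar> * (if k = j then 1 else 0))"
        unfolding s using N[of k] k r by (auto simp: J_def)
    qed
    also have "\<dots> = r / 2 + (\<Sum>j\<in>J. \<bar>e j\<bar> * (wt j * v n j))"
      unfolding E_add E_const E_sum E_cmult by (simp add: J_def E_point)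
    finally show ?thesis .
  qed
  have "(\<lambda>n. \<Sum>j\<in>J. \<bar>e j\<bar> * (wt j * v n j)) \<longlonglongrightarrow> (\<Sum>j\<in>J. \<bar>e j\<bar> * (wt j * 0))"
    by (intro tendsto_intros v_lim) (auto simp: J_def)
  then have "(\<lambda>n. \<Sum>j\<in>J. \<bar>e j\<bar> * (wt j * v n j)) \<longlonglongrightarrow> 0" by simp
  from LIMSEQ_D[OF this, of "r/2"] r
  obtain n0 where n0: "\<And>n. n \<ge> n0 \<Longrightarrow> \<bar>\<Sum>j\<in>J. \<bar>e j\<bar> * (wt j * v n j)\<bar> < r / 2" by auto
  have "E n (\<lambda>k. \<bar>e k\<bar>) \<ge> 0" for n by (intro E_nonneg) simp
  then have "norm (E n (\<lambda>k. \<bar>e k\<bar>) - 0) < r" if "n \<ge> n0" for n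
    using b[of n] n0[OF that] by (simp add: abs_less_iff)
  then show "\<exists>no. \<forall>n\<ge>no. norm (E n (\<lambda>k. \<bar>e k\<bar>) - 0) < r" by blast
qed

definition drift :: "nat \<Rightarrow> real" where "drift k = real k * (up k - dn k)"

lemma drift_bounded: "\<exists>B\<ge>0. \<forall>k. \<bar>drift k\<bar> \<le> B"
  using convergent_imp_Bseq[OF convergentI[OF drift_lim]]
  by (auto simp: Bseq_def drift_def[symmetric] dest!: less_imp_le)

text \<open>The value at \<open>k\<close> of the Bessel semigroup of dimension
  \<open>2 * kap + 2\<close> at time \<open>r\<close>, applied to
  \<open>exp (- s * x^2)\<close>.\<close>

definition gau :: "real \<Rightarrow> nat \<Rightarrow> nat \<Rightarrow> real" where
  "gau s r k = (1 + 2 * s * real r) powr (- (kap + 1)) * exp (- (s / (1 + 2 * s * real r)) * (real k)\<^sup>2)"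

lemma gau_step:
  "\<exists>C\<ge>0. \<forall>s r k. 0 < s \<longrightarrow> s \<le> 1/4 \<longrightarrow> k \<ge> 1 \<longrightarrow>
    \<bar>T (gau s r) k - gau s (Suc r) k\<bar> \<le> C * s\<^sup>2 + 2 * s * \<bar>drift k - (kap + 1/2)\<bar>"
proof -
  obtain B where B: "B \<ge> 0" "\<And>k. \<bar>drift k\<bar> \<le> B" using drift_bounded by auto
  define K where "K = kap + 1"
  define C where "C = 46 + 11 * B + 4 * K\<^sup>2 + 28 * K"
  have K: "K \<ge> 0" using kap_pos by (simp add: K_def)
  have C: "C \<ge> 0" using B K by (simp add: C_def)
  show ?thesis
  proof (intro exI[of _ C] conjI allI impI C)
    fix s :: real and r k :: nat assume s: "0 < s" "s \<le> 1/4" and k: "k \<ge> 1"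
    \<comment> \<open>Running the flow for \<open>r\<close> steps rescales the Gaussian parameter to
      \<open>a = s / D\<close>; one more step multiplies \<open>D\<close> by
      \<open>1 + 2 * a\<close>. As \<open>a <= s\<close> and \<open>D powr (-K) <= 1\<close>, the
      one-step error bound is uniform in \<open>r\<close>.\<close>
    define D where "D = 1 + 2 * s * real r"
    define a where "a = s / D"
    have D: "D \<ge> 1" using s by (simp add: D_def)
    have a: "0 < a" "a \<le> s" using s D by (auto simp: a_def divide_le_eq mult_le_cancel_left1)
    have D': "1 + 2 * s * real (Suc r) = D * (1 + 2 * a)" using D by (simp add: D_def a_def field_simps)
    have a': "s / (D * (1 + 2 * a)) = a / (1 + 2 * a)" by (simp add: a_def)
    have g: "gau s r i = D powr (-K) * exp (- a * (real i)\<^sup>2)" for i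
      by (simp add: gau_def D_def a_def K_def)
    have g': "gau s (Suc r) k = D powr (-K) * ((1 + 2 * a) powr (-K) * exp (- (a / (1 + 2 * a)) * (real k)\<^sup>2))"
      unfolding gau_def D' a' K_def[symmetric] using D a by (simp add: powr_mult)
    have "T (gau s r) k = D powr (-K) * (up k * exp (- a * (real k + 1)\<^sup>2) + dn k * exp (- a * (real k - 1)\<^sup>2))"
      using k by (simp add: T_def g algebra_simps of_nat_diff)
    then have "T (gau s r) k - gau s (Suc r) k = D powr (-K) *
       (up k * exp (- a * (real k + 1)\<^sup>2) + dn k * exp (- a * (real k - 1)\<^sup>2)
         - (1 + 2 * a) powr (-K) * exp (- (a / (1 + 2 * a)) * (real k)\<^sup>2))"
      unfolding g' by (simp only: right_diff_distrib)
    also have "\<bar>\<dots>\<bar> \<le> 1 * (C * a\<^sup>2 + 2 * a * \<bar>drift k - (K - 1/2)\<bar>)"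
      unfolding abs_mult C_def
    proof (intro mult_mono gaussian_one_step)
      show "\<bar>D powr - K\<bar> \<le> 1" using D K powr_mono[of "-K" 0 D] by simp
      show "up k - dn k = drift k / real k" using k by (simp add: drift_def)
    qed (use a s k K up_dn B in auto)
    also have "\<dots> \<le> C * s\<^sup>2 + 2 * s * \<bar>drift k - (kap + 1/2)\<bar>"
      using a C by (auto simp: K_def intro!: add_mono mult_mono)
    finally show "\<bar>T (gau s r) k - gau s (Suc r) k\<bar> \<le> C * s\<^sup>2 + 2 * s * \<bar>drift k - (kap + 1/2)\<bar>" .
  qed
qed

text \<open>Replacing the walk by the Bessel semigroup one step at a time (Lindeberg).\<close>
lemma laplace_lim:
  assumes c: "c \<ge> 0"
  shows "(\<lambda>n. E n (\<lambda>k. exp (- (c / (2 * real (Suc n))) * (real k)\<^sup>2))) \<longlonglongrightarrow> (1 + c) powr (- (kap + 1))"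
proof (cases "c = 0")
  case True
  then show ?thesis by (simp add: E_const)
next
  case False
  then have c: "c > 0" using assms by simp
  obtain C where C: "C \<ge> 0" and step: "\<And>s r k. 0 < s \<Longrightarrow> s \<le> 1/4 \<Longrightarrow> k \<ge> 1 \<Longrightarrow>
    \<bar>T (gau s r) k - gau s (Suc r) k\<bar> \<le> C * s\<^sup>2 + 2 * s * \<bar>drift k - (kap + 1/2)\<bar>"
    using gau_step by blast
  \<comment> \<open>With \<open>s\<close> of order \<open>1 / n\<close>, the \<open>n\<close> errors
    of size \<open>s^2\<close> add up to \<open>O(1/n)\<close>, and the drift errors
    \<open>e i\<close> enter only through their Cesaro mean.\<close>
  define s where "s = (\<lambda>n. c / (2 * real (Suc n)))"
  define e where "e = (\<lambda>i. E i (\<lambda>k. \<bar>drift k - (kap + 1/2)\<bar>))"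
  have s_lim: "s \<longlonglongrightarrow> 0" unfolding s_def by real_asymp
  have "(\<lambda>k. drift k - (kap + 1/2)) \<longlonglongrightarrow> (kap + 1/2) - (kap + 1/2)"
    unfolding drift_def by (intro tendsto_intros drift_lim)
  then have e_lim: "e \<longlonglongrightarrow> 0" unfolding e_def by (intro E_vanishing) simp
  have ces: "(\<lambda>n. (\<Sum>i<n. e i) / real n) \<longlonglongrightarrow> 0"
    by (rule stolz_cesaro[OF _ _ _ e_lim]) (auto simp: filterlim_real_sequentially)
  have e0: "e i \<ge> 0" for i unfolding e_def by (intro E_nonneg) simp
  have tele: "\<bar>E n (gau (s n) 0) - gau (s n) n 1\<bar> \<le> real n * (C * (s n)\<^sup>2) + 2 * s n * (\<Sum>i<n. e i)"
    if sn: "s n \<le> 1/4" for n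
  proof -
    \<comment> \<open>\<open>?H 0\<close> is the semigroup run for \<open>n\<close> steps from 1,
      \<open>?H n\<close> the expectation for the walk; raising \<open>i\<close> by one trades one
      semigroup step for one step of the walk.\<close>
    let ?H = "\<lambda>i. E i (gau (s n) (n - i))"
    have s0: "s n > 0" using c by (simp add: s_def)
    have "\<bar>?H (Suc i) - ?H i\<bar> \<le> C * (s n)\<^sup>2 + 2 * s n * e i" if "i < n" for i
    proof -
      have ni: "n - i = Suc (n - Suc i)" using that by simp
      have "?H (Suc i) - ?H i = E i (\<lambda>k. T (gau (s n) (n - Suc i)) k - gau (s n) (Suc (n - Suc i)) k)"
        unfolding E_Suc E_diff ni by (rule refl)
      then have "\<bar>?H (Suc i) - ?H i\<bar> = \<bar>E i (\<lambda>k. T (gau (s n) (n - Suc i)) k - gau (s n) (Suc (n - Suc i)) k)\<bar>"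
        by (rule arg_cong)
      also have "\<dots> \<le> E i (\<lambda>k. \<bar>T (gau (s n) (n - Suc i)) k - gau (s n) (Suc (n - Suc i)) k\<bar>)"
        by (rule E_abs)
      also have "\<dots> \<le> E i (\<lambda>k. C * (s n)\<^sup>2 + 2 * s n * \<bar>drift k - (kap + 1/2)\<bar>)"
        by (intro E_mono step s0 sn)
      also have "\<dots> = C * (s n)\<^sup>2 + 2 * s n * e i"
        unfolding E_add E_const E_cmult e_def ..
      finally show ?thesis .
    qed
    then have "(\<Sum>i<n. \<bar>?H (Suc i) - ?H i\<bar>) \<le> (\<Sum>i<n. C * (s n)\<^sup>2 + 2 * s n * e i)"
      by (intro sum_mono) auto
    also have "\<dots> = real n * (C * (s n)\<^sup>2) + 2 * s n * (\<Sum>i<n. e i)"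
      by (simp add: sum.distrib sum_distrib_left)
    finally have "\<bar>\<Sum>i<n. ?H (Suc i) - ?H i\<bar> \<le> real n * (C * (s n)\<^sup>2) + 2 * s n * (\<Sum>i<n. e i)"
      by (rule order_trans[OF sum_abs])
    moreover have "(\<Sum>i<n. ?H (Suc i) - ?H i) = ?H n - ?H 0"
      by (rule sum_lessThan_telescope)
    ultimately show ?thesis by (simp add: E_0)
  qed
  have "(\<lambda>n. E n (gau (s n) 0) - gau (s n) n 1) \<longlonglongrightarrow> 0"
  proof (rule Lim_null_comparison)
    show "eventually (\<lambda>n. norm (E n (gau (s n) 0) - gau (s n) n 1)
        \<le> C * (real n * (s n)\<^sup>2) + c * \<bar>(\<Sum>i<n. e i) / real n\<bar>) sequentially"
      using order_tendstoD(2)[OF s_lim, of "1/4", simplified] eventually_gt_at_top[of 0]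
    proof eventually_elim
      case (elim n)
      have 1: "2 * s n * (\<Sum>i<n. e i) = c * ((\<Sum>i<n. e i) / real (Suc n))" by (simp add: s_def del: of_nat_Suc)
      have "(\<Sum>i<n. e i) / real (Suc n) \<le> (\<Sum>i<n. e i) / real n"
        using elim by (intro divide_left_mono sum_nonneg e0) auto
      then have "(\<Sum>i<n. e i) / real (Suc n) \<le> \<bar>(\<Sum>i<n. e i) / real n\<bar>" by (rule order_trans[OF _ abs_ge_self])
      then have 2: "c * ((\<Sum>i<n. e i) / real (Suc n)) \<le> c * \<bar>(\<Sum>i<n. e i) / real n\<bar>"
        using c by (intro mult_left_mono) auto
      have "s n \<le> 1/4" using elim by simp
      from tele[OF this] show ?case using 1 2 unfolding real_norm_def mult.left_commute[of C] by linarith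
    qed
    have "(\<lambda>n. c\<^sup>2 / 4 * (real n / (real n + 1)\<^sup>2)) \<longlonglongrightarrow> c\<^sup>2 / 4 * 0"
      by (intro tendsto_mult tendsto_const) real_asymp
    moreover have "c\<^sup>2 / 4 * (real n / (real n + 1)\<^sup>2) = real n * (s n)\<^sup>2" for n
    proof -
      have "(s n)\<^sup>2 = c\<^sup>2 / (4 * (real n + 1)\<^sup>2)"
        by (simp add: s_def power_divide power_mult_distrib add.commute del: distrib_left_numeral)
      then show ?thesis by simp
    qed
    ultimately have "(\<lambda>n. real n * (s n)\<^sup>2) \<longlonglongrightarrow> 0" by simp
    then have "(\<lambda>n. C * (real n * (s n)\<^sup>2) + c * \<bar>(\<Sum>i<n. e i) / real n\<bar>) \<longlonglongrightarrow> C * 0 + c * \<bar>0\<bar>"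
      by (intro tendsto_intros ces)
    then show "(\<lambda>n. C * (real n * (s n)\<^sup>2) + c * \<bar>(\<Sum>i<n. e i) / real n\<bar>) \<longlonglongrightarrow> 0" by simp
  qed
  moreover have "(\<lambda>n. gau (s n) n 1) \<longlonglongrightarrow> (1 + c) powr (- (kap + 1)) * exp (- (0 / (1 + c)))"
  proof -
    have l: "(\<lambda>n. 1 + 2 * s n * real n) \<longlonglongrightarrow> 1 + c" unfolding s_def using c by real_asymp
    have c1: "1 + c \<noteq> 0" using c by simp
    have "(\<lambda>n. gau (s n) n 1) \<longlonglongrightarrow> (1 + c) powr (- (kap + 1)) * exp (- (0 / (1 + c)) * (real 1)\<^sup>2)"
      unfolding gau_def
      by (rule tendsto_mult[OF tendsto_powr[OF l tendsto_const c1]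
            tendsto_exp[OF tendsto_mult[OF tendsto_minus[OF tendsto_divide[OF s_lim l c1]] tendsto_const]]])
    then show ?thesis by simp
  qed
  ultimately have "(\<lambda>n. (E n (gau (s n) 0) - gau (s n) n 1) + gau (s n) n 1) \<longlonglongrightarrow> 0 + (1 + c) powr (- (kap + 1)) * exp (- (0 / (1 + c)))"
    by (rule tendsto_add)
  moreover have "gau (s n) 0 = (\<lambda>k. exp (- (c / (2 * real (Suc n))) * (real k)\<^sup>2))" for n
    by (rule ext) (simp add: gau_def s_def)
  ultimately show ?thesis by simp
qed


section \<open>The Gamma limit law\<close>

definition rho :: "real \<Rightarrow> real" where
  "rho y = indicator {0..} y * (y powr kap * exp (- y) / Gamma (kap + 1))"

lemma Gamma_pos: "Gamma kap > 0" "Gamma (kap + 1) > 0"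
  using kap_pos by (auto intro: Gamma_real_pos)

lemma rho_nonneg: "rho y \<ge> 0"
  using Gamma_pos by (simp add: rho_def)

lemma rho_exp_integral:
  assumes c: "c \<ge> 0"
  shows "has_bochner_integral lborel (\<lambda>y. rho y * exp (- c * y)) ((1 + c) powr (- (kap + 1)))"
proof -
  define f where "f = (\<lambda>t::real. indicator {0..} t * t powr kap / exp t)"
  have "has_bochner_integral lborel f (Gamma (kap + 1))"
  proof (rule has_bochner_integral_nn_integral)
    show "(\<integral>\<^sup>+ x. ennreal (f x) \<partial>lborel) = ennreal (Gamma (kap + 1))"
      using Gamma_conv_nn_integral_real[of "kap + 1"] kap_pos by (simp add: f_def)
  qed (use Gamma_pos in \<open>auto simp: f_def\<close>)
  then have "has_bochner_integral lborel (\<lambda>y. f (0 + (1 + c) * y)) (Gamma (kap + 1) /\<^sub>R \<bar>1 + c\<bar>)"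
    using c by (subst (asm) lborel_has_bochner_integral_real_affine_iff[of "1 + c" _ _ 0]) auto
  then have "has_bochner_integral lborel (\<lambda>y. ((1 + c) powr (- kap) / Gamma (kap + 1)) * f (0 + (1 + c) * y))
      (((1 + c) powr (- kap) / Gamma (kap + 1)) * (Gamma (kap + 1) /\<^sub>R \<bar>1 + c\<bar>))"
    by (intro has_bochner_integral_mult_right) auto
  moreover have "((1 + c) powr (- kap) / Gamma (kap + 1)) * (Gamma (kap + 1) /\<^sub>R \<bar>1 + c\<bar>) = (1 + c) powr (- (kap + 1))"
  proof -
    have r: "inverse \<bar>1 + c\<bar> = (1 + c) powr (- 1)" using c by (simp add: powr_minus)
    have "((1 + c) powr (- kap) / Gamma (kap + 1)) * (Gamma (kap + 1) /\<^sub>R \<bar>1 + c\<bar>)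
        = (1 + c) powr (- kap) * inverse \<bar>1 + c\<bar>" using Gamma_pos(2) by simp
    also have "\<dots> = (1 + c) powr (- kap) * (1 + c) powr (- 1)" unfolding r ..
    also have "\<dots> = (1 + c) powr (- (kap + 1))" by (simp only: powr_add[symmetric]) simp
    finally show ?thesis .
  qed
  moreover have "((1 + c) powr (- kap) / Gamma (kap + 1)) * f (0 + (1 + c) * y) = rho y * exp (- c * y)" for y
  proof (cases "y \<ge> 0")
    case True
    have "((1 + c) * y) powr kap = (1 + c) powr kap * y powr kap" using True c by (simp add: powr_mult)
    moreover have "exp ((1 + c) * y) = exp y * exp (c * y)" by (simp add: exp_add[symmetric] distrib_right)
    moreover have "(1 + c) powr kap \<noteq> 0" "(1 + c) * y \<ge> 0" using c True by auto
    ultimately show ?thesis using True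
      by (simp add: f_def rho_def powr_minus exp_minus divide_simps)
  next
    case False
    then have "(1 + c) * y < 0" using c by (simp add: mult_less_0_iff)
    then show ?thesis using False by (simp add: f_def rho_def)
  qed
  ultimately show ?thesis by simp
qed

lemma rho_integral: "integrable lborel rho" "integral\<^sup>L lborel rho = 1"
  using rho_exp_integral[of 0] by (auto simp: has_bochner_integral_iff)

text \<open>In the coordinate \<open>exp (- y)\<close> the half line becomes a subset of the compact
  interval \<open>[0, 1]\<close>, and Laplace transforms at integers become moments.\<close>

definition J :: "(real \<Rightarrow> real) \<Rightarrow> real" where
  "J h = (LINT y|lborel. rho y * h (exp (- y)))"

lemma J_power: "integrable lborel (\<lambda>y. rho y * exp (- y) ^ j)"
    "J (\<lambda>z. z ^ j) = (1 + real j) powr (- (kap + 1))"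
proof -
  have "(\<lambda>y. rho y * exp (- real j * y)) = (\<lambda>y. rho y * exp (- y) ^ j)"
    by (simp add: exp_of_nat_mult[symmetric])
  then show "integrable lborel (\<lambda>y. rho y * exp (- y) ^ j)" "J (\<lambda>z. z ^ j) = (1 + real j) powr (- (kap + 1))"
    using rho_exp_integral[of "real j"] by (auto simp: has_bochner_integral_iff J_def)
qed

lemma J_integrable:
  assumes "continuous_on UNIV h" "\<And>z. 0 \<le> h z" "\<And>z. h z \<le> 1"
  shows "integrable lborel (\<lambda>y. rho y * h (exp (- y)))"
proof (rule Bochner_Integration.integrable_bound[OF rho_integral(1)])
  have "h \<in> borel_measurable borel" using assms(1) by (rule borel_measurable_continuous_onI)
  then show "(\<lambda>y. rho y * h (exp (- y))) \<in> borel_measurable lborel"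
    using borel_measurable_integrable[OF rho_integral(1)] by measurable
  show "AE y in lborel. norm (rho y * h (exp (- y))) \<le> norm (rho y)"
    using assms by (intro AE_I2) (auto simp: abs_mult intro!: mult_left_le)
qed

definition Z :: "nat \<Rightarrow> nat \<Rightarrow> real" where "Z n k = exp (- (real k)\<^sup>2 / (2 * real (Suc n)))"

lemma Z_bounds: "0 \<le> Z n k" "Z n k \<le> 1"
  by (simp_all add: Z_def divide_nonpos_pos)

text \<open>Expectations of polynomials in \<open>Z n\<close> are combinations of the functionals in
  \<open>laplace_lim\<close> at integer parameters. Weierstrass approximation on
  \<open>[0, 1]\<close>, where \<open>Z n\<close> takes its values, extends the convergence to
  \<open>h\<close>.\<close>

lemma weak_limit:
  assumes h: "continuous_on UNIV h" "\<And>z. 0 \<le> h z" "\<And>z. h z \<le> (1::real)"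
  shows "(\<lambda>n. E n (\<lambda>k. h (Z n k))) \<longlonglongrightarrow> J h"
proof (rule LIMSEQ_I)
  fix r :: real assume r: "r > 0"
  have "continuous_on {0..1} h" using h(1) continuous_on_subset by blast
  then obtain g where "real_polynomial_function g" and g: "\<And>z. z \<in> {0..1} \<Longrightarrow> \<bar>h z - g z\<bar> < r / 4"
    using Stone_Weierstrass_real_polynomial_function[of "{0..1::real}" h "r/4"] r by (auto)
  then obtain a N where ga: "g = (\<lambda>z. \<Sum>i\<le>N. a i * z ^ i)"
    unfolding real_polynomial_function_iff_sum by blast
  define l where "l = (\<Sum>i\<le>(N::nat). a i * (1 + real i) powr (- (kap + 1)))"
  have Zp: "Z n k ^ i = exp (- (real i / (2 * real (Suc n))) * (real k)\<^sup>2)" for n k i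
    by (simp add: Z_def exp_of_nat_mult[symmetric])
  have "(\<lambda>n. \<Sum>i\<le>N. a i * E n (\<lambda>k. Z n k ^ i)) \<longlonglongrightarrow> l"
    unfolding Zp l_def by (intro tendsto_intros laplace_lim) auto
  then have lim: "(\<lambda>n. E n (\<lambda>k. g (Z n k))) \<longlonglongrightarrow> l"
    unfolding ga E_sum E_cmult .
  have gJ: "(\<lambda>y. rho y * g (exp (- y))) = (\<lambda>y. \<Sum>i\<le>N. a i * (rho y * exp (- y) ^ i))"
    by (simp add: ga sum_distrib_left mult_ac)
  have int: "integrable lborel (\<lambda>y. rho y * g (exp (- y)))"
    unfolding gJ by (intro Bochner_Integration.integrable_sum integrable_mult_right J_power)
  have Jg: "J g = l"
    unfolding J_def gJ l_def using J_power
    by (subst Bochner_Integration.integral_sum) (auto simp: J_def)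
  have "\<bar>J h - J g\<bar> = \<bar>LINT y|lborel. rho y * h (exp (- y)) - rho y * g (exp (- y))\<bar>"
    unfolding J_def by (subst Bochner_Integration.integral_diff[OF J_integrable[OF h] int]) simp
  also have "\<dots> \<le> (LINT y|lborel. \<bar>rho y * h (exp (- y)) - rho y * g (exp (- y))\<bar>)"
    by (rule integral_abs_bound)
  also have "\<dots> \<le> (LINT y|lborel. r / 4 * rho y)"
  proof (rule integral_mono)
    fix y :: real
    have "\<bar>rho y * h (exp (- y)) - rho y * g (exp (- y))\<bar> = rho y * \<bar>h (exp (- y)) - g (exp (- y))\<bar>"
      using rho_nonneg[of y] by (simp add: right_diff_distrib[symmetric] abs_mult)
    also have "\<dots> \<le> rho y * (r / 4)"
    proof (cases "y \<ge> 0")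
      case True
      then show ?thesis using g[of "exp (- y)"] rho_nonneg[of y] by (intro mult_left_mono) auto
    qed (simp add: rho_def)
    finally show "\<bar>rho y * h (exp (- y)) - rho y * g (exp (- y))\<bar> \<le> r / 4 * rho y" by (simp add: mult_ac)
  qed (use J_integrable[OF h] int rho_integral in auto)
  also have "\<dots> = r / 4" by (simp add: rho_integral)
  finally have 1: "\<bar>J h - l\<bar> \<le> r / 4" by (simp add: Jg)
  have 2: "\<bar>E n (\<lambda>k. h (Z n k)) - E n (\<lambda>k. g (Z n k))\<bar> \<le> r / 4" for n
  proof -
    have "\<bar>E n (\<lambda>k. h (Z n k) - g (Z n k))\<bar> \<le> E n (\<lambda>k. \<bar>h (Z n k) - g (Z n k)\<bar>)" by (rule E_abs)
    also have "\<dots> \<le> E n (\<lambda>k. r / 4)" by (intro E_mono less_imp_le g) (auto simp: Z_bounds)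
    finally show ?thesis by (simp add: E_diff E_const)
  qed
  obtain n0 where n0: "\<And>n. n \<ge> n0 \<Longrightarrow> \<bar>E n (\<lambda>k. g (Z n k)) - l\<bar> < r / 4"
    using LIMSEQ_D[OF lim, of "r/4"] r by auto
  have "norm (E n (\<lambda>k. h (Z n k)) - J h) < r" if "n \<ge> n0" for n
    using n0[OF that] 2[of n] 1 r unfolding real_norm_def by linarith
  then show "\<exists>no. \<forall>n\<ge>no. norm (E n (\<lambda>k. h (Z n k)) - J h) < r" by blast
qed

lemma trapezoid:
  fixes \<alpha> \<alpha>' \<beta>' \<beta> :: real
  assumes "\<alpha> < \<alpha>'" "\<beta>' < \<beta>"
  obtains h where "continuous_on UNIV h" "\<And>z. 0 \<le> h z" "\<And>z. h z \<le> (1::real)"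
    "\<And>z. \<alpha>' \<le> z \<Longrightarrow> z \<le> \<beta>' \<Longrightarrow> h z = 1" "\<And>z. z \<le> \<alpha> \<or> \<beta> \<le> z \<Longrightarrow> h z = 0"
proof
  let ?h = "\<lambda>z. max 0 (min 1 (min ((z - \<alpha>) / (\<alpha>' - \<alpha>)) ((\<beta> - z) / (\<beta> - \<beta>'))))"
  show "continuous_on UNIV ?h" using assms by (intro continuous_intros) auto
  show "?h z = 1" if "\<alpha>' \<le> z" "z \<le> \<beta>'" for z
    using assms that by (auto simp: min_def max_def field_simps)
  show "?h z = 0" if "z \<le> \<alpha> \<or> \<beta> \<le> z" for z
  proof -
    have "(z - \<alpha>) / (\<alpha>' - \<alpha>) \<le> 0 \<or> (\<beta> - z) / (\<beta> - \<beta>') \<le> 0"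
      using that assms by (auto intro: divide_nonpos_pos)
    moreover have "max 0 (min 1 (min A B)) = 0" if "A \<le> 0 \<or> B \<le> 0" for A B :: real
      using that by auto
    ultimately show ?thesis by blast
  qed
qed auto

definition prob :: "nat \<Rightarrow> real \<Rightarrow> real \<Rightarrow> real" where
  "prob n a b = E n (\<lambda>k. if 2 * a * real (Suc n) \<le> (real k)\<^sup>2 \<and> (real k)\<^sup>2 \<le> 2 * b * real (Suc n) then 1 else 0)"

lemma Z_between:
  "Z n k \<le> exp (- a) \<longleftrightarrow> 2 * a * real (Suc n) \<le> (real k)\<^sup>2"
  "exp (- b) \<le> Z n k \<longleftrightarrow> (real k)\<^sup>2 \<le> 2 * b * real (Suc n)"
  by (simp_all add: Z_def field_simps del: of_nat_Suc)

text \<open>The bound, length times the maxima of the two factors of the density, is crude, as is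
  its counterpart in \<open>prob_lower\<close>. It is used only on thin intervals, where
  \<open>b / a\<close> is close to 1. The margin \<open>t\<close> leaves room for a continuous test
  function between the indicators and then tends to 0.\<close>

lemma prob_upper:
  assumes ab: "0 < a" "a \<le> b" and ub: "(b - a) * b powr kap * exp (- a) / Gamma (kap + 1) < ub"
  shows "eventually (\<lambda>n. prob n a b < ub) sequentially"
proof -
  let ?F = "\<lambda>t. ((b + t) - (a - t)) * (b + t) powr kap * exp (- (a - t)) / Gamma (kap + 1)"
  have "(?F \<longlongrightarrow> ((b + 0) - (a - 0)) * (b + 0) powr kap * exp (- (a - 0)) / Gamma (kap + 1)) (at_right 0)"
    using ab Gamma_pos by (intro tendsto_intros) auto
  then have "eventually (\<lambda>t. ?F t < ub) (at_right 0)" using ub by (intro order_tendstoD(2)) auto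
  moreover have "eventually (\<lambda>t. t < a) (at_right 0)" using ab eventually_at_right_real[of 0 a] by (auto elim: eventually_mono)
  moreover have "eventually (\<lambda>t::real. t > 0) (at_right 0)" by (simp add: eventually_at_right_less)
  ultimately have "eventually (\<lambda>t. ?F t < ub \<and> t < a \<and> t > 0) (at_right 0)" by eventually_elim auto
  then obtain t where t: "?F t < ub" "t < a" "t > 0"
    using eventually_happens'[of "at_right (0::real)"] by auto
  obtain h where h: "continuous_on UNIV h" "\<And>z. 0 \<le> h z" "\<And>z. h z \<le> (1::real)"
    and h1: "\<And>z. exp (- b) \<le> z \<Longrightarrow> z \<le> exp (- a) \<Longrightarrow> h z = 1"
    and h0: "\<And>z. z \<le> exp (- (b + t)) \<or> exp (- (a - t)) \<le> z \<Longrightarrow> h z = 0"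
    using t by (rule_tac trapezoid[of "exp (- (b + t))" "exp (- b)" "exp (- a)" "exp (- (a - t))"]) auto
  let ?C = "(b + t) powr kap * exp (- (a - t)) / Gamma (kap + 1)"
  have "J h \<le> (LINT y|lborel. indicator {a - t..b + t} y * ?C)"
    unfolding J_def
  proof (rule integral_mono[OF J_integrable[OF h]])
    show "integrable lborel (\<lambda>y. indicator {a - t..b + t} y * ?C)"
      by (intro integrable_mult_left integrable_real_indicator) (auto simp: emeasure_lborel_Icc_eq)
    fix y :: real
    show "rho y * h (exp (- y)) \<le> indicator {a - t..b + t} y * ?C"
    proof (cases "y \<in> {a - t..b + t}")
      case True
      have "rho y * h (exp (- y)) \<le> rho y * 1" using rho_nonneg h by (intro mult_left_mono) auto
      also have "rho y \<le> ?C"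
        using True t kap_pos Gamma_pos by (auto simp: rho_def intro!: divide_right_mono mult_mono powr_mono2)
      finally show ?thesis using True by simp
    next
      case False
      then have "h (exp (- y)) = 0" by (intro h0) auto
      then show ?thesis using False by simp
    qed
  qed
  also have "\<dots> = ?F t" using ab t by simp
  finally have "J h < ub" using t by linarith
  then have "eventually (\<lambda>n. E n (\<lambda>k. h (Z n k)) < ub) sequentially"
    by (rule order_tendstoD(2)[OF weak_limit[OF h]])
  then show ?thesis
  proof eventually_elim
    case (elim n)
    have "prob n a b \<le> E n (\<lambda>k. h (Z n k))"
      unfolding prob_def by (intro E_mono) (use h(2) h1 Z_between in auto)
    then show ?case using elim by linarith
  qed
qed

lemma prob_lower:
  assumes ab: "0 < a" "a < b" and lb: "lb < (b - a) * a powr kap * exp (- b) / Gamma (kap + 1)"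
  shows "eventually (\<lambda>n. lb < prob n a b) sequentially"
proof -
  let ?F = "\<lambda>t. ((b - t) - (a + t)) * a powr kap * exp (- b) / Gamma (kap + 1)"
  have "(?F \<longlongrightarrow> ((b - 0) - (a + 0)) * a powr kap * exp (- b) / Gamma (kap + 1)) (at_right 0)"
    using ab Gamma_pos by (intro tendsto_intros) auto
  then have "eventually (\<lambda>t. lb < ?F t) (at_right 0)" using lb by (intro order_tendstoD(1)) auto
  moreover have "eventually (\<lambda>t. t < (b - a) / 2) (at_right 0)"
    using ab eventually_at_right_real[of 0 "(b - a) / 2"] by (auto elim: eventually_mono)
  moreover have "eventually (\<lambda>t::real. t > 0) (at_right 0)" by (simp add: eventually_at_right_less)
  ultimately have "eventually (\<lambda>t. lb < ?F t \<and> t < (b - a) / 2 \<and> t > 0) (at_right 0)" by eventually_elim auto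
  then obtain t where t: "lb < ?F t" "t < (b - a) / 2" "t > 0"
    using eventually_happens'[of "at_right (0::real)"] by auto
  have ab': "a + t \<le> b - t" using t by simp
  obtain h where h: "continuous_on UNIV h" "\<And>z. 0 \<le> h z" "\<And>z. h z \<le> (1::real)"
    and h1: "\<And>z. exp (- (b - t)) \<le> z \<Longrightarrow> z \<le> exp (- (a + t)) \<Longrightarrow> h z = 1"
    and h0: "\<And>z. z \<le> exp (- b) \<or> exp (- a) \<le> z \<Longrightarrow> h z = 0"
    using t by (rule_tac trapezoid[of "exp (- b)" "exp (- (b - t))" "exp (- (a + t))" "exp (- a)"]) auto
  let ?C = "a powr kap * exp (- b) / Gamma (kap + 1)"
  have "?F t = (LINT y|lborel. indicator {a + t..b - t} y * ?C)"
    using ab' by simp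
  also have "\<dots> \<le> J h"
    unfolding J_def
  proof (rule integral_mono[OF _ J_integrable[OF h]])
    show "integrable lborel (\<lambda>y. indicator {a + t..b - t} y * ?C)"
      by (intro integrable_mult_left integrable_real_indicator) (auto simp: ab')
    fix y :: real
    show "indicator {a + t..b - t} y * ?C \<le> rho y * h (exp (- y))"
    proof (cases "y \<in> {a + t..b - t}")
      case True
      have "?C \<le> rho y"
        using True t ab kap_pos Gamma_pos by (auto simp: rho_def intro!: divide_right_mono mult_mono powr_mono2)
      moreover have "h (exp (- y)) = 1" using True by (intro h1) auto
      ultimately show ?thesis using True by simp
    next
      case False
      then show ?thesis using rho_nonneg h by simp
    qed
  qed
  finally have "lb < J h" using t by linarith
  then have "eventually (\<lambda>n. lb < E n (\<lambda>k. h (Z n k))) sequentially"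
    by (rule order_tendstoD(1)[OF weak_limit[OF h]])
  then show ?thesis
  proof eventually_elim
    case (elim n)
    have "E n (\<lambda>k. h (Z n k)) \<le> prob n a b"
      unfolding prob_def
    proof (intro E_mono)
      fix k
      show "h (Z n k) \<le> (if 2 * a * real (Suc n) \<le> (real k)\<^sup>2 \<and> (real k)\<^sup>2 \<le> 2 * b * real (Suc n) then 1 else 0)"
        using h(3)[of "Z n k"] h0[of "Z n k"] Z_between(1)[of n k a] Z_between(2)[of b n k] 
        by (cases "Z n k \<le> exp (- a)"; cases "exp (- b) \<le> Z n k") auto
    qed
    then show ?case using elim by linarith
  qed
qed

text \<open>Markov's inequality for the Laplace functional. The constant is
  \<open>4 = 3 * (4/3)\<close>: 3 dominates \<open>exp 1\<close>, and \<open>4/3\<close> turns a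
  limit into an eventual bound. The power \<open>kap + 1\<close> is matched below against the decay
  of \<open>cc\<close>.\<close>

lemma prob_small:
  assumes c: "c > 0"
  shows "eventually (\<lambda>n. E n (\<lambda>k. if (real k)\<^sup>2 \<le> 2 / c * real (Suc n) then 1 else 0)
     \<le> 4 * (1 + c) powr (- (kap + 1))) sequentially"
proof -
  have "eventually (\<lambda>n. E n (\<lambda>k. exp (- (c / (2 * real (Suc n))) * (real k)\<^sup>2)) < 4/3 * (1 + c) powr (- (kap + 1))) sequentially"
    using c by (intro order_tendstoD(2)[OF laplace_lim]) auto
  then show ?thesis
  proof eventually_elim
    case (elim n)
    have "E n (\<lambda>k. if (real k)\<^sup>2 \<le> 2 / c * real (Suc n) then 1 else 0)
       \<le> E n (\<lambda>k. 3 * exp (- (c / (2 * real (Suc n))) * (real k)\<^sup>2))"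
    proof (rule E_mono)
      fix k
      show "(if (real k)\<^sup>2 \<le> 2 / c * real (Suc n) then 1 else 0) \<le> 3 * exp (- (c / (2 * real (Suc n))) * (real k)\<^sup>2)"
      proof (cases "(real k)\<^sup>2 \<le> 2 / c * real (Suc n)")
        case True
        have "c / (2 * real (Suc n)) * (real k)\<^sup>2 \<le> c / (2 * real (Suc n)) * (2 / c * real (Suc n))"
          using True c by (intro mult_left_mono) auto
        also have "\<dots> = 1" using c by (simp del: of_nat_Suc)
        finally have "exp (-1) \<le> exp (- (c / (2 * real (Suc n))) * (real k)\<^sup>2)" by simp
        moreover have "3 * exp (-1) \<ge> (1::real)" using exp_le by (simp add: exp_minus field_simps)
        ultimately have "1 \<le> 3 * exp (- (c / (2 * real (Suc n))) * (real k)\<^sup>2)" by linarith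
        then show ?thesis by (simp only: True if_True)
      qed simp
    qed
    also have "\<dots> = 3 * E n (\<lambda>k. exp (- (c / (2 * real (Suc n))) * (real k)\<^sup>2))" by (rule E_cmult)
    finally show ?case using elim by simp
  qed
qed

end

subsection \<open>Local limit theorem\<close>

lemma card_parity_interval:
  fixes m :: nat and x y :: real
  assumes x: "1 \<le> x" "x \<le> y"
  shows "(y - x) / 2 - 1 \<le> real (card {k. even (m + k) \<and> x \<le> real k \<and> real k \<le> y})"
    "real (card {k. even (m + k) \<and> x \<le> real k \<and> real k \<le> y}) \<le> (y - x) / 2 + 1"
    "finite {k. even (m + k) \<and> x \<le> real k \<and> real k \<le> y}"
proof -
  define r where "r = m mod 2"
  define A where "A = (x - real r) / 2"
  define B where "B = (y - real r) / 2"
  let ?S = "{k. even (m + k) \<and> x \<le> real k \<and> real k \<le> y}"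
  have r: "r \<le> 1" by (simp add: r_def)
  \<comment> \<open>\<open>1 <= x\<close> makes the lower index bound nonnegative, so the truncation
    by \<open>nat\<close> is harmless.\<close>
  have AB: "0 \<le> A" "A \<le> B" using x r by (auto simp: A_def B_def)
  have S: "?S = (\<lambda>i. 2 * i + r) ` {nat \<lceil>A\<rceil>..nat \<lfloor>B\<rfloor>}"
  proof (intro equalityI subsetI)
    fix k assume k: "k \<in> ?S"
    have "even (m + k)" using k by simp
    then have "k mod 2 = r" unfolding r_def by presburger
    then have k2: "k = 2 * (k div 2) + r" by (metis mult_div_mod_eq)
    have "real k = 2 * real (k div 2) + real r" by (subst k2) simp
    then have "A \<le> real (k div 2)" "real (k div 2) \<le> B" using k by (auto simp: A_def B_def)
    then have "k div 2 \<in> {nat \<lceil>A\<rceil>..nat \<lfloor>B\<rfloor>}" by (auto simp: le_nat_floor nat_ceiling_le_eq)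
    then show "k \<in> (\<lambda>i. 2 * i + r) ` {nat \<lceil>A\<rceil>..nat \<lfloor>B\<rfloor>}" using k2 by blast
  next
    fix k assume "k \<in> (\<lambda>i. 2 * i + r) ` {nat \<lceil>A\<rceil>..nat \<lfloor>B\<rfloor>}"
    then obtain i where i: "k = 2 * i + r" "nat \<lceil>A\<rceil> \<le> i" "i \<le> nat \<lfloor>B\<rfloor>" by auto
    then have "A \<le> real i" "real i \<le> B" using AB by linarith+
    moreover have "even (m + k)" unfolding i(1) r_def by presburger
    ultimately show "k \<in> ?S" using i(1) by (auto simp: A_def B_def)
  qed
  have "card ?S = Suc (nat \<lfloor>B\<rfloor>) - nat \<lceil>A\<rceil>"
    unfolding S by (subst card_image) (auto simp: inj_on_def)
  moreover have "nat \<lceil>A\<rceil> \<le> Suc (nat \<lfloor>B\<rfloor>)" using AB by linarith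
  ultimately have c: "real (card ?S) = real (nat \<lfloor>B\<rfloor>) + 1 - real (nat \<lceil>A\<rceil>)" by linarith
  have BA: "B - A = (y - x) / 2" by (simp add: A_def B_def field_simps)
  show "(y - x) / 2 - 1 \<le> real (card ?S)" "real (card ?S) \<le> (y - x) / 2 + 1"
    unfolding BA[symmetric] c using AB by linarith+
  show "finite ?S" unfolding S by simp
qed

context bessel_walk
begin

section \<open>Uniform asymptotics on the scale \<open>sqrt m\<close>\<close>

lemma eventually_k_large:
  assumes a: "a > 0"
  shows "eventually (\<lambda>m. \<forall>k. a * real m \<le> (real k)\<^sup>2 \<longrightarrow> k \<ge> N) sequentially"
  using eventually_ge_at_top[of "nat \<lceil>(real N)\<^sup>2 / a\<rceil>"]
proof eventually_elim
  case (elim m)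
  have "(real N)\<^sup>2 / a \<le> real m" using elim by linarith
  then have "(real N)\<^sup>2 \<le> a * real m" using a by (simp add: field_simps)
  then have "a * real m \<le> (real k)\<^sup>2 \<Longrightarrow> N \<le> k" for k
    by (metis of_nat_0_le_iff of_nat_le_iff order_trans power2_le_imp_le)
  then show ?case by blast
qed

text \<open>Replaces \<open>L k\<close> by \<open>Lf m\<close> over a whole window of
  \<open>k\<close> at once; half of \<open>\<xi>\<close> pays for the given limit, half for slow
  variation.\<close>

lemma uniform_asymp:
  assumes lim: "(\<lambda>k. f k * L k / real k powr e) \<longlonglongrightarrow> l" and l: "l > 0" and a: "0 < a" and xi: "\<xi> > 0"
  shows "eventually (\<lambda>m. \<forall>k. a * real m \<le> (real k)\<^sup>2 \<and> (real k)\<^sup>2 \<le> b * real m \<longrightarrow>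
      exp (- \<xi>) * (l * real k powr e) \<le> f k * Lf m \<and> f k * Lf m \<le> exp \<xi> * (l * real k powr e)) sequentially"
proof -
  have "eventually (\<lambda>k. exp (- \<xi> / 2) * l < f k * L k / real k powr e \<and> f k * L k / real k powr e < exp (\<xi> / 2) * l) sequentially"
    using order_tendstoD[OF lim, of "exp (- \<xi> / 2) * l"] order_tendstoD[OF lim, of "exp (\<xi> / 2) * l"] l xi
    by (auto intro: eventually_conj simp: mult_less_cancel_right1 mult_less_cancel_right2)
  then obtain N where N: "\<And>k. k \<ge> N \<Longrightarrow> exp (- \<xi> / 2) * l < f k * L k / real k powr e \<and> f k * L k / real k powr e < exp (\<xi> / 2) * l"
    by (auto simp: eventually_at_top_linorder)
  have x2: "\<xi> / 2 > 0" using xi by simp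
  show ?thesis
    using eventually_k_large[OF a, of "max N 1"] Lf_asymp[OF a x2, of b]
  proof eventually_elim
    case (elim m)
    show ?case
    proof (intro allI impI)
      fix k assume k: "a * real m \<le> (real k)\<^sup>2 \<and> (real k)\<^sup>2 \<le> b * real m"
      then have kN: "k \<ge> max N 1" using elim(1) by blast
      have LL: "L k \<le> exp (\<xi> / 2) * Lf m" "Lf m \<le> exp (\<xi> / 2) * L k" using elim(2) k by blast+
      have pk: "real k powr e > 0" using kN by simp
      have f1: "exp (- \<xi> / 2) * (l * real k powr e) \<le> f k * L k" "f k * L k \<le> exp (\<xi> / 2) * (l * real k powr e)"
        using N[of k] kN pk by (auto simp: field_simps)
      have "0 < f k * L k" by (rule less_le_trans[OF _ f1(1)]) (use l pk in simp)
      then have fk: "f k > 0" using L_pos[of k] by (simp add: zero_less_mult_iff)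
      have ee: "exp (- \<xi>) = exp (- \<xi> / 2) * exp (- \<xi> / 2)" "exp \<xi> = exp (\<xi> / 2) * exp (\<xi> / 2)"
        by (simp_all add: exp_add[symmetric])
      have "f k * Lf m \<le> f k * (exp (\<xi> / 2) * L k)" using LL fk by (intro mult_left_mono) auto
      also have "\<dots> = exp (\<xi> / 2) * (f k * L k)" by simp
      also have "\<dots> \<le> exp (\<xi> / 2) * (exp (\<xi> / 2) * (l * real k powr e))" using f1 by (intro mult_left_mono) auto
      finally have u: "f k * Lf m \<le> exp \<xi> * (l * real k powr e)" by (simp add: ee)
      have "exp (- \<xi> / 2) * L k \<le> Lf m" using LL(1) by (simp add: exp_minus field_simps)
      then have "f k * (exp (- \<xi> / 2) * L k) \<le> f k * Lf m" using fk by (intro mult_left_mono) auto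
      moreover have "exp (- \<xi> / 2) * (exp (- \<xi> / 2) * (l * real k powr e)) \<le> exp (- \<xi> / 2) * (f k * L k)"
        using f1 by (intro mult_left_mono) auto
      moreover have "f k * (exp (- \<xi> / 2) * L k) = exp (- \<xi> / 2) * (f k * L k)" by simp
      ultimately have "exp (- \<xi>) * (l * real k powr e) \<le> f k * Lf m" unfolding ee mult.assoc by linarith
      with u show "exp (- \<xi>) * (l * real k powr e) \<le> f k * Lf m \<and> f k * Lf m \<le> exp \<xi> * (l * real k powr e)" by simp
    qed
  qed
qed

text \<open>The claimed size of \<open>v (m - 1)\<close> near \<open>0\<close>.\<close>

definition cc :: "nat \<Rightarrow> real" where
  "cc m = 2 powr (2 - kap) * kap / (K0 p \<delta> * Gamma kap) * real m powr (-(1 + kap)) * Lf m"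

lemma cc_pos: "m \<ge> 1 \<Longrightarrow> cc m > 0"
  using kap_pos K0_pos Gamma_pos Lf_pos by (simp add: cc_def)

lemma cc_nonneg: "cc m \<ge> 0"
  using kap_pos K0_pos Gamma_pos Lf_pos[of m] by (simp add: cc_def)

lemma Gamma_Suc: "Gamma (kap + 1) = kap * Gamma kap"
  using Gamma_plus1[of kap] kap_pos by (auto simp: nonpos_Ints_def)

text \<open>Multiplication by \<open>cc m\<close> removes \<open>K0\<close> and the slowly varying
  function together: the remaining expression contains only \<open>kap\<close>, \<open>k\<close> and
  \<open>m\<close>.\<close>

lemma wt_uniform:
  assumes a: "0 < a" and xi: "\<xi> > 0"
  shows "eventually (\<lambda>m. \<forall>k. a * real m \<le> (real k)\<^sup>2 \<and> (real k)\<^sup>2 \<le> b * real m \<longrightarrow>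
      exp (- \<xi>) * (2 powr (1 - kap) / Gamma (kap + 1) * real m powr (-(1 + kap)) * real k powr (2 * kap + 1)) \<le> cc m * wt k
    \<and> cc m * wt k \<le> exp \<xi> * (2 powr (1 - kap) / Gamma (kap + 1) * real m powr (-(1 + kap)) * real k powr (2 * kap + 1))) sequentially"
proof -
  have "K0 p \<delta> / (2 * kap\<^sup>2) > 0" using kap_pos K0_pos by simp
  from uniform_asymp[OF wt_asymp this a xi, of b] show ?thesis
  proof eventually_elim
    case (elim m)
    define D where "D = 2 powr (2 - kap) * kap / (K0 p \<delta> * Gamma kap) * real m powr (-(1 + kap))"
    have D: "D \<ge> 0" using kap_pos K0_pos Gamma_pos by (simp add: D_def)
    have c: "cc m * wt k = D * (wt k * Lf m)" for k by (simp add: cc_def D_def)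
    have d: "2 powr (1 - kap) / Gamma (kap + 1) * real m powr (-(1 + kap)) * z = D * (K0 p \<delta> / (2 * kap\<^sup>2) * z)" for z
    proof -
      have "2 powr (2 - kap) = 2 * 2 powr (1 - kap)" by (simp add: powr_diff)
      then show ?thesis using kap_pos K0_pos Gamma_pos unfolding D_def Gamma_Suc by (simp add: field_simps power2_eq_square)
    qed
    show ?case unfolding c d mult.left_commute[of _ D]
      using elim mult_left_mono[OF _ D] by blast
  qed
qed

lemma M_uniform:
  assumes a: "0 < a" and xi: "\<xi> > 0"
  shows "eventually (\<lambda>m. \<forall>k. a * real m \<le> (real k)\<^sup>2 \<and> (real k)\<^sup>2 \<le> b * real m \<longrightarrow>
      exp (- \<xi>) * (2 powr (1 - kap) / Gamma kap * real m powr (-(1 + kap)) * real k powr (2 * kap)) \<le> cc m * M k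
    \<and> cc m * M k \<le> exp \<xi> * (2 powr (1 - kap) / Gamma kap * real m powr (-(1 + kap)) * real k powr (2 * kap))) sequentially"
proof -
  have "K0 p \<delta> / (2 * kap) > 0" using kap_pos K0_pos by simp
  from uniform_asymp[OF M_asymp this a xi, of b] show ?thesis
  proof eventually_elim
    case (elim m)
    define D where "D = 2 powr (2 - kap) * kap / (K0 p \<delta> * Gamma kap) * real m powr (-(1 + kap))"
    have D: "D \<ge> 0" using kap_pos K0_pos Gamma_pos by (simp add: D_def)
    have c: "cc m * M k = D * (M k * Lf m)" for k by (simp add: cc_def D_def)
    have d: "2 powr (1 - kap) / Gamma kap * real m powr (-(1 + kap)) * z = D * (K0 p \<delta> / (2 * kap) * z)" for z
    proof -
      have "2 powr (2 - kap) = 2 * 2 powr (1 - kap)" by (simp add: powr_diff)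
      then show ?thesis using kap_pos K0_pos Gamma_pos unfolding D_def by (simp add: field_simps)
    qed
    show ?case unfolding c d mult.left_commute[of _ D]
      using elim mult_left_mono[OF _ D] by blast
  qed
qed

definition shell :: "nat \<Rightarrow> real \<Rightarrow> real \<Rightarrow> nat set" where
  "shell m a b = {k. even (m + k) \<and> 2 * a * real m \<le> (real k)\<^sup>2 \<and> (real k)\<^sup>2 \<le> 2 * b * real m}"

lemma shell_eq:
  assumes "0 \<le> a" "0 \<le> b"
  shows "shell m a b = {k. even (m + k) \<and> sqrt (2 * a * real m) \<le> real k \<and> real k \<le> sqrt (2 * b * real m)}"
proof -
  have "(real k)\<^sup>2 \<le> 2 * b * real m" if "real k \<le> sqrt (2 * b * real m)" for k
    using that by (intro sqrt_ge_absD) simp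
  then show ?thesis using assms by (auto simp: shell_def real_le_rsqrt sqrt_le_D intro: real_le_lsqrt)
qed

lemma prob_eq:
  assumes a: "0 < a" and fin: "finite (shell (Suc n) a b)"
  shows "prob n a b = (\<Sum>k\<in>shell (Suc n) a b. wt k * v n k)"
proof -
  let ?P = "\<lambda>k. 2 * a * real (Suc n) \<le> (real k)\<^sup>2 \<and> (real k)\<^sup>2 \<le> 2 * b * real (Suc n)"
  have z: "0 \<notin> shell (Suc n) a b" using a by (simp add: shell_def mult_le_0_iff)
  have "prob n a b = (\<Sum>k\<in>{1..Suc n}. if k \<in> shell (Suc n) a b then wt k * v n k else 0)"
    unfolding prob_def E_def
    by (intro sum.cong) (auto simp: shell_def v_parity)
  also have "\<dots> = (\<Sum>k\<in>{1..Suc n} \<inter> shell (Suc n) a b. wt k * v n k)"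
    by (simp add: sum.inter_restrict)
  also have "\<dots> = (\<Sum>k\<in>shell (Suc n) a b. wt k * v n k)"
  proof (intro sum.mono_neutral_left fin ballI)
    fix k assume k: "k \<in> shell (Suc n) a b - {1..Suc n} \<inter> shell (Suc n) a b"
    then have "k \<noteq> 0" using z by (metis DiffD1)
    then have "k > Suc n" using k by auto
    then show "wt k * v n k = 0" by (simp add: v_support)
  qed auto
  finally show ?thesis .
qed

lemma sqrt_diff_bounds:
  fixes a b :: real
  assumes "0 < a" "a < b"
  shows "(b - a) / (2 * sqrt b) \<le> sqrt b - sqrt a" "sqrt b - sqrt a \<le> (b - a) / (2 * sqrt a)"
proof -
  have e: "b - a = (sqrt b - sqrt a) * (sqrt b + sqrt a)"
    using assms by (simp add: algebra_simps)
  have s: "sqrt a < sqrt b" "sqrt a > 0" using assms by auto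
  have "(sqrt b - sqrt a) * (sqrt b + sqrt a) \<le> (sqrt b - sqrt a) * (2 * sqrt b)"
    "(sqrt b - sqrt a) * (2 * sqrt a) \<le> (sqrt b - sqrt a) * (sqrt b + sqrt a)"
    using s by (auto intro!: mult_left_mono)
  then show "(b - a) / (2 * sqrt b) \<le> sqrt b - sqrt a" "sqrt b - sqrt a \<le> (b - a) / (2 * sqrt a)"
    using s unfolding e[symmetric] by (auto simp: field_simps)
qed

text \<open>Heuristically, \<open>cc m\<close> times the weight of a shell is the integral of
  \<open>y powr kap / Gamma (kap + 1)\<close> over \<open>[a, b]\<close>. The probability of the
  shell has the same integrand with an extra \<open>exp (- y)\<close>, so the quotient shows
  \<open>v n k\<close> to be \<open>cc m * exp (- y)\<close>. Counting lattice points and bounding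
  the weights at the endpoints avoids the integral.\<close>

lemma shell_mass:
  assumes ab: "0 < a" "a < b" and xi: "\<xi> > 0"
  shows "eventually (\<lambda>m. finite (shell m a b) \<and>
      exp (- \<xi>) * ((b - a) * a powr (kap + 1/2) / (sqrt b * Gamma (kap + 1))) \<le> cc m * (\<Sum>k\<in>shell m a b. wt k)
    \<and> cc m * (\<Sum>k\<in>shell m a b. wt k) \<le> exp \<xi> * ((b - a) * b powr (kap + 1/2) / (sqrt a * Gamma (kap + 1)))) sequentially"
proof -
  define G where "G = Gamma (kap + 1)"
  have G: "G > 0" using Gamma_pos by (simp add: G_def)
  define \<sigma> where "\<sigma> = (sqrt (2 * b) - sqrt (2 * a)) / 2"
  have \<sigma>: "\<sigma> > 0" using ab by (simp add: \<sigma>_def)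
  have x2: "\<xi> / 2 > 0" using xi by simp
  have a2: "2 * a > 0" using ab by simp
  \<comment> \<open>The number of states in the shell is \<open>\<sigma> * sqrt m\<close> up to 1;
    the rounding error is absorbed into a factor \<open>exp (\<xi> / 2)\<close> or its
    inverse.\<close>
  have "eventually (\<lambda>m. exp (- \<xi> / 2) * (\<sigma> * sqrt (real m)) \<le> \<sigma> * sqrt (real m) - 1) sequentially"
  proof -
    have lt: "exp (- \<xi> / 2) < 1" using xi by simp
    have "filterlim (\<lambda>m. sqrt (real m)) at_top sequentially" by real_asymp
    then have "eventually (\<lambda>m. 1 / (\<sigma> * (1 - exp (- \<xi> / 2))) \<le> sqrt (real m)) sequentially"
      unfolding filterlim_at_top by blast
    then show ?thesis
    proof eventually_elim
      case (elim m)
      then have "1 \<le> sqrt (real m) * (\<sigma> * (1 - exp (- \<xi> / 2)))" using \<sigma> lt by (subst (asm) pos_divide_le_eq) auto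
      then show ?case by (simp add: algebra_simps)
    qed
  qed
  moreover have "eventually (\<lambda>m. \<sigma> * sqrt (real m) + 1 \<le> exp (\<xi> / 2) * (\<sigma> * sqrt (real m))) sequentially"
  proof -
    have lt: "exp (\<xi> / 2) > 1" using xi by simp
    have "filterlim (\<lambda>m. sqrt (real m)) at_top sequentially" by real_asymp
    then have "eventually (\<lambda>m. 1 / (\<sigma> * (exp (\<xi> / 2) - 1)) \<le> sqrt (real m)) sequentially"
      unfolding filterlim_at_top by blast
    then show ?thesis
    proof eventually_elim
      case (elim m)
      then have "1 \<le> sqrt (real m) * (\<sigma> * (exp (\<xi> / 2) - 1))" using \<sigma> lt by (subst (asm) pos_divide_le_eq) auto
      then show ?case by (simp add: algebra_simps)
    qed
  qed
  moreover have "eventually (\<lambda>m. m \<ge> nat \<lceil>1 / (2 * a)\<rceil> \<and> m \<ge> 1) sequentially"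
    by (rule eventually_conj[OF eventually_ge_at_top eventually_ge_at_top])
  ultimately show ?thesis
    using wt_uniform[OF a2 x2, of "2 * b"]
  proof eventually_elim
    case (elim m)
    define S where "S = shell m a b"
    define s where "s = sqrt (real m)"
    have m1: "real m > 0" "1 / (2 * a) \<le> real m" using elim(3) by linarith+
    have s: "s > 0" "s * s = real m" using m1 by (auto simp: s_def)
    have am: "1 \<le> 2 * a * real m" using m1(2) ab by (simp add: field_simps)
    have x: "1 \<le> sqrt (2 * a * real m)" "sqrt (2 * a * real m) \<le> sqrt (2 * b * real m)"
      using am ab mult_right_mono[of a b "real m"] by auto
    have d: "(sqrt (2 * b * real m) - sqrt (2 * a * real m)) / 2 = \<sigma> * s"
      by (simp add: \<sigma>_def s_def real_sqrt_mult field_simps)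
    note card = card_parity_interval[OF x, of m, folded shell_eq[OF less_imp_le[OF ab(1)] less_imp_le[OF less_trans[OF ab]]], unfolded d, folded S_def]
    have c1: "exp (- \<xi> / 2) * (\<sigma> * s) \<le> real (card S)" using card(1) elim(1) unfolding s_def by linarith
    have c2: "real (card S) \<le> exp (\<xi> / 2) * (\<sigma> * s)" using card(2) elim(2) unfolding s_def by linarith
    define Q where "Q = 2 powr (1 - kap) / G * real m powr (-(1 + kap))"
    have Q: "Q > 0" using m1 G by (simp add: Q_def)
    have W: "exp (- \<xi> / 2) * (Q * real k powr (2 * kap + 1)) \<le> cc m * wt k"
      "cc m * wt k \<le> exp (\<xi> / 2) * (Q * real k powr (2 * kap + 1))" if "k \<in> S" for k
      using elim(4) that unfolding S_def shell_def Q_def G_def by auto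
    have pk: "(2 * a * real m) powr (kap + 1/2) \<le> real k powr (2 * kap + 1)"
      "real k powr (2 * kap + 1) \<le> (2 * b * real m) powr (kap + 1/2)" if k: "k \<in> S" for k
    proof -
      have k2: "2 * a * real m \<le> (real k)\<^sup>2" "(real k)\<^sup>2 \<le> 2 * b * real m" using k by (auto simp: S_def shell_def)
      then have "k > 0" using am by (cases k) auto
      then have "real k powr (2 * kap + 1) = ((real k)\<^sup>2) powr (kap + 1/2)"
        by (simp add: powr_powr powr_numeral[symmetric] distrib_left del: powr_numeral)
      then show "(2 * a * real m) powr (kap + 1/2) \<le> real k powr (2 * kap + 1)"
        "real k powr (2 * kap + 1) \<le> (2 * b * real m) powr (kap + 1/2)"
        using k2 ab kap_pos am by (auto intro!: powr_mono2)
    qed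
    have id: "Q * (2 * t * real m) powr (kap + 1/2) * (sqrt 2 * s / 2) = 2 * t powr (kap + 1/2) / G" if t: "t > 0" for t
    proof -
      have h: "sqrt z = z powr (1/2)" if "z \<ge> 0" for z :: real using that by (simp add: powr_half_sqrt)
      have "Q * (2 * t * real m) powr (kap + 1/2) * (sqrt 2 * s / 2)
        = (2 powr (1 - kap) * 2 powr (kap + 1/2) * 2 powr (1/2) * 2 powr (- 1)) *
          (real m powr (-(1 + kap)) * real m powr (kap + 1/2) * real m powr (1/2)) * t powr (kap + 1/2) / G"
        using t m1 by (simp add: Q_def s_def h powr_mult powr_minus_divide) (simp add: mult_ac)
      also have "2 powr (1 - kap) * 2 powr (kap + 1/2) * 2 powr (1/2) * 2 powr (- 1) = (2::real)"
        by (simp only: powr_add[symmetric]) simp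
      also have "real m powr (-(1 + kap)) * real m powr (kap + 1/2) * real m powr (1/2) = 1"
        using m1 by (simp only: powr_add[symmetric]) simp
      finally show ?thesis by simp
    qed
    have \<sigma>': "\<sigma> = sqrt 2 / 2 * (sqrt b - sqrt a)" by (simp add: \<sigma>_def real_sqrt_mult right_diff_distrib)
    have ee: "exp (- \<xi>) = exp (- \<xi> / 2) * exp (- \<xi> / 2)" "exp \<xi> = exp (\<xi> / 2) * exp (\<xi> / 2)"
      by (simp_all add: exp_add[symmetric])
    have sumc: "cc m * (\<Sum>k\<in>S. wt k) = (\<Sum>k\<in>S. cc m * wt k)" by (simp add: sum_distrib_left)
    have lower: "exp (- \<xi>) * ((b - a) * a powr (kap + 1/2) / (sqrt b * G)) \<le> cc m * (\<Sum>k\<in>S. wt k)"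
    proof -
      have "exp (- \<xi>) * ((b - a) * a powr (kap + 1/2) / (sqrt b * G))
        = exp (- \<xi>) * ((b - a) / (2 * sqrt b)) * (2 * a powr (kap + 1/2) / G)" using ab G by simp
      also have "\<dots> \<le> exp (- \<xi>) * (sqrt b - sqrt a) * (2 * a powr (kap + 1/2) / G)"
        using sqrt_diff_bounds(1)[OF ab] G by (intro mult_right_mono mult_left_mono) auto
      also have "\<dots> = exp (- \<xi> / 2) * (\<sigma> * s) * (exp (- \<xi> / 2) * (Q * (2 * a * real m) powr (kap + 1/2)))"
        unfolding id[OF ab(1), symmetric] \<sigma>' ee by (simp add: mult_ac)
      also have "\<dots> \<le> real (card S) * (exp (- \<xi> / 2) * (Q * (2 * a * real m) powr (kap + 1/2)))"
        using c1 Q by (intro mult_right_mono) auto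
      also have "\<dots> \<le> (\<Sum>k\<in>S. cc m * wt k)"
      proof (rule sum_bounded_below)
        fix k assume k: "k \<in> S"
        have "exp (- \<xi> / 2) * (Q * (2 * a * real m) powr (kap + 1/2)) \<le> exp (- \<xi> / 2) * (Q * real k powr (2 * kap + 1))"
          using pk[OF k] Q by (intro mult_left_mono) auto
        then show "exp (- \<xi> / 2) * (Q * (2 * a * real m) powr (kap + 1/2)) \<le> cc m * wt k"
          using W(1)[OF k] by linarith
      qed
      finally show ?thesis unfolding sumc .
    qed
    have b0: "b > 0" using ab by simp
    have upper: "cc m * (\<Sum>k\<in>S. wt k) \<le> exp \<xi> * ((b - a) * b powr (kap + 1/2) / (sqrt a * G))"
    proof -
      have "(\<Sum>k\<in>S. cc m * wt k) \<le> real (card S) * (exp (\<xi> / 2) * (Q * (2 * b * real m) powr (kap + 1/2)))"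
      proof (rule sum_bounded_above)
        fix k assume k: "k \<in> S"
        have "exp (\<xi> / 2) * (Q * real k powr (2 * kap + 1)) \<le> exp (\<xi> / 2) * (Q * (2 * b * real m) powr (kap + 1/2))"
          using pk[OF k] Q by (intro mult_left_mono) auto
        then show "cc m * wt k \<le> exp (\<xi> / 2) * (Q * (2 * b * real m) powr (kap + 1/2))"
          using W(2)[OF k] by linarith
      qed
      also have "\<dots> \<le> exp (\<xi> / 2) * (\<sigma> * s) * (exp (\<xi> / 2) * (Q * (2 * b * real m) powr (kap + 1/2)))"
        using c2 Q by (intro mult_right_mono) auto
      also have "\<dots> = exp \<xi> * (sqrt b - sqrt a) * (2 * b powr (kap + 1/2) / G)"
        unfolding id[OF b0, symmetric] \<sigma>' ee by (simp add: mult_ac)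
      also have "\<dots> \<le> exp \<xi> * ((b - a) / (2 * sqrt a)) * (2 * b powr (kap + 1/2) / G)"
        using sqrt_diff_bounds(2)[OF ab] G by (intro mult_right_mono mult_left_mono) auto
      also have "\<dots> = exp \<xi> * ((b - a) * b powr (kap + 1/2) / (sqrt a * G))" using ab G by simp
      finally show ?thesis unfolding sumc .
    qed
    show ?case using lower upper card(3) unfolding S_def G_def by blast
  qed
qed

end

lemma shell_quotient:
  fixes c e e' d P u G A q :: real
  assumes "d > 0" "G > 0" "A > 0" "q > 0" "e' > 0"
  shows "c * (e * (d * P * u / G)) / (e' * (d * A / (q * G))) = e / e' * u * (P * q / A) * c"
  using assms by (simp add: field_simps)

context bessel_walk
begin

text \<open>Since \<open>v n\<close> is monotone along a parity class, its value at \<open>k\<close> is at most (at least) its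
  average over any shell to the left (right) of \<open>k\<close>.\<close>
lemma v_upper_shell:
  assumes ab: "0 < a" "a < b" and xi: "\<xi> > 0"
  shows "eventually (\<lambda>n. \<forall>k. even (Suc n + k) \<and> 2 * b * real (Suc n) \<le> (real k)\<^sup>2 \<longrightarrow>
     v n k \<le> exp \<xi> * exp (- a) * (b / a) powr (kap + 1/2) * cc (Suc n)) sequentially"
proof -
  define G where "G = Gamma (kap + 1)"
  have G: "G > 0" using Gamma_pos by (simp add: G_def)
  have b: "b > 0" using ab by simp
  have x2: "\<xi> / 2 > 0" using xi by simp
  let ?p = "(b - a) * b powr kap * exp (- a) / G"
  let ?w = "(b - a) * a powr (kap + 1/2) / (sqrt b * G)"
  have p0: "?p > 0" "?w > 0" using ab b G by auto
  have "?p * 1 < ?p * exp (\<xi> / 2)" using p0(1) xi by (intro mult_strict_left_mono) auto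
  then have "?p < exp (\<xi> / 2) * ?p" by (simp add: mult.commute)
  from prob_upper[OF ab(1) less_imp_le[OF ab(2)] this[unfolded G_def]]
  have P: "eventually (\<lambda>n. prob n a b < exp (\<xi> / 2) * ?p) sequentially" unfolding G_def .
  show ?thesis
    using P shell_mass[OF ab x2, folded G_def, THEN eventually_sequentially_Suc[THEN iffD2]]
  proof eventually_elim
    case (elim n)
    show ?case
    proof (intro allI impI)
      fix k assume k: "even (Suc n + k) \<and> 2 * b * real (Suc n) \<le> (real k)\<^sup>2"
      define S where "S = shell (Suc n) a b"
      define W where "W = (\<Sum>j\<in>S. wt j)"
      have fin: "finite S" and w: "exp (- \<xi> / 2) * ?w \<le> cc (Suc n) * W"
        using elim(2) by (auto simp: S_def W_def)
      have le: "v n k \<le> v n j" if j: "j \<in> S" for j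
      proof (rule v_antimono)
        have "0 < 2 * a * real (Suc n)" using ab by simp
        also have "\<dots> \<le> (real j)\<^sup>2" using j by (simp add: S_def shell_def)
        finally show "1 \<le> j" by (cases j) auto
        have "(real j)\<^sup>2 \<le> 2 * b * real (Suc n)" using j by (simp add: S_def shell_def)
        with k have "(real j)\<^sup>2 \<le> (real k)\<^sup>2" by linarith
        from power2_le_imp_le[OF this] show "j \<le> k" by simp
        show "even (j + k)" using j k by (auto simp: S_def shell_def)
      qed
      have wj: "wt j \<ge> 0" if "j \<in> S" for j
      proof -
        have "0 < 2 * a * real (Suc n)" using ab by simp
        also have "\<dots> \<le> (real j)\<^sup>2" using that by (simp add: S_def shell_def)
        finally have "1 \<le> j" by (cases j) auto
        then show ?thesis using wt_pos less_imp_le by blast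
      qed
      have "W * v n k \<le> prob n a b"
        unfolding prob_eq[OF ab(1) fin[unfolded S_def]] W_def S_def[symmetric] sum_distrib_right
        using le wj by (intro sum_mono mult_left_mono) auto
      then have "W * v n k \<le> exp (\<xi> / 2) * ?p" using elim(1) by linarith
      then have "cc (Suc n) * (W * v n k) \<le> cc (Suc n) * (exp (\<xi> / 2) * ?p)"
        by (intro mult_left_mono cc_nonneg)
      moreover have "exp (- \<xi> / 2) * ?w * v n k \<le> cc (Suc n) * W * v n k"
        using w by (intro mult_right_mono v_nonneg)
      ultimately have "exp (- \<xi> / 2) * ?w * v n k \<le> cc (Suc n) * (exp (\<xi> / 2) * ?p)" by (simp add: mult_ac)
      then have "v n k \<le> cc (Suc n) * (exp (\<xi> / 2) * ?p) / (exp (- \<xi> / 2) * ?w)"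
        by (intro mult_imp_le_div_pos mult_pos_pos exp_gt_zero p0(2)) (simp only: mult.commute[of "v n k"])
      \<comment> \<open>Dividing the probability by the weight cancels the length of the shell and
        the Gamma factor; \<open>(b / a) powr (kap + 1/2)\<close> is the price of the endpoint
        bounds and tends to 1 for thin shells.\<close>
      also have "\<dots> = exp \<xi> * exp (- a) * (b / a) powr (kap + 1/2) * cc (Suc n)"
      proof -
        have "exp \<xi> = exp (\<xi> / 2) / exp (- \<xi> / 2)" by (simp add: exp_diff[symmetric])
        moreover have "(b / a) powr (kap + 1/2) = b powr kap * sqrt b / a powr (kap + 1/2)"
          using ab b by (simp add: powr_divide powr_add powr_half_sqrt)
        ultimately show ?thesis using ab b G by (simp only:) (rule shell_quotient, auto)
      qed
      finally show "v n k \<le> exp \<xi> * exp (- a) * (b / a) powr (kap + 1/2) * cc (Suc n)" .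
    qed
  qed
qed

lemma v_lower_shell:
  assumes ab: "0 < a" "a < b" and xi: "\<xi> > 0"
  shows "eventually (\<lambda>n. \<forall>k\<ge>1. even (Suc n + k) \<and> (real k)\<^sup>2 \<le> 2 * a * real (Suc n) \<longrightarrow>
     exp (- \<xi>) * exp (- b) * (a / b) powr (kap + 1/2) * cc (Suc n) \<le> v n k) sequentially"
proof -
  define G where "G = Gamma (kap + 1)"
  have G: "G > 0" using Gamma_pos by (simp add: G_def)
  have b: "b > 0" using ab by simp
  have x2: "\<xi> / 2 > 0" using xi by simp
  let ?p = "(b - a) * a powr kap * exp (- b) / G"
  let ?w = "(b - a) * b powr (kap + 1/2) / (sqrt a * G)"
  have p0: "?p > 0" "?w > 0" using ab b G by auto
  have "?p * exp (- \<xi> / 2) < ?p * 1" using p0(1) xi by (intro mult_strict_left_mono) auto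
  then have "exp (- \<xi> / 2) * ?p < ?p" by (simp add: mult.commute)
  from prob_lower[OF ab this[unfolded G_def]]
  have P: "eventually (\<lambda>n. exp (- \<xi> / 2) * ?p < prob n a b) sequentially" unfolding G_def .
  show ?thesis
    using P shell_mass[OF ab x2, folded G_def, THEN eventually_sequentially_Suc[THEN iffD2]]
  proof eventually_elim
    case (elim n)
    show ?case
    proof (intro allI impI)
      fix k :: nat assume k1: "k \<ge> 1" and k: "even (Suc n + k) \<and> (real k)\<^sup>2 \<le> 2 * a * real (Suc n)"
      define S where "S = shell (Suc n) a b"
      define W where "W = (\<Sum>j\<in>S. wt j)"
      have fin: "finite S" and w: "cc (Suc n) * W \<le> exp (\<xi> / 2) * ?w"
        using elim(2) by (auto simp: S_def W_def)
      have le: "v n j \<le> v n k" if j: "j \<in> S" for j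
      proof (rule v_antimono)
        have "2 * a * real (Suc n) \<le> (real j)\<^sup>2" using j by (simp add: S_def shell_def)
        with k have "(real k)\<^sup>2 \<le> (real j)\<^sup>2" by linarith
        from power2_le_imp_le[OF this] show "k \<le> j" by simp
        show "even (k + j)" using j k by (auto simp: S_def shell_def)
      qed (rule k1)
      have wj: "wt j \<ge> 0" if "j \<in> S" for j
      proof -
        have "0 < 2 * a * real (Suc n)" using ab by simp
        also have "\<dots> \<le> (real j)\<^sup>2" using that by (simp add: S_def shell_def)
        finally have "1 \<le> j" by (cases j) auto
        then show ?thesis using wt_pos less_imp_le by blast
      qed
      have "prob n a b \<le> W * v n k"
        unfolding prob_eq[OF ab(1) fin[unfolded S_def]] W_def S_def[symmetric] sum_distrib_right
        using le wj by (intro sum_mono mult_left_mono) auto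
      then have "exp (- \<xi> / 2) * ?p \<le> W * v n k" using elim(1) by linarith
      then have "cc (Suc n) * (exp (- \<xi> / 2) * ?p) \<le> cc (Suc n) * (W * v n k)"
        by (intro mult_left_mono cc_nonneg)
      moreover have "cc (Suc n) * W * v n k \<le> exp (\<xi> / 2) * ?w * v n k"
        using w by (intro mult_right_mono v_nonneg)
      ultimately have "cc (Suc n) * (exp (- \<xi> / 2) * ?p) \<le> exp (\<xi> / 2) * ?w * v n k" by (simp add: mult_ac)
      then have "cc (Suc n) * (exp (- \<xi> / 2) * ?p) / (exp (\<xi> / 2) * ?w) \<le> v n k"
        by (intro mult_imp_div_pos_le mult_pos_pos exp_gt_zero p0(2)) (simp only: mult.commute[of "v n k"])
      moreover have "cc (Suc n) * (exp (- \<xi> / 2) * ?p) / (exp (\<xi> / 2) * ?w)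
         = exp (- \<xi>) * exp (- b) * (a / b) powr (kap + 1/2) * cc (Suc n)"
      proof -
        have "exp (- \<xi>) = exp (- \<xi> / 2) / exp (\<xi> / 2)" by (simp add: exp_diff[symmetric])
        moreover have "(a / b) powr (kap + 1/2) = a powr kap * sqrt a / b powr (kap + 1/2)"
          using ab b by (simp add: powr_divide powr_add powr_half_sqrt)
        ultimately show ?thesis using ab b G by (simp only:) (rule shell_quotient, auto)
      qed
      ultimately show "exp (- \<xi>) * exp (- b) * (a / b) powr (kap + 1/2) * cc (Suc n) \<le> v n k" by simp
    qed
  qed
qed

subsection \<open>Large starting points\<close>

text \<open>One step of the walk turns \<open>exp (s x\<^sup>2)\<close> into at most \<open>exp (s' x\<^sup>2)\<close> with \<open>s' = s + 2 s\<^sup>2\<close>,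
  that is \<open>1/s' \<ge> 1/s - 2\<close>.\<close>
lemma gaussian_moment:
  "\<exists>C>0. \<forall>n. E n (\<lambda>k. exp ((real k)\<^sup>2 / (4 * real (Suc n)))) \<le> C"
proof -
  obtain B where B: "B \<ge> 0" "\<And>k. \<bar>drift k\<bar> \<le> B" using drift_bounded by auto
  \<comment> \<open>The inequality \<open>sinh y <= y * cosh y\<close> cancels the
    \<open>1 / x\<close> in the drift against the \<open>x\<close> in \<open>y = 2 * s * x\<close>.
    The drift thus costs only a factor \<open>exp (2 * B * s)\<close>, uniformly in the
    position.\<close>
  have step: "T (\<lambda>k. exp (s * (real k)\<^sup>2)) k \<le> exp ((1 + 2 * B) * s) * exp ((s + 2 * s\<^sup>2) * (real k)\<^sup>2)"
    if s: "s \<ge> 0" and k: "k \<ge> 1" for s k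
  proof -
    define x where "x = real k"
    define y where "y = 2 * s * x"
    have x: "x \<ge> 1" using k by (simp add: x_def)
    have y: "y \<ge> 0" using s x by (simp add: y_def)
    have up: "up k = (1 + drift k / x) / 2" "dn k = (1 - drift k / x) / 2"
    proof -
      have "drift k / x = up k - dn k" using k by (simp add: drift_def x_def)
      then show "up k = (1 + drift k / x) / 2" "dn k = (1 - drift k / x) / 2" using up_dn[OF k] by auto
    qed
    have "T (\<lambda>k. exp (s * (real k)\<^sup>2)) k = up k * exp (s * (x + 1)\<^sup>2) + dn k * exp (s * (x - 1)\<^sup>2)"
      using k by (simp add: T_def x_def of_nat_diff add.commute)
    also have "\<dots> = exp (s * x\<^sup>2 + s) * (up k * exp y + dn k * exp (- y))"
      by (simp add: y_def exp_add[symmetric] distrib_left power2_eq_square algebra_simps)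
    also have "up k * exp y + dn k * exp (- y) = cosh y + drift k * (sinh y / x)"
    proof -
      have "drift k * (sinh y / x) = drift k / x * ((exp y - exp (- y)) / 2)" by (simp add: sinh_def)
      moreover have "cosh y = (exp y + exp (- y)) / 2" by (simp add: cosh_def)
      ultimately show ?thesis unfolding up by (simp only:) argo
    qed
    also have "\<dots> \<le> cosh y + B * (2 * s * cosh y)"
    proof -
      have "0 \<le> sinh y / x" using x y by simp
      then have "drift k * (sinh y / x) \<le> B * (sinh y / x)" using B(2)[of k] by (intro mult_right_mono) auto
      also have "\<dots> \<le> B * (2 * s * cosh y)"
        using sinh_real_bounds(2)[OF y] x B(1) by (intro mult_left_mono) (auto simp: y_def divide_le_eq mult_ac)
      finally show ?thesis by simp
    qed
    also have "\<dots> = (1 + 2 * B * s) * cosh y" by (simp add: algebra_simps)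
    also have "\<dots> \<le> exp (2 * B * s) * exp (y\<^sup>2 / 2)"
      using B s y exp_ge_add_one_self[of "2 * B * s"] cosh_real_bounds(2)[OF y] by (intro mult_mono) auto
    finally have "T (\<lambda>k. exp (s * (real k)\<^sup>2)) k \<le> exp (s * x\<^sup>2 + s) * (exp (2 * B * s) * exp (y\<^sup>2 / 2))"
      by simp
    also have "\<dots> = exp ((1 + 2 * B) * s) * exp ((s + 2 * s\<^sup>2) * x\<^sup>2)"
      by (simp add: y_def exp_add[symmetric] power_mult_distrib algebra_simps)
    finally show ?thesis by (simp add: x_def)
  qed
  \<comment> \<open>The exponent grows as the recursion goes back in time, so \<open>s\<close> is
    generalised. The reserve \<open>t + n\<close> shrinks by 1 per step, matching
    \<open>s + 2 * s^2\<close>, and never falls below \<open>t\<close>; therefore each step costs at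
    most \<open>(1 + 2 * B) / (2 * t)\<close>.\<close>
  have main: "E n (\<lambda>k. exp (s * (real k)\<^sup>2)) \<le> exp ((1 + (1 + 2 * B) * real n) / (2 * t))"
    if "s \<ge> 0" "t \<ge> 1" "s \<le> 1 / (2 * (t + real n))" for n s t
    using that
  proof (induction n arbitrary: s)
    case 0
    then show ?case by (simp add: E_0)
  next
    case (Suc n)
    define q where "q = t + real (Suc n)"
    have q: "q \<ge> 2" using Suc.prems by (simp add: q_def)
    have sq: "s \<le> 1 / (2 * q)" using Suc.prems by (simp add: q_def)
    have "s + 2 * s\<^sup>2 \<le> 1 / (2 * q) + 2 * (1 / (2 * q))\<^sup>2"
      using sq Suc.prems by (intro add_mono mult_left_mono power_mono) auto
    also have "\<dots> = (q + 1) / (2 * (q * q))" using q by (simp add: field_simps power2_eq_square)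
    also have "\<dots> \<le> 1 / (2 * (q - 1))"
    proof -
      have "(q + 1) * (2 * (q - 1)) \<le> 2 * (q * q)" by (simp add: algebra_simps)
      then have "q + 1 \<le> 2 * (q * q) / (2 * (q - 1))" using q by (intro mult_imp_le_div_pos) auto
      then have "q + 1 \<le> 1 / (2 * (q - 1)) * (2 * (q * q))" by simp
      then show ?thesis using q by (intro mult_imp_div_pos_le) auto
    qed
    also have "q - 1 = t + real n" by (simp add: q_def)
    finally have s': "s + 2 * s\<^sup>2 \<le> 1 / (2 * (t + real n))" .
    have "E (Suc n) (\<lambda>k. exp (s * (real k)\<^sup>2)) \<le> E n (\<lambda>k. exp ((1 + 2 * B) * s) * exp ((s + 2 * s\<^sup>2) * (real k)\<^sup>2))"
      unfolding E_Suc by (intro E_mono step Suc.prems)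
    also have "\<dots> = exp ((1 + 2 * B) * s) * E n (\<lambda>k. exp ((s + 2 * s\<^sup>2) * (real k)\<^sup>2))" by (rule E_cmult)
    also have "\<dots> \<le> exp ((1 + 2 * B) * s) * exp ((1 + (1 + 2 * B) * real n) / (2 * t))"
      using Suc.prems s' by (intro mult_left_mono Suc.IH) auto
    also have "\<dots> = exp ((1 + 2 * B) * s + (1 + (1 + 2 * B) * real n) / (2 * t))" by (simp add: exp_add)
    also have "\<dots> \<le> exp ((1 + (1 + 2 * B) * real (Suc n)) / (2 * t))"
    proof -
      have "1 / (2 * q) \<le> 1 / (2 * t)" using Suc.prems by (intro divide_left_mono) (auto simp: q_def)
      then have "(1 + 2 * B) * s \<le> (1 + 2 * B) * (1 / (2 * t))" using sq B by (intro mult_left_mono) auto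
      moreover have "(1 + 2 * B) * (1 / (2 * t)) + (1 + (1 + 2 * B) * real n) / (2 * t) = (1 + (1 + 2 * B) * real (Suc n)) / (2 * t)"
        by (simp add: add_divide_distrib[symmetric] algebra_simps)
      ultimately show ?thesis by simp
    qed
    finally show ?case .
  qed
  show ?thesis
  proof (intro exI[of _ "exp (1 + B)"] conjI allI)
    fix n
    \<comment> \<open>Taking \<open>t = n + 1\<close> admits the exponent
      \<open>1 / (4 * (n + 1))\<close> and keeps the total cost of \<open>n\<close> steps
      bounded.\<close>
    have "E n (\<lambda>k. exp (1 / (4 * real (Suc n)) * (real k)\<^sup>2)) \<le> exp ((1 + (1 + 2 * B) * real n) / (2 * real (Suc n)))"
      by (rule main) (auto simp: field_simps)
    also have "\<dots> \<le> exp (1 + B)"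
    proof -
      have "(1 + (1 + 2 * B) * real n) / (2 * real (Suc n)) \<le> (2 * (1 + B) * real (Suc n)) / (2 * real (Suc n))"
        using B by (intro divide_right_mono) (auto simp: algebra_simps)
      also have "\<dots> = 1 + B" by (simp del: of_nat_Suc)
      finally show ?thesis by simp
    qed
    finally show "E n (\<lambda>k. exp ((real k)\<^sup>2 / (4 * real (Suc n)))) \<le> exp (1 + B)" by simp
  qed simp
qed


lemma E_indicator:
  assumes "finite S" "0 \<notin> S"
  shows "E n (\<lambda>k. if k \<in> S then 1 else 0) = (\<Sum>j\<in>S. wt j * v n j)"
proof -
  have "E n (\<lambda>k. if k \<in> S then 1 else 0) = E n (\<lambda>k. \<Sum>j\<in>S. if k = j then 1 else 0)"
    using assms by (intro E_cong) simp
  also have "\<dots> = (\<Sum>j\<in>S. E n (\<lambda>k. if k = j then 1 else 0))" by (rule E_sum)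
  also have "\<dots> = (\<Sum>j\<in>S. wt j * v n j)"
    using assms by (intro sum.cong refl E_point) (metis One_nat_def Suc_leI gr0I)
  finally show ?thesis .
qed

text \<open>By monotonicity \<open>v n k\<close> is at most its average over
  \<open>[3 * k / 4, k]\<close>, whose weight is at least of order \<open>k^2 * M k\<close>. Under
  the Gaussian moment that interval costs \<open>exp (- (3/4)^2 * k^2 / (4 * m))\<close>. The
  resulting \<open>9/64\<close> exceeds the \<open>1/8\<close> of the theorem.\<close>

lemma first_hit_tail:
  "\<exists>C>0. \<exists>N. \<forall>k\<ge>N. \<forall>n. first_hit0 p k (Suc n) \<le> C / (real k)\<^sup>2 * exp (- 9 * (real k)\<^sup>2 / (64 * real (Suc n)))"
proof -
  obtain C0 where C0: "C0 > 0" "\<And>n. E n (\<lambda>k. exp ((real k)\<^sup>2 / (4 * real (Suc n)))) \<le> C0"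
    using gaussian_moment by blast
  have "eventually (\<lambda>x. real x * lm x / M x < 4 * kap) sequentially"
    using kap_pos by (intro order_tendstoD(2)[OF lam_over_M_lim]) simp
  then obtain N0 where N0: "\<And>x. x \<ge> N0 \<Longrightarrow> real x * lm x / M x < 4 * kap" by (auto simp: eventually_at_top_linorder)
  \<comment> \<open>\<open>D\<close> bounds the growth of \<open>M\<close> from
    \<open>3 * k / 4\<close> to \<open>k\<close>, and \<open>c\<close> is chosen so that
    \<open>c * 16 * (4/3) * D = 1 / (4 * kap)\<close>. In \<open>N\<close>, the summand 16 makes the
    lattice count at least \<open>k / 16\<close>, and \<open>2 * N0\<close> puts the whole window
    beyond \<open>N0\<close>.\<close>
  define D where "D = exp (4 * kap)"
  define c where "c = 3 / (256 * kap * D)"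
  have D: "D > 0" by (simp add: D_def)
  have c: "c > 0" using kap_pos D by (simp add: c_def)
  define N where "N = 2 * N0 + 16"
  have lamM: "lm x \<le> 4 * kap * M x / real x" if "x \<ge> N0" "x \<ge> 1" for x
    using N0[OF that(1)] M_pos[OF that(2)] that(2) by (simp add: field_simps)
  have grow: "M i \<le> M j * exp (4 * kap * (real i - real j) / real j)" if "j \<ge> N0" "j \<ge> 1" "i \<ge> j" for i j
    using that(3)
  proof (induction i rule: dec_induct)
    case (step i)
    have "M (Suc i) \<le> M i * (1 + 4 * kap / real i)"
      using lamM[of i] step that by (simp add: M_Suc algebra_simps)
    also have "\<dots> \<le> M i * exp (4 * kap / real j)"
    proof (intro mult_left_mono M_nonneg)
      have "1 + 4 * kap / real i \<le> 1 + 4 * kap / real j"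
        using kap_pos step that by (intro add_left_mono divide_left_mono) auto
      also have "\<dots> \<le> exp (4 * kap / real j)" by (rule exp_ge_add_one_self)
      finally show "1 + 4 * kap / real i \<le> exp (4 * kap / real j)" .
    qed
    also have "\<dots> \<le> M j * exp (4 * kap * (real i - real j) / real j) * exp (4 * kap / real j)"
      using step.IH by (intro mult_right_mono) auto
    also have "\<dots> = M j * exp (4 * kap * (real (Suc i) - real j) / real j)"
      by (simp add: mult.assoc exp_add[symmetric] add_divide_distrib[symmetric] algebra_simps)
    finally show ?case .
  qed simp
  show ?thesis
  proof (intro exI[of _ "C0 / c"] exI[of _ N] conjI allI impI)
    show "C0 / c > 0" using C0 c by simp
    fix k n :: nat assume k: "k \<ge> N"
    define m where "m = real (Suc n)"
    have m: "m > 0" by (simp add: m_def)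
    have k1: "k \<ge> 1" "real k \<ge> 16" using k by (auto simp: N_def)
    define S where "S = {j. even (k + j) \<and> 3 / 4 * real k \<le> real j \<and> real j \<le> real k}"
    have x: "1 \<le> 3 / 4 * real k" "3 / 4 * real k \<le> real k" using k1 by auto
    note card = card_parity_interval[OF x, of k, folded S_def]
    have "(real k - 3 / 4 * real k) / 2 = real k / 8" by simp
    then have cardS: "real k / 16 \<le> real (card S)" using card(1) k1(2) by linarith
    have jS: "j \<ge> N0" "j \<ge> 1" "j \<le> k" "real k \<le> 4 / 3 * real j" if "j \<in> S" for j
      using that k1 k unfolding S_def N_def mem_Collect_eq by linarith+
    have wS: "c * 16 * real k * M k \<le> wt j" if j: "j \<in> S" for j
    proof -
      note jj = jS[OF j]
      have "M k \<le> M j * exp (4 * kap * (real k - real j) / real j)" by (rule grow) (use jj in auto)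
      also have "\<dots> \<le> M j * D"
      proof -
        have "(real k - real j) / real j \<le> 1" using jj by (simp add: divide_le_eq)
        then have "4 * kap * ((real k - real j) / real j) \<le> 4 * kap * 1" using kap_pos by (intro mult_left_mono) auto
        then show ?thesis unfolding D_def by (intro mult_left_mono M_nonneg) simp
      qed
      finally have MM: "M k \<le> M j * D" .
      have "c * 16 * real k * M k \<le> c * 16 * (4 / 3 * real j) * (M j * D)"
        using c jj MM M_nonneg by (intro mult_mono) auto
      also have "\<dots> = real j * M j / (4 * kap)" using D kap_pos by (simp add: c_def field_simps)
      also have "\<dots> \<le> M j * (M j / lm j)"
      proof -
        have "real j / (4 * kap) \<le> M j / lm j"
          using N0[OF jj(1)] M_pos[OF jj(2)] lam_pos[of j] kap_pos by (simp add: field_simps)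
        then have "M j * (real j / (4 * kap)) \<le> M j * (M j / lm j)" by (intro mult_left_mono M_nonneg)
        then show ?thesis by (simp add: mult.commute)
      qed
      also have "\<dots> \<le> wt j"
      proof -
        have "M j * (M j / lm j) = (M j)\<^sup>2 / (1 * lm j)" by (simp add: power2_eq_square)
        also have "\<dots> \<le> wt j" unfolding wt_def
          using p_pos[OF jj(2)] q_pos[OF jj(2)] lam_pos[of j]
          by (intro divide_left_mono mult_right_mono) auto
        finally show ?thesis .
      qed
      finally show ?thesis .
    qed
    have z: "0 \<notin> S" using jS(2)[of 0] by auto
    have "(\<Sum>j\<in>S. wt j) * v n k \<le> E n (\<lambda>k. if k \<in> S then 1 else 0)"
      unfolding E_indicator[OF card(3) z] sum_distrib_right
    proof (intro sum_mono mult_left_mono)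
      fix j assume j: "j \<in> S"
      show "v n k \<le> v n j" using jS[OF j] j by (intro v_antimono) (auto simp: S_def)
      show "0 \<le> wt j" using wt_pos[OF jS(2)[OF j]] by simp
    qed
    also have "\<dots> \<le> E n (\<lambda>j. exp (- 9 * (real k)\<^sup>2 / (64 * m)) * exp ((real j)\<^sup>2 / (4 * m)))"
    proof (rule E_mono)
      fix j
      show "(if j \<in> S then 1 else 0) \<le> exp (- 9 * (real k)\<^sup>2 / (64 * m)) * exp ((real j)\<^sup>2 / (4 * m))"
      proof (cases "j \<in> S")
        case True
        then have "(3 / 4 * real k)\<^sup>2 \<le> (real j)\<^sup>2" unfolding S_def by (intro power_mono) auto
        then have "(3 / 4 * real k)\<^sup>2 / (4 * m) \<le> (real j)\<^sup>2 / (4 * m)" using m by (intro divide_right_mono) auto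
        moreover have "(3 / 4 * real k)\<^sup>2 / (4 * m) = 9 * (real k)\<^sup>2 / (64 * m)" by (simp add: power_mult_distrib power_divide)
        ultimately show ?thesis using True by (simp add: exp_add[symmetric])
      qed simp
    qed
    also have "\<dots> \<le> exp (- 9 * (real k)\<^sup>2 / (64 * m)) * C0"
      unfolding E_cmult m_def by (intro mult_left_mono C0) auto
    finally have up: "(\<Sum>j\<in>S. wt j) * v n k \<le> C0 * exp (- 9 * (real k)\<^sup>2 / (64 * m))" by (simp add: mult.commute)
    have "c * (real k)\<^sup>2 * M k = real k / 16 * (c * 16 * real k * M k)" by (simp add: power2_eq_square)
    also have "\<dots> \<le> real (card S) * (c * 16 * real k * M k)"
      using cardS c M_nonneg by (intro mult_right_mono) auto
    also have "\<dots> \<le> (\<Sum>j\<in>S. wt j)" by (rule sum_bounded_below[OF wS])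
    finally have "c * (real k)\<^sup>2 * M k * v n k \<le> (\<Sum>j\<in>S. wt j) * v n k"
      by (intro mult_right_mono v_nonneg)
    with up have "c * (real k)\<^sup>2 * (v n k * M k) \<le> C0 * exp (- 9 * (real k)\<^sup>2 / (64 * m))" by (simp add: mult_ac)
    then have "v n k * M k \<le> C0 * exp (- 9 * (real k)\<^sup>2 / (64 * m)) / (c * (real k)\<^sup>2)"
      using c k1 by (intro mult_imp_le_div_pos) (auto simp: mult_ac)
    then show "first_hit0 p k (Suc n) \<le> C0 / c / (real k)\<^sup>2 * exp (- 9 * (real k)\<^sup>2 / (64 * real (Suc n)))"
      unfolding first_hit0_eq[OF k1(1)] m_def by simp
  qed
qed

subsection \<open>Small starting points\<close>

text \<open>Polynomial control of \<open>cc\<close> over a bounded ratio of times, which the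
  recursion for \<open>U\<close> has to beat.\<close>

lemma cc_ratio:
  assumes A: "A \<ge> 1" and xi: "\<xi> > 0"
  shows "\<exists>N. \<forall>m\<ge>N. \<forall>m'. m \<le> m' \<and> real m' \<le> A * real m \<longrightarrow> cc m \<le> exp \<xi> * A powr (1 + kap) * cc m'"
proof -
  have x2: "\<xi> / 2 > 0" using xi by simp
  from Lf_asymp[of "1/4" "\<xi> / 2" A] x2 obtain N where
    N: "\<And>m k. m \<ge> N \<Longrightarrow> 1/4 * real m \<le> (real k)\<^sup>2 \<Longrightarrow> (real k)\<^sup>2 \<le> A * real m \<Longrightarrow>
      L k \<le> exp (\<xi> / 2) * Lf m \<and> Lf m \<le> exp (\<xi> / 2) * L k"
    unfolding eventually_at_top_linorder by auto
  show ?thesis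
  proof (intro exI[of _ "max N 1"] allI impI)
    fix m m' assume m: "max N 1 \<le> m" and m': "m \<le> m' \<and> real m' \<le> A * real m"
    \<comment> \<open>\<open>Lf_asymp\<close> compares only \<open>L k\<close> with
      \<open>Lf\<close>; an integer near \<open>sqrt m'\<close> is admissible for both times and
      links \<open>Lf m\<close> with \<open>Lf m'\<close>.\<close>
    define k where "k = nat \<lfloor>sqrt (real m')\<rfloor>"
    have s1: "sqrt (real m') \<ge> 1" using m m' by simp
    have k: "real k \<le> sqrt (real m')" "sqrt (real m') / 2 \<le> real k"
    proof -
      have "1 \<le> \<lfloor>sqrt (real m')\<rfloor>" using s1 by simp
      then have "real k \<ge> 1" "real k \<ge> sqrt (real m') - 1" "real k \<le> sqrt (real m')"
        unfolding k_def by linarith+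
      then show "real k \<le> sqrt (real m')" "sqrt (real m') / 2 \<le> real k" by linarith+
    qed
    have "(real k)\<^sup>2 \<le> (sqrt (real m'))\<^sup>2" "(sqrt (real m') / 2)\<^sup>2 \<le> (real k)\<^sup>2"
      using k s1 by (intro power_mono; simp)+
    then have k2: "(real k)\<^sup>2 \<le> real m'" "1/4 * real m' \<le> (real k)\<^sup>2" by (simp_all add: power_divide)
    have mA: "real m' \<le> A * real m'" using A by (simp add: mult_le_cancel_right1)
    have "Lf m \<le> exp (\<xi> / 2) * L k" using N[of m k] m m' k2 by linarith
    also have "\<dots> \<le> exp (\<xi> / 2) * (exp (\<xi> / 2) * Lf m')"
      using N[of m' k] m m' k2 mA by (intro mult_left_mono) auto
    finally have L: "Lf m \<le> exp \<xi> * Lf m'" by (simp add: mult.assoc[symmetric] exp_add[symmetric])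
    have P: "real m powr (-(1 + kap)) \<le> A powr (1 + kap) * real m' powr (-(1 + kap))"
    proof -
      have "real m' powr (1 + kap) \<le> (A * real m) powr (1 + kap)" using m' kap_pos by (intro powr_mono2) auto
      also have "\<dots> = A powr (1 + kap) * real m powr (1 + kap)" using A by (simp add: powr_mult)
      finally have h: "real m' powr (1 + kap) \<le> A powr (1 + kap) * real m powr (1 + kap)" .
      have pos: "real m powr (1 + kap) > 0" "real m' powr (1 + kap) > 0" using m m' by auto
      show ?thesis unfolding powr_minus using h pos by (simp add: field_simps)
    qed
    define D where "D = 2 powr (2 - kap) * kap / (K0 p \<delta> * Gamma kap)"
    have D: "D \<ge> 0" using kap_pos K0_pos Gamma_pos by (simp add: D_def)
    have "cc m = D * (real m powr (-(1 + kap)) * Lf m)" by (simp add: cc_def D_def)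
    also have "\<dots> \<le> D * ((A powr (1 + kap) * real m' powr (-(1 + kap))) * (exp \<xi> * Lf m'))"
      using P L D Lf_pos[of m] A by (intro mult_left_mono mult_mono) auto
    also have "\<dots> = exp \<xi> * A powr (1 + kap) * cc m'" by (simp add: cc_def D_def)
    finally show "cc m \<le> exp \<xi> * A powr (1 + kap) * cc m'" .
  qed
qed

text \<open>The maximum of \<open>v n\<close> over the states of the right parity.\<close>

definition U :: "nat \<Rightarrow> real" where "U n = (if even n then v n 1 else v n 2)"

lemma U_nonneg: "U n \<ge> 0" by (simp add: U_def v_nonneg)

lemma v_le_U: "k \<ge> 1 \<Longrightarrow> v n k \<le> U n"
proof (cases "even (Suc n + k)")
  case True
  assume "k \<ge> 1"
  then show ?thesis using True v_antimono[of 1 k n] v_antimono[of 2 k n]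
    by (cases "k = 1") (auto simp: U_def)
next
  case False
  then show ?thesis by (simp add: v_parity U_nonneg)
qed

lemma U_Suc_le: "U (Suc n) \<le> U n"
proof -
  have "v (Suc n) 2 \<le> v n 1" using v_le_step[of 1 n] by (simp add: numeral_2_eq_2)
  moreover have "v (Suc n) 1 = v n 2" using v_Suc[of 1 n] by (simp add: T_def numeral_2_eq_2)
  ultimately show ?thesis by (simp add: U_def)
qed

text \<open>Run the chain from 1 for \<open>s'\<close> steps. Either it is still within distance
  \<open>sqrt Y\<close>, with probability at most \<open>\<zeta>\<close>, and \<open>U n\<close> is
  the best available bound; or it is farther away and \<open>V\<close> applies. The choice of
  \<open>s'\<close> adjusts the parity so that 1 is an admissible start.\<close>

lemma U_step:
  assumes "s' = s \<or> s' = Suc s" "even (n + s')" and V: "V \<ge> 0"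
    and small: "E s' (\<lambda>k. if (real k)\<^sup>2 \<le> Y then 1 else 0) \<le> \<zeta>"
    and far: "\<And>k. even (Suc n + k) \<Longrightarrow> Y \<le> (real k)\<^sup>2 \<Longrightarrow> v n k \<le> V"
  shows "U (n + s) \<le> \<zeta> * U n + V"
proof -
  have "U (n + s) \<le> v (n + s') 1"
  proof (cases "even (n + s)")
    case True
    then have "s' = s" using assms(1,2) by auto
    then show ?thesis using True by (simp add: U_def)
  next
    case False
    then have "s' = Suc s" using assms(1,2) by auto
    then show ?thesis using False v_ge_step[of 1 "n + s"] by (simp add: U_def numeral_2_eq_2)
  qed
  also have "\<dots> = E s' (v n)" by (simp add: chapman_kolmogorov)
  also have "\<dots> \<le> E s' (\<lambda>k. U n * (if (real k)\<^sup>2 \<le> Y then 1 else 0) + V)"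
  proof (rule E_mono)
    fix k :: nat assume k: "k \<ge> 1"
    show "v n k \<le> U n * (if (real k)\<^sup>2 \<le> Y then 1 else 0) + V"
    proof (cases "(real k)\<^sup>2 \<le> Y")
      case True
      then show ?thesis using v_le_U[OF k, of n] V by simp
    next
      case False
      then show ?thesis using far[of k] V v_parity[of n k] by (cases "even (Suc n + k)") auto
    qed
  qed
  also have "\<dots> = U n * E s' (\<lambda>k. if (real k)\<^sup>2 \<le> Y then 1 else 0) + V"
    unfolding E_add E_cmult E_const ..
  also have "\<dots> \<le> U n * \<zeta> + V" using small U_nonneg by (intro add_right_mono mult_left_mono)
  finally show ?thesis by (simp add: mult.commute)
qed


text \<open>\<open>U (2 n) \<le> \<zeta> U n + O(cc n)\<close> with \<open>\<zeta>\<close> so small that the recursion beats the polynomial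
  decay of \<open>cc\<close>.\<close>

lemma U_apriori: "\<exists>B>0. eventually (\<lambda>n. U n \<le> B * cc (Suc n)) sequentially"
proof -
  \<comment> \<open>Chosen so that \<open>1 + c = 16 * exp 1\<close>. Then \<open>\<zeta> * A1 = 4 *
    exp 1 * 2 powr (1 + kap) / (16 * exp 1) powr (1 + kap)\<close>, which is at most
    \<open>1/2\<close> because \<open>(8 * exp 1) powr (1 + kap)\<close> is at least
    \<open>8 * exp 1\<close>.\<close>
  define c where "c = 16 * exp 1 - (1::real)"
  define \<zeta> where "\<zeta> = 4 * (1 + c) powr (- (kap + 1))"
  define A1 where "A1 = exp 1 * 2 powr (1 + kap)"
  define C1 where "C1 = exp 1 * exp (- (1 / (2 * c))) * 2 powr (kap + 1/2)"
  have e1: "exp 1 \<ge> (1::real)" by simp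
  have c: "c > 0" using e1 unfolding c_def by linarith
  have pos: "\<zeta> \<ge> 0" "A1 > 0" "C1 > 0" by (simp_all add: \<zeta>_def A1_def C1_def)
  have "\<zeta> * A1 \<le> 1/2"
  proof -
    have "(16 * exp 1 :: real) = 8 * exp 1 * 2" by simp
    then have "(16 * exp 1) powr (1 + kap) = (8 * exp 1) powr (1 + kap) * (2::real) powr (1 + kap)"
      by (metis exp_ge_zero mult_nonneg_nonneg powr_mult zero_le_numeral)
    moreover have "(8 * exp 1) powr (1 + kap) \<ge> (8 * exp 1 :: real) powr 1"
    proof (rule powr_mono)
      show "(1::real) \<le> 8 * exp 1" using e1 by linarith
    qed (use kap_pos in simp)
    ultimately have "8 * exp 1 * 2 powr (1 + kap) \<le> (16 * exp 1 :: real) powr (1 + kap)"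
      by (simp add: mult_right_mono)
    moreover have "\<zeta> * A1 = 4 * exp 1 * 2 powr (1 + kap) / (16 * exp 1) powr (1 + kap)"
    proof -
      have "1 + c = 16 * exp 1" by (simp add: c_def)
      then have "\<zeta> = 4 * inverse ((16 * exp 1) powr (1 + kap))"
        unfolding \<zeta>_def powr_minus by (simp only: add.commute)
      then show ?thesis by (simp add: A1_def divide_inverse)
    qed
    ultimately show ?thesis by (simp add: divide_le_eq)
  qed
  obtain N1 where N1: "\<And>s. s \<ge> N1 \<Longrightarrow> E s (\<lambda>k. if (real k)\<^sup>2 \<le> 2 / c * real (Suc s) then 1 else 0) \<le> \<zeta>"
    using prob_small[OF c] unfolding eventually_at_top_linorder \<zeta>_def by blast
  have ab: "0 < 1 / (2 * c)" "1 / (2 * c) < 1 / c" using c by (auto simp: field_simps)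
  have "(1 / c) / (1 / (2 * c)) = 2" using c by simp
  with v_upper_shell[OF ab, of 1] obtain N2 where
    N2: "\<And>n k. n \<ge> N2 \<Longrightarrow> even (Suc n + k) \<Longrightarrow> 2 * (1 / c) * real (Suc n) \<le> (real k)\<^sup>2 \<Longrightarrow> v n k \<le> C1 * cc (Suc n)"
    unfolding eventually_at_top_linorder C1_def by auto
  obtain N3 where N3: "\<And>m m'. m \<ge> N3 \<Longrightarrow> m \<le> m' \<Longrightarrow> real m' \<le> 2 * real m \<Longrightarrow> cc m \<le> A1 * cc m'"
    using cc_ratio[of 2 1] unfolding A1_def by auto
  define n0 where "n0 = Suc (max N1 (max N2 N3))"
  \<comment> \<open>The induction closes when \<open>\<zeta> * A1 * B + C1 * A1 <= B\<close>; by
    \<open>\<zeta> * A1 <= 1/2\<close> the first summand achieves this. The finite sum covers the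
    start, \<open>N < 2 * n0\<close>.\<close>
  define B where "B = 2 * C1 * A1 + (\<Sum>N<2 * n0. U N / cc (Suc N))"
  have terms: "U N / cc (Suc N) \<ge> 0" for N using U_nonneg cc_nonneg by simp
  have B: "B \<ge> 2 * C1 * A1" using sum_nonneg[of "{..<2 * n0}" "\<lambda>N. U N / cc (Suc N)"] terms by (simp add: B_def)
  have B0: "B > 0" using B pos by (smt (verit) mult_pos_pos)
  have "U N \<le> B * cc (Suc N)" if "N \<ge> n0" for N
    using that
  proof (induction N rule: less_induct)
    case (less N)
    show ?case
    proof (cases "N < 2 * n0")
      case True
      then have "U N / cc (Suc N) \<le> (\<Sum>N<2 * n0. U N / cc (Suc N))"
        using terms by (intro member_le_sum) auto
      also have "\<dots> \<le> B" using pos by (simp add: B_def)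
      finally show ?thesis using cc_pos[of "Suc N"] by (simp add: divide_le_eq)
    next
      case False
      define n where "n = N div 2"
      have n: "n \<ge> n0" "n < N" "N = n + n \<or> N = Suc (n + n)" 
      proof -
        have "n0 \<ge> 1" by (simp add: n0_def)
        with False show "n \<ge> n0" "n < N" "N = n + n \<or> N = Suc (n + n)" unfolding n_def by linarith+
      qed
      have "U N \<le> U (n + n)" using n(3) U_Suc_le[of "n + n"] by auto
      also have "\<dots> \<le> \<zeta> * U n + C1 * cc (Suc n)"
      proof (rule U_step[of n n n _ "2 / c * real (Suc n)"])
        show "E n (\<lambda>k. if (real k)\<^sup>2 \<le> 2 / c * real (Suc n) then 1 else 0) \<le> \<zeta>"
          using n by (intro N1) (simp add: n0_def)
        show "v n k \<le> C1 * cc (Suc n)" if "even (Suc n + k)" "2 / c * real (Suc n) \<le> (real k)\<^sup>2" for k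
          using n that by (intro N2) (auto simp: n0_def)
      qed (use pos cc_nonneg in auto)
      also have "\<dots> \<le> \<zeta> * (B * cc (Suc n)) + C1 * cc (Suc n)"
        using less.IH[OF n(2,1)] pos by (intro add_right_mono mult_left_mono) auto
      also have "\<dots> = (\<zeta> * B + C1) * cc (Suc n)" by (simp add: algebra_simps)
      also have "\<dots> \<le> (\<zeta> * B + C1) * (A1 * cc (Suc N))"
        using n pos B0 by (intro mult_left_mono N3) (auto simp: n0_def)
      also have "\<dots> = (\<zeta> * A1 * B + C1 * A1) * cc (Suc N)" by (simp add: algebra_simps)
      also have "\<dots> \<le> B * cc (Suc N)"
      proof (intro mult_right_mono cc_nonneg)
        have "\<zeta> * A1 * B \<le> 1/2 * B" using \<open>\<zeta> * A1 \<le> 1/2\<close> B0 by (intro mult_right_mono) auto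
        then show "\<zeta> * A1 * B + C1 * A1 \<le> B" using B by linarith
      qed
      finally show ?thesis .
    qed
  qed
  then show ?thesis using B0 unfolding eventually_at_top_linorder by blast
qed

text \<open>The a priori bound is sharpened by one short run of length about
  \<open>\<eta> * N\<close>. The chain is then mostly at distance of order \<open>sqrt N\<close>,
  where \<open>v_upper_shell\<close> gives nearly the exact constant; the rest has small probability
  and is bounded by \<open>U_apriori\<close>.\<close>

lemma U_asymp:
  assumes th: "\<theta> > 0"
  shows "eventually (\<lambda>n. U n \<le> (1 + \<theta>) * cc (Suc n)) sequentially"
proof -
  \<comment> \<open>The summand \<open>\<xi>\<close> is the part near 0, the next one comes from the
    shell estimate, and the last factor from replacing \<open>cc\<close> at time \<open>n\<close> by
    \<open>cc\<close> at time \<open>N\<close>.\<close>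
  let ?F = "\<lambda>\<xi>. (\<xi> + exp (\<xi> * (kap + 2))) * exp (\<xi> * (2 + kap))"
  have "(?F \<longlongrightarrow> (0 + exp (0 * (kap + 2))) * exp (0 * (2 + kap))) (at_right 0)"
    by (intro tendsto_intros)
  then have "eventually (\<lambda>\<xi>. ?F \<xi> < 1 + \<theta>) (at_right 0)" using th by (intro order_tendstoD(2)) auto
  moreover have "eventually (\<lambda>\<xi>::real. \<xi> > 0) (at_right 0)" by (simp add: eventually_at_right_less)
  ultimately have "eventually (\<lambda>\<xi>. ?F \<xi> < 1 + \<theta> \<and> \<xi> > 0) (at_right 0)" by eventually_elim auto
  then obtain \<xi> where F: "?F \<xi> < 1 + \<theta>" and xi: "\<xi> > 0"
    using eventually_happens'[of "at_right (0::real)"] by auto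
  obtain B n0 where B: "B > 0" and n0: "\<And>n. n \<ge> n0 \<Longrightarrow> U n \<le> B * cc (Suc n)"
    using U_apriori unfolding eventually_at_top_linorder by blast
  \<comment> \<open>Large enough, relative to the a priori constant \<open>B\<close>, that the part
    near 0 contributes at most \<open>\<xi> * cc\<close>; the bound
    \<open>(1 + c) powr (- (kap + 1)) <= 1 / c\<close> suffices.\<close>
  define c where "c = 4 * B / \<xi>"
  define \<zeta> where "\<zeta> = 4 * (1 + c) powr (- (kap + 1))"
  have c: "c > 0" using B xi by (simp add: c_def)
  have zB: "\<zeta> * B \<le> \<xi>"
  proof -
    have "(1 + c) powr (- (kap + 1)) \<le> (1 + c) powr (- 1)" using c kap_pos by (intro powr_mono) auto
    also have "\<dots> = 1 / (1 + c)" using c by (simp add: powr_minus_divide)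
    also have "\<dots> \<le> 1 / c" using c by (intro divide_left_mono) auto
    finally have "\<zeta> * B \<le> 4 * (1 / c) * B" unfolding \<zeta>_def using B by (intro mult_right_mono mult_left_mono) auto
    also have "\<dots> = \<xi>" using B xi by (simp add: c_def)
    finally show ?thesis .
  qed
  define \<eta> where "\<eta> = 1 - exp (- \<xi>)"
  have eta: "0 < \<eta>" "\<eta> < 1" using xi by (auto simp: \<eta>_def)
  \<comment> \<open>Then the shell at time \<open>n\<close> lies to the left of the threshold
    reached at time \<open>s'\<close>: from \<open>\<eta> * (n + 1) <= 2 * (s' + 1)\<close> follows
    \<open>2 * b * (n + 1) <= 2 / c * (s' + 1)\<close>.\<close>
  define b where "b = \<eta> / (2 * c)"
  define a where "a = b * exp (- \<xi>)"
  have b: "b > 0" using eta c by (simp add: b_def)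
  have ab: "0 < a" "a < b" using b xi by (auto simp: a_def)
  have ba: "b / a = exp \<xi>" using b by (simp add: a_def exp_minus inverse_eq_divide)
  obtain N1 where N1: "\<And>s. s \<ge> N1 \<Longrightarrow> E s (\<lambda>k. if (real k)\<^sup>2 \<le> 2 / c * real (Suc s) then 1 else 0) \<le> \<zeta>"
    using prob_small[OF c] unfolding eventually_at_top_linorder \<zeta>_def by blast
  obtain N2 where N2: "\<And>n k. n \<ge> N2 \<Longrightarrow> even (Suc n + k) \<Longrightarrow> 2 * b * real (Suc n) \<le> (real k)\<^sup>2 \<Longrightarrow>
      v n k \<le> exp \<xi> * exp (- a) * exp \<xi> powr (kap + 1/2) * cc (Suc n)"
    using v_upper_shell[OF ab xi] unfolding eventually_at_top_linorder ba by blast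
  define K where "K = exp (\<xi> * (kap + 2))"
  have N2': "v n k \<le> K * cc (Suc n)" if "n \<ge> N2" "even (Suc n + k)" "2 * b * real (Suc n) \<le> (real k)\<^sup>2" for n k
  proof -
    have "exp \<xi> * exp (- a) * exp \<xi> powr (kap + 1/2) = exp (\<xi> - a + \<xi> * (kap + 1/2))"
      by (simp add: powr_def exp_add[symmetric] exp_diff algebra_simps)
    also have "\<dots> \<le> K" unfolding K_def using ab xi by (simp add: algebra_simps)
    finally have "exp \<xi> * exp (- a) * exp \<xi> powr (kap + 1/2) * cc (Suc n) \<le> K * cc (Suc n)"
      by (intro mult_right_mono cc_nonneg)
    then show ?thesis using N2[OF that] by linarith
  qed
  have K: "K \<ge> 0" by (simp add: K_def)
  obtain N3 where N3: "\<And>m m'. m \<ge> N3 \<Longrightarrow> m \<le> m' \<Longrightarrow> real m' \<le> exp \<xi> * real m \<Longrightarrow> cc m \<le> exp \<xi> * exp \<xi> powr (1 + kap) * cc m'"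
    using cc_ratio[of "exp \<xi>" \<xi>] xi by auto
  have "eventually (\<lambda>N. real N \<ge> (real N1 + 1) / \<eta> \<and> real N \<ge> (real (max n0 (max N2 N3))) / (1 - \<eta>) \<and> real N \<ge> 1) sequentially"
    by (intro eventually_conj filterlim_real_sequentially[unfolded filterlim_at_top, rule_format])
  then show ?thesis
  proof eventually_elim
    case (elim N)
    define s where "s = nat \<lfloor>\<eta> * real N\<rfloor>"
    define n where "n = N - s"
    have sN0: "0 \<le> \<eta> * real N" using eta by simp
    have s: "real s \<le> \<eta> * real N" "\<eta> * real N < real s + 1" using sN0 unfolding s_def by linarith+
    have "\<eta> * real N \<le> real N" using eta by (simp add: mult_left_le_one_le)
    then have sN: "s \<le> N" using s by linarith
    then have nN: "n + s = N" "real n = real N - real s" by (auto simp: n_def)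
    have "real N1 + 1 \<le> \<eta> * real N" using elim eta by (simp add: field_simps)
    then have sN1: "s \<ge> N1" using s by linarith
    have "real (max n0 (max N2 N3)) \<le> (1 - \<eta>) * real N" using elim eta by (simp add: field_simps)
    also have "\<dots> \<le> real n" using s nN by (simp add: algebra_simps)
    finally have n: "n \<ge> n0" "n \<ge> N2" "n \<ge> N3" by auto
    define s' where "s' = (if even (n + s) then s else Suc s)"
    have s': "s' = s \<or> s' = Suc s" "even (n + s')" "s' \<ge> s" by (auto simp: s'_def)
    have "U (n + s) \<le> \<zeta> * U n + K * cc (Suc n)"
    proof (rule U_step[OF s'(1,2), where Y = "2 / c * real (Suc s')"])
      show "E s' (\<lambda>k. if (real k)\<^sup>2 \<le> 2 / c * real (Suc s') then 1 else 0) \<le> \<zeta>"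
        using sN1 s' by (intro N1) auto
      show "v n k \<le> K * cc (Suc n)" if k: "even (Suc n + k)" "2 / c * real (Suc s') \<le> (real k)\<^sup>2" for k
      proof (rule N2'[OF n(2) k(1)])
        have "\<eta> * real (Suc n) \<le> \<eta> * (2 * real N)" using elim nN eta by (intro mult_left_mono) auto
        also have "\<dots> \<le> 2 * real (Suc s')" using s s' by simp
        finally have "\<eta> * real (Suc n) / c \<le> 2 * real (Suc s') / c" using c by (intro divide_right_mono) auto
        moreover have "2 * b * real (Suc n) = \<eta> * real (Suc n) / c" by (simp add: b_def)
        moreover have "2 * real (Suc s') / c = 2 / c * real (Suc s')" by simp
        ultimately show "2 * b * real (Suc n) \<le> (real k)\<^sup>2" using k(2) by linarith
      qed
    qed (use K cc_nonneg in auto)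
    also have "\<dots> \<le> \<zeta> * (B * cc (Suc n)) + K * cc (Suc n)"
      using n0[OF n(1)] by (intro add_right_mono mult_left_mono) (auto simp: \<zeta>_def)
    also have "\<dots> = (\<zeta> * B + K) * cc (Suc n)" by (simp add: algebra_simps)
    also have "\<dots> \<le> (\<xi> + K) * cc (Suc n)" using zB by (intro mult_right_mono cc_nonneg) auto
    also have "\<dots> \<le> (\<xi> + K) * (exp \<xi> * exp \<xi> powr (1 + kap) * cc (Suc N))"
    proof (intro mult_left_mono N3)
      have "exp (- \<xi>) * real (Suc N) \<le> real (Suc n)"
        using s nN eta xi by (simp add: \<eta>_def algebra_simps add_mono)
      then have "exp \<xi> * (exp (- \<xi>) * real (Suc N)) \<le> exp \<xi> * real (Suc n)" by (intro mult_left_mono) auto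
      moreover have "exp \<xi> * (exp (- \<xi>) * real (Suc N)) = real (Suc N)"
        by (simp add: mult.assoc[symmetric] exp_add[symmetric] del: of_nat_Suc)
      ultimately show "real (Suc N) \<le> exp \<xi> * real (Suc n)" by linarith
    qed (use n nN xi K in auto)
    also have "exp \<xi> * exp \<xi> powr (1 + kap) = exp (\<xi> * (2 + kap))"
      by (simp add: powr_def exp_add[symmetric] algebra_simps)
    also have "(\<xi> + K) * (exp (\<xi> * (2 + kap)) * cc (Suc N)) = ?F \<xi> * cc (Suc N)" by (simp add: K_def)
    also have "\<dots> \<le> (1 + \<theta>) * cc (Suc N)" using F by (intro mult_right_mono cc_nonneg) auto
    finally show ?case unfolding nN .
  qed
qed

text \<open>The shell estimates hold eventually for fixed endpoints. Uniformity in \<open>k\<close>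
  comes from covering the compact range of \<open>y = k^2 / (2 * m)\<close> by finitely many
  geometric shells: for \<open>y\<close> in \<open>[g i, g (i + 1)]\<close>, the shell on its left
  gives the upper bound and the shell on its right the lower one.\<close>

lemma v_bulk:
  assumes chi: "ch > 0" and xi: "\<xi> > 0"
  shows "eventually (\<lambda>n. \<forall>k. even (Suc n + k) \<and> ch * real (Suc n) \<le> (real k)\<^sup>2 \<and> (real k)\<^sup>2 \<le> real (Suc n) / ch \<longrightarrow>
     exp (- \<xi>) * exp (- (real k)\<^sup>2 / (2 * real (Suc n))) * cc (Suc n) \<le> v n k \<and>
     v n k \<le> exp \<xi> * exp (- (real k)\<^sup>2 / (2 * real (Suc n))) * cc (Suc n)) sequentially"
proof -
  \<comment> \<open>The total logarithmic error: the slack of the shell estimate, the ratio of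
    endpoints to the power \<open>kap + 1/2\<close>, and the shift of the exponent from
    \<open>y\<close> to the far end of the neighbouring shell, where
    \<open>y <= 1 / (2 * ch)\<close>.\<close>
  let ?F = "\<lambda>\<rho>. \<rho> + \<rho> * (kap + 1/2) + 1 / (2 * ch) * (exp (2 * \<rho>) - exp (- \<rho>))"
  have "(?F \<longlongrightarrow> 0 + 0 * (kap + 1/2) + 1 / (2 * ch) * (exp (2 * 0) - exp (- 0))) (at_right 0)"
    by (intro tendsto_intros)
  then have "eventually (\<lambda>\<rho>. ?F \<rho> < \<xi>) (at_right 0)" using xi by (intro order_tendstoD(2)) auto
  moreover have "eventually (\<lambda>\<rho>::real. \<rho> > 0) (at_right 0)" by (simp add: eventually_at_right_less)
  ultimately have "eventually (\<lambda>\<rho>. ?F \<rho> < \<xi> \<and> \<rho> > 0) (at_right 0)" by eventually_elim auto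
  then obtain \<rho> where F: "?F \<rho> < \<xi>" and rho: "\<rho> > 0"
    using eventually_happens'[of "at_right (0::real)"] by auto
  define g where "g = (\<lambda>i::int. ch / 2 * exp (\<rho> * real_of_int i))"
  have g: "0 < g i" "g i < g (i + 1)" "g (i + 1) = exp \<rho> * g i" for i
    using chi rho by (auto simp: g_def exp_add[symmetric] algebra_simps)
  have q: "g (i + 1) / g i = exp \<rho>" "g i / g (i + 1) = exp (- \<rho>)" for i
    using g(1)[of i] unfolding g(3) by (simp_all add: exp_minus field_simps)
  define I where "I = \<lceil>ln (1 / ch\<^sup>2) / \<rho>\<rceil>"
  have "eventually (\<lambda>n. \<forall>i\<in>{-1..I}. \<forall>k. even (Suc n + k) \<and> 2 * g (i + 1) * real (Suc n) \<le> (real k)\<^sup>2 \<longrightarrow>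
     v n k \<le> exp \<rho> * exp (- g i) * exp \<rho> powr (kap + 1/2) * cc (Suc n)) sequentially"
    by (intro eventually_ball_finite ballI v_upper_shell[OF g(1,2) rho, unfolded q]) simp
  moreover have "eventually (\<lambda>n. \<forall>i\<in>{0..I + 1}. \<forall>k\<ge>1. even (Suc n + k) \<and> (real k)\<^sup>2 \<le> 2 * g i * real (Suc n) \<longrightarrow>
     exp (- \<rho>) * exp (- g (i + 1)) * exp (- \<rho>) powr (kap + 1/2) * cc (Suc n) \<le> v n k) sequentially"
    by (intro eventually_ball_finite ballI v_lower_shell[OF g(1,2) rho, unfolded q]) simp
  ultimately show ?thesis
  proof eventually_elim
    case (elim n)
    show ?case
    proof (intro allI impI)
      fix k assume k: "even (Suc n + k) \<and> ch * real (Suc n) \<le> (real k)\<^sup>2 \<and> (real k)\<^sup>2 \<le> real (Suc n) / ch"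
      define m where "m = real (Suc n)"
      define y where "y = (real k)\<^sup>2 / (2 * m)"
      have m: "m > 0" by (simp add: m_def)
      have "ch * m \<le> (real k)\<^sup>2" "(real k)\<^sup>2 \<le> m / ch" using k unfolding m_def by blast+
      then have y: "ch / 2 \<le> y" "y \<le> 1 / (2 * ch)" using m chi by (auto simp: y_def field_simps)
      have y0: "y > 0" using y(1) chi by linarith
      have ky: "(real k)\<^sup>2 = 2 * y * m" using m by (simp add: y_def)
      have k1: "k \<ge> 1"
      proof (rule ccontr)
        assume "\<not> k \<ge> 1" then have "y = 0" by (simp add: y_def)
        with y0 show False by simp
      qed
      define t where "t = ln (y / (ch / 2)) / \<rho>"
      define i where "i = \<lfloor>t\<rfloor>"
      have yt: "y = ch / 2 * exp (\<rho> * t)" using y0 chi rho by (simp add: t_def)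
      have t0: "t \<ge> 0" using y chi rho by (auto simp: t_def intro!: divide_nonneg_pos ln_ge_zero)
      have "y / (ch / 2) \<le> 1 / ch\<^sup>2" using y chi by (simp add: field_simps power2_eq_square)
      then have tI: "t \<le> ln (1 / ch\<^sup>2) / \<rho>" unfolding t_def using y0 chi rho
        by (intro divide_right_mono) (auto intro!: ln_mono)
      have i: "0 \<le> i" "i \<le> I" "real_of_int i \<le> t" "t < real_of_int i + 1"
        using t0 tI unfolding i_def I_def by (auto simp: floor_le_iff le_ceiling_iff) linarith+
      have gi: "g i \<le> y" "y \<le> g (i + 1)"
        unfolding yt g_def using chi rho i by (auto intro!: mult_left_mono)
      have gm: "g (i - 1) = exp (- \<rho>) * g i" using g(3)[of "i - 1"] by (simp add: exp_minus)
      have gp: "g (i + 1 + 1) = exp (2 * \<rho>) * g i" unfolding g(3) by (simp add: exp_add[symmetric] mult.assoc[symmetric])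
      have up: "v n k \<le> exp \<rho> * exp (- g (i - 1)) * exp \<rho> powr (kap + 1/2) * cc (Suc n)"
      proof -
        have "2 * g i * real (Suc n) \<le> (real k)\<^sup>2" unfolding ky m_def[symmetric] using gi m by simp
        then show ?thesis using elim(1)[rule_format, of "i - 1" k] i k by simp
      qed
      have lo: "exp (- \<rho>) * exp (- g (i + 1 + 1)) * exp (- \<rho>) powr (kap + 1/2) * cc (Suc n) \<le> v n k"
      proof -
        have "(real k)\<^sup>2 \<le> 2 * g (i + 1) * real (Suc n)" unfolding ky m_def[symmetric] using gi m by simp
        then show ?thesis using elim(2)[rule_format, of "i + 1" k] i k k1 by simp
      qed
      have ee: "exp (- \<rho>) < 1" "1 < exp (2 * \<rho>)" using rho by auto
      have mono1: "y - g (i - 1) \<le> 1 / (2 * ch) * (exp (2 * \<rho>) - exp (- \<rho>))"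
      proof -
        have "y - g (i - 1) \<le> exp \<rho> * g i - exp (- \<rho>) * g i" unfolding gm using gi g(3)[of i] by simp
        also have "\<dots> = g i * (exp \<rho> - exp (- \<rho>))" by (simp add: algebra_simps)
        also have "\<dots> \<le> 1 / (2 * ch) * (exp (2 * \<rho>) - exp (- \<rho>))"
          using gi y rho g(1)[of i] chi by (intro mult_mono) auto
        finally show ?thesis .
      qed
      have mono2: "g (i + 1 + 1) - y \<le> 1 / (2 * ch) * (exp (2 * \<rho>) - exp (- \<rho>))"
      proof -
        have "g (i + 1 + 1) - y \<le> exp (2 * \<rho>) * g i - exp (- \<rho>) * g i"
        proof -
          have "exp (- \<rho>) * g i \<le> 1 * g i" using ee g(1)[of i] by (intro mult_right_mono) auto
          then show ?thesis unfolding gp using gi by simp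
        qed
        also have "\<dots> = g i * (exp (2 * \<rho>) - exp (- \<rho>))" by (simp add: algebra_simps)
        also have "\<dots> \<le> 1 / (2 * ch) * (exp (2 * \<rho>) - exp (- \<rho>))"
          using gi y ee by (intro mult_right_mono) auto
        finally show ?thesis .
      qed
      have "exp \<rho> * exp (- g (i - 1)) * exp \<rho> powr (kap + 1/2) = exp (\<rho> - g (i - 1) + \<rho> * (kap + 1/2))"
        by (simp add: powr_def exp_add[symmetric] exp_diff algebra_simps)
      also have "\<dots> \<le> exp (\<xi> - y)" using mono1 F by simp
      also have "\<dots> = exp \<xi> * exp (- (real k)\<^sup>2 / (2 * m))" by (simp add: y_def exp_add[symmetric])
      finally have u: "v n k \<le> exp \<xi> * exp (- (real k)\<^sup>2 / (2 * m)) * cc (Suc n)"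
        using up mult_right_mono[OF _ cc_nonneg[of "Suc n"]] by (meson order_trans)
      have "exp (- \<xi>) * exp (- (real k)\<^sup>2 / (2 * m)) = exp (- \<xi> - y)" by (simp add: y_def exp_add[symmetric])
      also have "\<dots> \<le> exp (- \<rho> - g (i + 1 + 1) - \<rho> * (kap + 1/2))" using mono2 F by simp
      also have "\<dots> = exp (- \<rho>) * exp (- g (i + 1 + 1)) * exp (- \<rho>) powr (kap + 1/2)"
      proof -
        have "exp (- \<rho>) powr (kap + 1/2) = exp (- (\<rho> * (kap + 1/2)))" by (simp add: powr_def mult.commute)
        then show ?thesis by (simp only: exp_add[symmetric]) simp
      qed
      finally have l: "exp (- \<xi>) * exp (- (real k)\<^sup>2 / (2 * m)) * cc (Suc n) \<le> v n k"
        using lo mult_right_mono[OF _ cc_nonneg[of "Suc n"]] by (meson order_trans)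
      show "exp (- \<xi>) * exp (- (real k)\<^sup>2 / (2 * real (Suc n))) * cc (Suc n) \<le> v n k \<and>
        v n k \<le> exp \<xi> * exp (- (real k)\<^sup>2 / (2 * real (Suc n))) * cc (Suc n)"
        using u l unfolding m_def by blast
    qed
  qed
qed


section \<open>The three regimes of the theorem\<close>

lemma first_hit_tail_bound:
  "\<exists>c>0. \<forall>ch. 0 < ch \<and> ch < c \<longrightarrow> (\<exists>m0. \<forall>m\<ge>m0. \<forall>k. real k > sqrt (real m / ch) \<longrightarrow>
     first_hit0 p k m \<le> 1 / real m * exp (- (real k)\<^sup>2 / (8 * real m)))"
proof -
  obtain C N where C: "C > 0" and tail: "\<And>k n. k \<ge> N \<Longrightarrow>
      first_hit0 p k (Suc n) \<le> C / (real k)\<^sup>2 * exp (- 9 * (real k)\<^sup>2 / (64 * real (Suc n)))"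
    using first_hit_tail by blast
  show ?thesis
  \<comment> \<open>Below \<open>1 / C\<close> the condition \<open>k^2 > m / ch\<close> turns the
    prefactor \<open>C / k^2\<close> into at most \<open>1 / m\<close>; below 1 it also gives
    \<open>k^2 > m\<close>, hence \<open>k >= N\<close>.\<close>
  proof (intro exI[of _ "min 1 (1 / C)"] conjI allI impI)
    show "0 < min 1 (1 / C)" using C by simp
    fix ch :: real assume ch: "0 < ch \<and> ch < min 1 (1 / C)"
    show "\<exists>m0. \<forall>m\<ge>m0. \<forall>k. real k > sqrt (real m / ch) \<longrightarrow>
       first_hit0 p k m \<le> 1 / real m * exp (- (real k)\<^sup>2 / (8 * real m))"
    proof (intro exI[of _ "Suc (N\<^sup>2)"] allI impI)
      fix m k assume m: "Suc (N\<^sup>2) \<le> m" and k: "real k > sqrt (real m / ch)"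
      obtain n where n: "m = Suc n" using m by (cases m) auto
      have m0: "real m > 0" using m by simp
      have k2: "real m / ch < (real k)\<^sup>2"
      proof -
        have "(sqrt (real m / ch))\<^sup>2 < (real k)\<^sup>2" using k ch by (intro power_strict_mono) auto
        then show ?thesis using ch by simp
      qed
      have "(real N)\<^sup>2 \<le> real m" using m by (simp flip: of_nat_power)
      also have "\<dots> \<le> real m / ch" using ch m0 by (simp add: pos_le_divide_eq mult_left_le)
      finally have "(real N)\<^sup>2 \<le> (real k)\<^sup>2" using k2 by linarith
      from power2_le_imp_le[OF this] have kN: "k \<ge> N" by simp
      have kp: "(real k)\<^sup>2 > 0" using k2 m0 ch by (meson divide_pos_pos less_trans)
      have "C * real m \<le> (real k)\<^sup>2"
      proof -
        have "C * ch \<le> 1" using ch C by (auto simp: field_simps)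
        then have "real m / ch * (C * ch) \<le> real m / ch * 1" using m0 ch by (intro mult_left_mono) auto
        then show ?thesis using k2 ch by (simp add: mult.commute)
      qed
      then have "C / (real k)\<^sup>2 \<le> 1 / real m" using kp m0 by (simp add: field_simps)
      moreover have "exp (- 9 * (real k)\<^sup>2 / (64 * real m)) \<le> exp (- (real k)\<^sup>2 / (8 * real m))"
        using m0 by (simp add: field_simps)
      ultimately have "C / (real k)\<^sup>2 * exp (- 9 * (real k)\<^sup>2 / (64 * real m)) \<le> 1 / real m * exp (- (real k)\<^sup>2 / (8 * real m))"
        using m0 by (intro mult_mono) auto
      then show "first_hit0 p k m \<le> 1 / real m * exp (- (real k)\<^sup>2 / (8 * real m))"
        using tail[OF kN, of n] unfolding n by linarith
    qed
  qed
qed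

text \<open>The upper bound comes from \<open>U_asymp\<close>. The lower bound uses a shell just to
  the right of \<open>sqrt (ch * m)\<close>; its loss \<open>exp (- b)\<close> is what forces
  \<open>ch\<close> to be small.\<close>

lemma first_hit_near:
  assumes th: "\<theta> > 0"
  shows "\<exists>c>0. \<forall>ch. 0 < ch \<and> ch < c \<longrightarrow> (\<exists>m0. \<forall>m\<ge>m0. \<forall>k. 1 \<le> k \<and> real k < sqrt (ch * real m) \<and> even (m + k) \<longrightarrow>
     (1 - \<theta>) * cc m * M k \<le> first_hit0 p k m \<and> first_hit0 p k m \<le> (1 + \<theta>) * cc m * M k)"
proof -
  \<comment> \<open>The lower bound loses the exponent
    \<open>\<xi> + b + \<xi> * (kap + 1/2)\<close>, which is at most
    \<open>\<xi> * (kap + 3) = \<theta>\<close> because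
    \<open>ch < 2 * \<xi> * exp (- \<xi>)\<close> gives \<open>b < \<xi>\<close>.\<close>
  define \<xi> where "\<xi> = \<theta> / (kap + 3)"
  have xi: "\<xi> > 0" using th kap_pos by (simp add: \<xi>_def)
  have xth: "\<xi> * (kap + 3) = \<theta>" using kap_pos by (simp add: \<xi>_def)
  show ?thesis
  proof (intro exI[of _ "2 * \<xi> * exp (- \<xi>)"] conjI allI impI)
    show "0 < 2 * \<xi> * exp (- \<xi>)" using xi by simp
    fix ch :: real assume ch: "0 < ch \<and> ch < 2 * \<xi> * exp (- \<xi>)"
    define a where "a = ch / 2"
    define b where "b = a * exp \<xi>"
    have ab: "0 < a" "a < b" using ch xi by (auto simp: a_def b_def)
    have aq: "a / b = exp (- \<xi>)" using ab by (simp add: b_def exp_minus inverse_eq_divide)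
    have "b < \<xi> * exp (- \<xi>) * exp \<xi>" unfolding b_def a_def using ch by (intro mult_strict_right_mono) auto
    then have bx: "b < \<xi>" by (simp add: mult.assoc exp_add[symmetric])
    have low: "1 - \<theta> \<le> exp (- \<xi>) * exp (- b) * (a / b) powr (kap + 1/2)"
    proof -
      have "1 - \<theta> \<le> exp (- \<theta>)" using exp_ge_add_one_self[of "- \<theta>"] by simp
      also have "\<dots> \<le> exp (- \<xi> - b - \<xi> * (kap + 1/2))"
        unfolding xth[symmetric] using bx xi by (simp add: algebra_simps)
      also have "\<dots> = exp (- \<xi>) * exp (- b) * (a / b) powr (kap + 1/2)"
      proof -
        have "exp (- \<xi>) powr (kap + 1/2) = exp (- (\<xi> * (kap + 1/2)))" by (simp add: powr_def mult.commute)
        then show ?thesis unfolding aq by (simp only: exp_add[symmetric]) simp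
      qed
      finally show ?thesis .
    qed
    have "eventually (\<lambda>n. \<forall>k. 1 \<le> k \<and> real k < sqrt (ch * real (Suc n)) \<and> even (Suc n + k) \<longrightarrow>
       (1 - \<theta>) * cc (Suc n) * M k \<le> first_hit0 p k (Suc n) \<and> first_hit0 p k (Suc n) \<le> (1 + \<theta>) * cc (Suc n) * M k) sequentially"
      using v_lower_shell[OF ab xi] U_asymp[OF th]
    proof eventually_elim
      case (elim n)
      show ?case
      proof (intro allI impI)
        fix k assume k: "1 \<le> k \<and> real k < sqrt (ch * real (Suc n)) \<and> even (Suc n + k)"
        have "(real k)\<^sup>2 \<le> ch * real (Suc n)" using k ch by (intro sqrt_ge_absD) simp
        then have "(real k)\<^sup>2 \<le> 2 * a * real (Suc n)" by (simp add: a_def)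
        then have l: "exp (- \<xi>) * exp (- b) * (a / b) powr (kap + 1/2) * cc (Suc n) \<le> v n k"
          using elim(1) k by blast
        have "(1 - \<theta>) * cc (Suc n) \<le> v n k"
          using mult_right_mono[OF low cc_nonneg[of "Suc n"]] l by linarith
        moreover have "v n k \<le> (1 + \<theta>) * cc (Suc n)" using v_le_U[of k n] k elim(2) by linarith
        ultimately show "(1 - \<theta>) * cc (Suc n) * M k \<le> first_hit0 p k (Suc n) \<and> first_hit0 p k (Suc n) \<le> (1 + \<theta>) * cc (Suc n) * M k"
          using first_hit0_eq[of k n] k M_nonneg by (auto intro!: mult_right_mono)
      qed
    qed
    then show "\<exists>m0. \<forall>m\<ge>m0. \<forall>k. 1 \<le> k \<and> real k < sqrt (ch * real m) \<and> even (m + k) \<longrightarrow>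
       (1 - \<theta>) * cc m * M k \<le> first_hit0 p k m \<and> first_hit0 p k m \<le> (1 + \<theta>) * cc m * M k"
      unfolding eventually_at_top_linorder[symmetric] by (rule eventually_sequentially_Suc[THEN iffD1])
  qed
qed

lemma first_hit_bulk:
  assumes th: "\<theta> > 0" and chi: "ch > 0"
  shows "\<exists>m0. \<forall>m\<ge>m0. \<forall>k. sqrt (real m * ch) \<le> real k \<and> real k \<le> sqrt (real m / ch) \<and> even (m + k) \<longrightarrow>
     (1 - \<theta>) * (2 / (Gamma kap * real m)) * ((real k)\<^sup>2 / (2 * real m)) powr kap * exp (- (real k)\<^sup>2 / (2 * real m))
       \<le> first_hit0 p k m \<and>
     first_hit0 p k m \<le>
     (1 + \<theta>) * (2 / (Gamma kap * real m)) * ((real k)\<^sup>2 / (2 * real m)) powr kap * exp (- (real k)\<^sup>2 / (2 * real m))"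
proof -
  \<comment> \<open>The bounds for \<open>v n k\<close> and for \<open>cc m * M k\<close> each cost
    a factor \<open>exp \<xi>\<close>; their product is \<open>1 + \<theta>\<close>, whose inverse
    is at least \<open>1 - \<theta>\<close>.\<close>
  define \<xi> where "\<xi> = ln (1 + \<theta>) / 2"
  have xi: "\<xi> > 0" using th by (simp add: \<xi>_def)
  have e1: "exp \<xi> * exp \<xi> = 1 + \<theta>" using th by (simp add: \<xi>_def exp_add[symmetric])
  have e2: "1 - \<theta> \<le> exp (- \<xi>) * exp (- \<xi>)"
  proof -
    have "exp (- \<xi>) * exp (- \<xi>) = 1 / (1 + \<theta>)" unfolding e1[symmetric] by (simp add: exp_minus field_simps)
    moreover have "(1 - \<theta>) * (1 + \<theta>) \<le> 1" by (simp add: algebra_simps)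
    ultimately show ?thesis using th by (simp add: pos_le_divide_eq)
  qed
  let ?T = "\<lambda>m k. 2 / (Gamma kap * real m) * ((real k)\<^sup>2 / (2 * real m)) powr kap * exp (- (real k)\<^sup>2 / (2 * real m))"
  have "eventually (\<lambda>n. \<forall>k. sqrt (real (Suc n) * ch) \<le> real k \<and> real k \<le> sqrt (real (Suc n) / ch) \<and> even (Suc n + k) \<longrightarrow>
     (1 - \<theta>) * ?T (Suc n) k \<le> first_hit0 p k (Suc n) \<and> first_hit0 p k (Suc n) \<le> (1 + \<theta>) * ?T (Suc n) k) sequentially"
    using v_bulk[OF chi xi] eventually_sequentially_Suc[THEN iffD2, OF M_uniform[OF chi xi, of "1 / ch"]]
  proof eventually_elim
    case (elim n)
    show ?case
    proof (intro allI impI)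
      fix k assume k: "sqrt (real (Suc n) * ch) \<le> real k \<and> real k \<le> sqrt (real (Suc n) / ch) \<and> even (Suc n + k)"
      define m where "m = Suc n"
      have m: "real m > 0" by (simp add: m_def)
      have ka: "ch * real m \<le> (real k)\<^sup>2" using k by (auto simp: m_def mult.commute intro: sqrt_le_D)
      have kb: "(real k)\<^sup>2 \<le> real m / ch" using k unfolding m_def by (intro sqrt_ge_absD) simp
      have kb': "(real k)\<^sup>2 \<le> 1 / ch * real m" using kb by simp
      have k0: "(real k)\<^sup>2 > 0" using ka mult_pos_pos[OF chi m] by linarith
      then have k1: "k \<ge> 1" by (cases k) auto
      define g where "g = exp (- (real k)\<^sup>2 / (2 * real m))"
      define Q where "Q = 2 powr (1 - kap) / Gamma kap * real m powr (-(1 + kap)) * real k powr (2 * kap)"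
      have g: "g > 0" by (simp add: g_def)
      have V: "exp (- \<xi>) * g * cc m \<le> v n k" "v n k \<le> exp \<xi> * g * cc m"
        using elim(1) k ka kb unfolding m_def g_def by blast+
      have MQ: "exp (- \<xi>) * Q \<le> cc m * M k" "cc m * M k \<le> exp \<xi> * Q"
        using elim(2) ka kb' unfolding m_def Q_def by blast+
      have Qpos: "Q > 0" using m k1 Gamma_pos by (simp add: Q_def)
      have TQ: "?T m k = g * Q"
      proof -
        have "((real k)\<^sup>2 / (2 * real m)) powr kap = real k powr (2 * kap) * 2 powr (- kap) * real m powr (- kap)"
        proof -
          have "((real k)\<^sup>2) powr kap = real k powr (2 * kap)"
            using k1 by (simp add: powr_powr powr_numeral[symmetric] del: powr_numeral)
          then show ?thesis using m by (simp add: powr_divide powr_mult powr_minus field_simps)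
        qed
        moreover have "2 powr (1 - kap) = 2 * 2 powr (- kap)" by (simp add: powr_diff powr_minus field_simps)
        moreover have "real m powr (-(1 + kap)) = real m powr (- kap) / real m"
        proof -
          have "-(1 + kap) = - kap + - 1" by simp
          then have "real m powr (-(1 + kap)) = real m powr (- kap + - 1)" by (simp only:)
          also have "\<dots> = real m powr (- kap) * real m powr (- 1)" by (rule powr_add)
          finally show ?thesis using m by (simp add: powr_minus_divide)
        qed
        ultimately show ?thesis unfolding Q_def g_def by simp
      qed
      have f: "first_hit0 p k m = v n k * M k" unfolding m_def by (rule first_hit0_eq[OF k1])
      have lower: "(1 - \<theta>) * ?T m k \<le> first_hit0 p k m"
      proof -
        have "(1 - \<theta>) * (g * Q) \<le> exp (- \<xi>) * exp (- \<xi>) * (g * Q)"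
          using e2 g Qpos by (intro mult_right_mono) auto
        also have "\<dots> = exp (- \<xi>) * g * (exp (- \<xi>) * Q)" by simp
        also have "\<dots> \<le> exp (- \<xi>) * g * (cc m * M k)" using MQ g by (intro mult_left_mono) auto
        also have "\<dots> = exp (- \<xi>) * g * cc m * M k" by simp
        also have "\<dots> \<le> v n k * M k" using V by (intro mult_right_mono M_nonneg)
        finally show ?thesis unfolding TQ f .
      qed
      have upper: "first_hit0 p k m \<le> (1 + \<theta>) * ?T m k"
      proof -
        have "v n k * M k \<le> exp \<xi> * g * cc m * M k" using V by (intro mult_right_mono M_nonneg)
        also have "\<dots> = exp \<xi> * g * (cc m * M k)" by simp
        also have "\<dots> \<le> exp \<xi> * g * (exp \<xi> * Q)" using MQ g by (intro mult_left_mono) auto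
        also have "\<dots> = exp \<xi> * exp \<xi> * (g * Q)" by simp
        finally show ?thesis unfolding TQ f e1 .
      qed
      show "(1 - \<theta>) * ?T (Suc n) k \<le> first_hit0 p k (Suc n) \<and> first_hit0 p k (Suc n) \<le> (1 + \<theta>) * ?T (Suc n) k"
        using lower upper unfolding m_def by blast
    qed
  qed
  then have "eventually (\<lambda>m. \<forall>k. sqrt (real m * ch) \<le> real k \<and> real k \<le> sqrt (real m / ch) \<and> even (m + k) \<longrightarrow>
     (1 - \<theta>) * ?T m k \<le> first_hit0 p k m \<and> first_hit0 p k m \<le> (1 + \<theta>) * ?T m k) sequentially"
    by (rule eventually_sequentially_Suc[THEN iffD1])
  then show ?thesis unfolding eventually_at_top_linorder mult.assoc .
qed

end

theorem theorem2p2: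
  fixes p :: "nat \<Rightarrow> real" and \<delta> \<epsilon> :: real
  assumes delta: "\<delta> > -1"
    and eps_pos: "\<epsilon> > 0"
    and ellip: "\<And>x. x \<ge> 1 \<Longrightarrow> \<epsilon> \<le> p x \<and> p x \<le> 1 - \<epsilon>"
    and R_small: "(\<lambda>x. real x * Rterm p \<delta> x) \<longlonglongrightarrow> 0"
  shows "\<forall>\<theta>>0. \<exists>chi0>0. \<forall>chi. 0 < chi \<and> chi < chi0 \<longrightarrow> (\<exists>m0::nat. \<forall>m\<ge>m0.
     (\<forall>k::nat. 1 \<le> k \<and> real k < sqrt (chi * real m) \<and> even (m + k) \<longrightarrow>
        (1 - \<theta>) * (2 powr (2 - kappa \<delta>) * kappa \<delta> / (K0 p \<delta> * Gamma (kappa \<delta>)))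
            * real m powr (-(1 + kappa \<delta>)) * Lfun p \<delta> (sqrt (real m)) * Mfun p k
          \<le> first_hit0 p k m \<and>
        first_hit0 p k m \<le>
        (1 + \<theta>) * (2 powr (2 - kappa \<delta>) * kappa \<delta> / (K0 p \<delta> * Gamma (kappa \<delta>)))
            * real m powr (-(1 + kappa \<delta>)) * Lfun p \<delta> (sqrt (real m)) * Mfun p k)
   \<and> (\<forall>k::nat. sqrt (real m * chi) \<le> real k \<and> real k \<le> sqrt (real m / chi) \<and> even (m + k) \<longrightarrow>
        (1 - \<theta>) * (2 / (Gamma (kappa \<delta>) * real m)) * ((real k)\<^sup>2 / (2 * real m)) powr kappa \<delta>
            * exp (- (real k)\<^sup>2 / (2 * real m))
          \<le> first_hit0 p k m \<and>
        first_hit0 p k m \<le>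
        (1 + \<theta>) * (2 / (Gamma (kappa \<delta>) * real m)) * ((real k)\<^sup>2 / (2 * real m)) powr kappa \<delta>
            * exp (- (real k)\<^sup>2 / (2 * real m)))
   \<and> (\<forall>k::nat. real k > sqrt (real m / chi) \<and> even (m + k) \<longrightarrow>
        first_hit0 p k m \<le> 1 / real m * exp (- (real k)\<^sup>2 / (8 * real m))))"
proof (intro allI impI)
  fix \<theta> :: real assume th: "\<theta> > 0"
  interpret bessel_walk p \<delta> \<epsilon>
    using delta eps_pos ellip R_small by unfold_locales auto
  obtain c1 where c1: "c1 > 0" and near: "\<And>ch. 0 < ch \<Longrightarrow> ch < c1 \<Longrightarrow> \<exists>m0. \<forall>m\<ge>m0. \<forall>k. 1 \<le> k \<and> real k < sqrt (ch * real m) \<and> even (m + k) \<longrightarrow>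
     (1 - \<theta>) * cc m * M k \<le> first_hit0 p k m \<and> first_hit0 p k m \<le> (1 + \<theta>) * cc m * M k"
    using first_hit_near[OF th] by blast
  obtain c2 where c2: "c2 > 0" and far: "\<And>ch. 0 < ch \<Longrightarrow> ch < c2 \<Longrightarrow> \<exists>m0. \<forall>m\<ge>m0. \<forall>k. real k > sqrt (real m / ch) \<longrightarrow>
     first_hit0 p k m \<le> 1 / real m * exp (- (real k)\<^sup>2 / (8 * real m))"
    using first_hit_tail_bound by blast
  have cc_eq: "t * (2 powr (2 - kap) * kap / (K0 p \<delta> * Gamma kap)) * real m powr (-(1 + kap)) * Lfun p \<delta> (sqrt (real m)) * M k
      = t * cc m * M k" for t m k
    by (simp add: cc_def Lf_def)
  show "\<exists>chi0>0. \<forall>chi. 0 < chi \<and> chi < chi0 \<longrightarrow> (\<exists>m0::nat. \<forall>m\<ge>m0.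
     (\<forall>k::nat. 1 \<le> k \<and> real k < sqrt (chi * real m) \<and> even (m + k) \<longrightarrow>
        (1 - \<theta>) * (2 powr (2 - kappa \<delta>) * kappa \<delta> / (K0 p \<delta> * Gamma (kappa \<delta>)))
            * real m powr (-(1 + kappa \<delta>)) * Lfun p \<delta> (sqrt (real m)) * Mfun p k
          \<le> first_hit0 p k m \<and>
        first_hit0 p k m \<le>
        (1 + \<theta>) * (2 powr (2 - kappa \<delta>) * kappa \<delta> / (K0 p \<delta> * Gamma (kappa \<delta>)))
            * real m powr (-(1 + kappa \<delta>)) * Lfun p \<delta> (sqrt (real m)) * Mfun p k)
   \<and> (\<forall>k::nat. sqrt (real m * chi) \<le> real k \<and> real k \<le> sqrt (real m / chi) \<and> even (m + k) \<longrightarrow>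
        (1 - \<theta>) * (2 / (Gamma (kappa \<delta>) * real m)) * ((real k)\<^sup>2 / (2 * real m)) powr kappa \<delta>
            * exp (- (real k)\<^sup>2 / (2 * real m))
          \<le> first_hit0 p k m \<and>
        first_hit0 p k m \<le>
        (1 + \<theta>) * (2 / (Gamma (kappa \<delta>) * real m)) * ((real k)\<^sup>2 / (2 * real m)) powr kappa \<delta>
            * exp (- (real k)\<^sup>2 / (2 * real m)))
   \<and> (\<forall>k::nat. real k > sqrt (real m / chi) \<and> even (m + k) \<longrightarrow>
        first_hit0 p k m \<le> 1 / real m * exp (- (real k)\<^sup>2 / (8 * real m))))"
    unfolding cc_eq
  \<comment> \<open>Only (i) and (iii) restrict \<open>ch\<close>; the bulk estimate is available
    for every positive value.\<close>
  proof (intro exI[of _ "min c1 c2"] conjI[of "0 < min c1 c2"] allI impI)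
    show "0 < min c1 c2" using c1 c2 by simp
    fix ch :: real assume ch: "0 < ch \<and> ch < min c1 c2"
    obtain m1 where m1: "\<And>m k. m \<ge> m1 \<Longrightarrow> 1 \<le> k \<and> real k < sqrt (ch * real m) \<and> even (m + k) \<Longrightarrow>
       (1 - \<theta>) * cc m * M k \<le> first_hit0 p k m \<and> first_hit0 p k m \<le> (1 + \<theta>) * cc m * M k"
      using near[of ch] ch by auto
    obtain m2 where m2: "\<And>m k. m \<ge> m2 \<Longrightarrow> real k > sqrt (real m / ch) \<Longrightarrow>
       first_hit0 p k m \<le> 1 / real m * exp (- (real k)\<^sup>2 / (8 * real m))"
      using far[of ch] ch by auto
    obtain m3 where m3: "\<forall>m\<ge>m3. \<forall>k. sqrt (real m * ch) \<le> real k \<and> real k \<le> sqrt (real m / ch) \<and> even (m + k) \<longrightarrow>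
       (1 - \<theta>) * (2 / (Gamma kap * real m)) * ((real k)\<^sup>2 / (2 * real m)) powr kap * exp (- (real k)\<^sup>2 / (2 * real m))
         \<le> first_hit0 p k m \<and>
       first_hit0 p k m \<le>
       (1 + \<theta>) * (2 / (Gamma kap * real m)) * ((real k)\<^sup>2 / (2 * real m)) powr kap * exp (- (real k)\<^sup>2 / (2 * real m))"
      using first_hit_bulk[OF th, of ch] ch by blast
    show "\<exists>m0::nat. \<forall>m\<ge>m0.
       (\<forall>k::nat. 1 \<le> k \<and> real k < sqrt (ch * real m) \<and> even (m + k) \<longrightarrow>
          (1 - \<theta>) * cc m * M k \<le> first_hit0 p k m \<and> first_hit0 p k m \<le> (1 + \<theta>) * cc m * M k)
     \<and> (\<forall>k::nat. sqrt (real m * ch) \<le> real k \<and> real k \<le> sqrt (real m / ch) \<and> even (m + k) \<longrightarrow>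
       (1 - \<theta>) * (2 / (Gamma kap * real m)) * ((real k)\<^sup>2 / (2 * real m)) powr kap * exp (- (real k)\<^sup>2 / (2 * real m))
         \<le> first_hit0 p k m \<and>
       first_hit0 p k m \<le>
       (1 + \<theta>) * (2 / (Gamma kap * real m)) * ((real k)\<^sup>2 / (2 * real m)) powr kap * exp (- (real k)\<^sup>2 / (2 * real m)))
     \<and> (\<forall>k::nat. real k > sqrt (real m / ch) \<and> even (m + k) \<longrightarrow>
          first_hit0 p k m \<le> 1 / real m * exp (- (real k)\<^sup>2 / (8 * real m)))"
      by (intro exI[of _ "max m1 (max m2 m3)"] allI impI conjI m3[rule_format] m1 m2) (use m1 in auto)
  qed
qed

end
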